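(* Let $(X,\mathcal{X},\mu,\mathcal{E},\mathcal{F})$ be a Dirichlet structure with associated carré du champ operator $\gamma:\mathcal{F}\times\mathcal{F}\to L^1(X,\mu)$. Then for any $n\in\mathbb{N}$ and any $\phi=(\phi_1,\ldots,\phi_n)\in\mathcal{F}^n$, with carré du champ matrix $\gamma(\phi)=[\gamma(\phi_i,\phi_j)]_{1\le i,j\le n}$, we have $$\phi_*\big(\mathbf{1}_{\{\det(\gamma(\phi))>0\}}\cdot\mu\big)\ll\mathcal{L}_n,$$ where $\mathcal{L}_n$ is the Lebesgue measure on $\mathbb{R}^n$.
   Context: A Dirichlet structure $(X,\mathcal{X},\mu,\mathcal{E},\mathcal{F})$ is a probability space $(X,\mathcal{X},\mu)$ together with a quadratic form $(\mathcal{E},\mathcal{F})$ on $L^2(X,\mu)$ such that: (i) $\mathcal{F}$ is a dense linear subspace of $L^2(X,\mu)$, $\mathcal{E}:\mathcal{F}\times\mathcal{F}\to\mathbb{R}$ is bilinear (and symmetric), and $\mathcal{E}(f,f)\ge 0$ for all $f\in\mathcal{F}$; (ii) $\mathcal{F}$ is a Hilbert space under the inner product $\mathcal{E}_1(f,g)=\mathcal{E}(f,g)+\langle f,g\rangle_{L^2(\mu)}$; (iii) (Markovian property) $f\in\mathcal{F}$ implies $\widetilde f:=0\vee(f\wedge 1)\in\mathcal{F}$ and $\mathcal{E}(\widetilde f,\widetilde f)\le\mathcal{E}(f,f)$; (iv) the constant function $\mathbf{1}$ is in $\mathcal{F}$ and $\mathcal{E}(\mathbf{1},\mathbf{1})=0$;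 (v) for every $f\in\mathcal{F}\cap L^\infty(\mu)$ there is $\gamma(f,f)\in L^1(\mu)$ such that for all $h\in\mathcal{F}\cap L^\infty(\mu)$, $\mathcal{E}(fh,f)-\frac12\mathcal{E}(h,f^2)=\int h\,\gamma(f,f)\,d\mu$; (vi) (strong locality) for all $f,g\in\mathcal{F}$ and $a\in\mathbb{R}$, $(f+a)g=0$ implies $\mathcal{E}(f,g)=0$. The carré du champ operator is the unique positive symmetric continuous bilinear form $\gamma:\mathcal{F}\times\mathcal{F}\to L^1(\mu)$ with $\frac12\mathcal{E}(fh,g)+\frac12\mathcal{E}(gh,f)-\frac12\mathcal{E}(h,fg)=\int h\,\gamma(f,g)\,d\mu$ for all $f,g,h\in\mathcal{F}\cap L^\infty(\mu)$ (its existence and uniqueness are known). For a measure $\mu$ and a nonnegative measurable function $u$, $u\cdot\mu$ is the measure $A\mapsto\int_A u\,d\mu$; $\phi_*$ denotes pushforward of measures and $\ll$ absolute continuity. *)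

theory Defs
  imports "HOL-Probability.Probability"
begin

text \<open>
  Elements of \<open>L\<^sup>p(M)\<close> are represented by measurable functions, so equalities
  between them are almost-everywhere equalities. A subspace of \<open>L\<^sup>2(M)\<close> is a set of
  representatives closed under almost-everywhere equality, and maps defined on it must not
  depend on the representative.
\<close>

definition L2_space :: "'a measure \<Rightarrow> ('a \<Rightarrow> real) set" where
  "L2_space M = {f \<in> borel_measurable M. integrable M (\<lambda>x. (f x)\<^sup>2)}"

definition Linf_space :: "'a measure \<Rightarrow> ('a \<Rightarrow> real) set" where
  "Linf_space M = {f \<in> borel_measurable M. \<exists>C. AE x in M. \<bar>f x\<bar> \<le> C}"

definition energy_inner ::
  "'a measure \<Rightarrow> (('a \<Rightarrow> real) \<Rightarrow> ('a \<Rightarrow> real) \<Rightarrow> real) \<Rightarrow> ('a \<Rightarrow> real) \<Rightarrow> ('a \<Rightarrow> real) \<Rightarrow> real" where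
  "energy_inner M \<E> f g = \<E> f g + (\<integral>x. f x * g x \<partial>M)"

definition energy_dist ::
  "'a measure \<Rightarrow> (('a \<Rightarrow> real) \<Rightarrow> ('a \<Rightarrow> real) \<Rightarrow> real) \<Rightarrow> ('a \<Rightarrow> real) \<Rightarrow> ('a \<Rightarrow> real) \<Rightarrow> real" where
  "energy_dist M \<E> f g = sqrt (energy_inner M \<E> (\<lambda>x. f x - g x) (\<lambda>x. f x - g x))"

text \<open>
  The values of \<open>\<E>\<close> outside \<open>\<F> \<times> \<F>\<close> are irrelevant. The products of functions in
  \<open>\<F> \<inter> L\<^sup>\<infinity>\<close> to which \<open>\<E>\<close> is applied below lie in \<open>\<F>\<close>, because
  \<open>\<F> \<inter> L\<^sup>\<infinity>\<close> is an algebra as a consequence of the linearity, completeness and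
  Markov axioms. Positive definiteness of \<open>energy_inner\<close> up to
  null sets is automatic, so the Hilbert space axiom amounts to completeness.
\<close>

locale dirichlet_structure = prob_space M for M :: "'a measure" +
  fixes \<E> :: "('a \<Rightarrow> real) \<Rightarrow> ('a \<Rightarrow> real) \<Rightarrow> real"
    and \<F> :: "('a \<Rightarrow> real) set"
  assumes dom_L2: "\<F> \<subseteq> L2_space M"
    and dom_AE: "\<And>f g. f \<in> \<F> \<Longrightarrow> g \<in> borel_measurable M \<Longrightarrow> (AE x in M. f x = g x) \<Longrightarrow> g \<in> \<F>"
    and dom_add: "\<And>f g. f \<in> \<F> \<Longrightarrow> g \<in> \<F> \<Longrightarrow> (\<lambda>x. f x + g x) \<in> \<F>"
    and dom_scale: "\<And>c f. f \<in> \<F> \<Longrightarrow> (\<lambda>x. c * f x) \<in> \<F>"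
    and dom_dense: "\<And>f e. f \<in> L2_space M \<Longrightarrow> 0 < e \<Longrightarrow>
          \<exists>g\<in>\<F>. sqrt (\<integral>x. (f x - g x)\<^sup>2 \<partial>M) < e"
    and form_AE: "\<And>f g h. f \<in> \<F> \<Longrightarrow> g \<in> \<F> \<Longrightarrow> h \<in> \<F> \<Longrightarrow> (AE x in M. f x = g x) \<Longrightarrow> \<E> f h = \<E> g h"
    and form_sym: "\<And>f g. f \<in> \<F> \<Longrightarrow> g \<in> \<F> \<Longrightarrow> \<E> f g = \<E> g f"
    and form_add: "\<And>f g h. f \<in> \<F> \<Longrightarrow> g \<in> \<F> \<Longrightarrow> h \<in> \<F> \<Longrightarrow> \<E> (\<lambda>x. f x + g x) h = \<E> f h + \<E> g h"
    and form_scale: "\<And>c f g. f \<in> \<F> \<Longrightarrow> g \<in> \<F> \<Longrightarrow> \<E> (\<lambda>x. c * f x) g = c * \<E> f g"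
    and form_nonneg: "\<And>f. f \<in> \<F> \<Longrightarrow> 0 \<le> \<E> f f"
    and complete: "\<And>u :: nat \<Rightarrow> 'a \<Rightarrow> real. (\<And>n. u n \<in> \<F>) \<Longrightarrow>
          (\<And>e. 0 < e \<Longrightarrow> \<exists>N. \<forall>m\<ge>N. \<forall>n\<ge>N. energy_dist M \<E> (u m) (u n) < e) \<Longrightarrow>
          \<exists>f\<in>\<F>. (\<lambda>n. energy_dist M \<E> (u n) f) \<longlonglongrightarrow> 0"
    and markov_dom: "\<And>f. f \<in> \<F> \<Longrightarrow> (\<lambda>x. max 0 (min (f x) 1)) \<in> \<F>"
    and markov: "\<And>f. f \<in> \<F> \<Longrightarrow>
          \<E> (\<lambda>x. max 0 (min (f x) 1)) (\<lambda>x. max 0 (min (f x) 1)) \<le> \<E> f f"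
    and one_dom: "(\<lambda>x. 1) \<in> \<F>"
    and one_form: "\<E> (\<lambda>x. 1) (\<lambda>x. 1) = 0"
    and carre_exists: "\<And>f. f \<in> \<F> \<inter> Linf_space M \<Longrightarrow>
          \<exists>g. integrable M g \<and> (\<forall>h \<in> \<F> \<inter> Linf_space M.
            \<E> (\<lambda>x. f x * h x) f - 1/2 * \<E> h (\<lambda>x. (f x)\<^sup>2) = (\<integral>x. h x * g x \<partial>M))"
    and strong_local: "\<And>f g a. f \<in> \<F> \<Longrightarrow> g \<in> \<F> \<Longrightarrow> (AE x in M. (f x + a) * g x = 0) \<Longrightarrow> \<E> f g = 0"

text \<open>
  The carre du champ operator is determined only up to almost-everywhere equality of its
  values, so it is described by a predicate satisfied by all its versions. Continuity is
  joint continuity with respect to \<open>energy_dist\<close> on both arguments and the \<open>L\<^sup>1\<close> distance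
  on the values.
\<close>

definition carre_du_champ ::
  "'a measure \<Rightarrow> (('a \<Rightarrow> real) \<Rightarrow> ('a \<Rightarrow> real) \<Rightarrow> real) \<Rightarrow> ('a \<Rightarrow> real) set \<Rightarrow>
   (('a \<Rightarrow> real) \<Rightarrow> ('a \<Rightarrow> real) \<Rightarrow> 'a \<Rightarrow> real) \<Rightarrow> bool" where
  "carre_du_champ M \<E> \<F> \<gamma> \<longleftrightarrow>
     (\<forall>f\<in>\<F>. \<forall>g\<in>\<F>. integrable M (\<gamma> f g)) \<and>
     (\<forall>f\<in>\<F>. \<forall>f'\<in>\<F>. \<forall>g\<in>\<F>. (AE x in M. f x = f' x) \<longrightarrow> (AE x in M. \<gamma> f g x = \<gamma> f' g x)) \<and>
     (\<forall>f\<in>\<F>. AE x in M. 0 \<le> \<gamma> f f x) \<and>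
     (\<forall>f\<in>\<F>. \<forall>g\<in>\<F>. AE x in M. \<gamma> f g x = \<gamma> g f x) \<and>
     (\<forall>f\<in>\<F>. \<forall>g\<in>\<F>. \<forall>h\<in>\<F>. AE x in M. \<gamma> (\<lambda>y. f y + g y) h x = \<gamma> f h x + \<gamma> g h x) \<and>
     (\<forall>c. \<forall>f\<in>\<F>. \<forall>g\<in>\<F>. AE x in M. \<gamma> (\<lambda>y. c * f y) g x = c * \<gamma> f g x) \<and>
     (\<forall>f\<in>\<F>. \<forall>g\<in>\<F>. \<forall>e>0. \<exists>d>0. \<forall>f'\<in>\<F>. \<forall>g'\<in>\<F>.
        energy_dist M \<E> f' f < d \<longrightarrow> energy_dist M \<E> g' g < d \<longrightarrow>
        (\<integral>x. \<bar>\<gamma> f' g' x - \<gamma> f g x\<bar> \<partial>M) < e) \<and>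
     (\<forall>f \<in> \<F> \<inter> Linf_space M. \<forall>g \<in> \<F> \<inter> Linf_space M. \<forall>h \<in> \<F> \<inter> Linf_space M.
        1/2 * \<E> (\<lambda>x. f x * h x) g + 1/2 * \<E> (\<lambda>x. g x * h x) f - 1/2 * \<E> h (\<lambda>x. f x * g x)
          = (\<integral>x. h x * \<gamma> f g x \<partial>M))"

definition carre_matrix ::
  "(('a \<Rightarrow> real) \<Rightarrow> ('a \<Rightarrow> real) \<Rightarrow> 'a \<Rightarrow> real) \<Rightarrow> ('n \<Rightarrow> 'a \<Rightarrow> real) \<Rightarrow> 'a \<Rightarrow> real ^ 'n ^ 'n" where
  "carre_matrix \<gamma> \<phi> x = (\<chi> i j. \<gamma> (\<phi> i) (\<phi> j) x)"

end

theory Submission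
  imports Defs
begin

text \<open>
  Let \<open>A\<close> be a set on which \<open>\<phi>\<close> is bounded, takes values in a compact null set \<open>K\<close>, and has a carre
  du champ matrix with bounded inverse \<open>\<beta>\<close>. By the derivation property of \<open>\<gamma>\<close>, integrating by parts
  against functions of the domain close to \<open>1\<^sub>A \<beta>\<close>, with each \<open>\<phi>\<^sub>i\<close> replaced by a close function in the
  domain of the generator, shows that \<open>\<partial>\<^sub>i \<nu> = \<Sum>\<^sub>j \<partial>\<^sub>j E\<^sub>i\<^sub>j - D\<^sub>i\<close> for the image \<open>\<nu>\<close> of the measure on \<open>A\<close>,
  where \<open>D\<close> and \<open>E\<close> are images of finite signed measures and the mass of \<open>E\<close> is arbitrarily small.

  Such a \<open>\<nu>\<close> has mass at most \<open>C |E|\<close> if it is carried by \<open>K\<close>. The identity is tested, on a cube of side \<open>a\<close>,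
  with the gradient of a function whose Laplacian is the difference of the mollifications at scales
  \<open>\<rho>\<close> of order \<open>a\<close> and \<open>\<sigma>\<close>, much smaller, of the indicator of a set \<open>Z\<close>. This set is the cube without
  a neighbourhood of \<open>K\<close>, so that the mollification at scale \<open>\<sigma>\<close> vanishes on \<open>K\<close>, and without the dilated
  Calderon-Zygmund cubes of \<open>|E|\<close>. The Hessian of the test function is bounded in \<open>L\<^sup>2\<close> and oscillates
  boundedly on each Calderon-Zygmund cube, which bounds its pairing with \<open>E\<close> by a multiple of the mass of
  \<open>E\<close> near the cube. The term with \<open>D\<close> carries a factor \<open>a\<close> and disappears as \<open>a\<close> tends to zero.
\<close>

section \<open>Bounded functions in the domain\<close>

text \<open>With \<open>E = 0\<close> the image would have a finite measure as its gradient: a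
  function of bounded variation. But \<gamma> is continuous only from energy to L^1, so
  approximating \<open>\<phi>\<close> and \<open>\<beta>\<close> leaves an error that is small in
  L^1 and stands under a derivative. Its natural partner, the Hessian of a potential with bounded
  Laplacian, is not bounded: the pointwise estimate is of order log(\<rho>/\<sigma>), and \<sigma>
  is dictated by \<open>K\<close>. This is the usual failure of singular integrals on L^1. As in the
  weak-type estimate, one gives up the places where \<open>E\<close> concentrates, which costs a
  fixed fraction of the volume of the cube.

  All constants depend on the dimension alone. This permits the only workable order of limits:
  \<open>D\<close> may blow up while the mass of \<open>E\<close> shrinks, so the side
  \<open>a\<close> goes to zero with \<open>E\<close> and \<open>D\<close> fixed, and only
  afterwards does the mass of \<open>E\<close>.

  The kernel is chosen so that the Laplacian of \<open>bump s ^ 4 / s ^ (n + 7)\<close>,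
  \<open>n\<close> the dimension, is the s-derivative of a mollifier. The test function is then an
  explicit superposition, and each piece composed with \<open>\<phi>\<close> lies in the algebra of
  bounded functions of the domain.\<close>

context dirichlet_structure
begin

section \<open>The form as a degenerate inner product\<close>

lemma dom_meas [measurable_dest]: "f \<in> \<F> \<Longrightarrow> f \<in> borel_measurable M"
  using dom_L2 by (auto simp: L2_space_def)

lemma dom_sq_int: "f \<in> \<F> \<Longrightarrow> integrable M (\<lambda>x. (f x)\<^sup>2)"
  using dom_L2 by (auto simp: L2_space_def)

lemma integrable_mult_sq:
  fixes f g :: "'a \<Rightarrow> real"
  assumes [measurable]: "f \<in> borel_measurable M" "g \<in> borel_measurable M"
    and "integrable M (\<lambda>x. (f x)\<^sup>2)" "integrable M (\<lambda>x. (g x)\<^sup>2)"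
  shows "integrable M (\<lambda>x. f x * g x)"
proof (rule Bochner_Integration.integrable_bound)
  show "integrable M (\<lambda>x. (f x)\<^sup>2 + (g x)\<^sup>2)" using assms by auto
  show "AE x in M. norm (f x * g x) \<le> norm ((f x)\<^sup>2 + (g x)\<^sup>2)"
  proof (rule AE_I2)
    fix x
    have "0 \<le> (\<bar>f x\<bar> - \<bar>g x\<bar>)\<^sup>2" by simp
    then have "2 * (\<bar>f x\<bar> * \<bar>g x\<bar>) \<le> (f x)\<^sup>2 + (g x)\<^sup>2" by (simp add: power2_diff)
    moreover have "0 \<le> \<bar>f x\<bar> * \<bar>g x\<bar>" by simp
    ultimately have "\<bar>f x\<bar> * \<bar>g x\<bar> \<le> (f x)\<^sup>2 + (g x)\<^sup>2" by linarith
    then show "norm (f x * g x) \<le> norm ((f x)\<^sup>2 + (g x)\<^sup>2)"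
      by (simp add: abs_mult)
  qed
qed simp

lemma dom_mult_int: "f \<in> \<F> \<Longrightarrow> g \<in> \<F> \<Longrightarrow> integrable M (\<lambda>x. f x * g x)"
  by (rule integrable_mult_sq) (auto dest: dom_meas dom_sq_int)

lemma dom_const: "(\<lambda>x. c) \<in> \<F>"
  using dom_scale[OF one_dom, of c] by simp

lemma dom_diff: "f \<in> \<F> \<Longrightarrow> g \<in> \<F> \<Longrightarrow> (\<lambda>x. f x - g x) \<in> \<F>"
  using dom_add[of f "\<lambda>x. (-1) * g x"] dom_scale[of g "-1"] by simp

lemma dom_sum: "(\<And>i. i \<in> I \<Longrightarrow> f i \<in> \<F>) \<Longrightarrow> (\<lambda>x. \<Sum>i\<in>I. f i x) \<in> \<F>"
proof (induction I rule: infinite_finite_induct)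
  case (insert i I)
  then show ?case using dom_add[of "f i" "\<lambda>x. \<Sum>i\<in>I. f i x"] by simp
qed (auto intro: dom_const)

lemma form_add_right: "f \<in> \<F> \<Longrightarrow> g \<in> \<F> \<Longrightarrow> h \<in> \<F> \<Longrightarrow> \<E> h (\<lambda>x. f x + g x) = \<E> h f + \<E> h g"
  using form_add[of f g h] form_sym[of h "\<lambda>x. f x + g x"] form_sym[of h f] form_sym[of h g] dom_add[of f g] by simp

lemma form_scale_right: "f \<in> \<F> \<Longrightarrow> g \<in> \<F> \<Longrightarrow> \<E> g (\<lambda>x. c * f x) = c * \<E> g f"
  using form_scale[of f g c] form_sym[of g "\<lambda>x. c * f x"] form_sym[of g f] dom_scale[of f c] by simp

lemma form_diff: "f \<in> \<F> \<Longrightarrow> g \<in> \<F> \<Longrightarrow> h \<in> \<F> \<Longrightarrow> \<E> (\<lambda>x. f x - g x) h = \<E> f h - \<E> g h"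
  using form_add[of f "\<lambda>x. (-1) * g x" h] dom_scale[of g "-1"] form_scale[of g h "-1"] by simp

lemma form_diff_right: "f \<in> \<F> \<Longrightarrow> g \<in> \<F> \<Longrightarrow> h \<in> \<F> \<Longrightarrow> \<E> h (\<lambda>x. f x - g x) = \<E> h f - \<E> h g"
  using form_diff[of f g h] form_sym[of h "\<lambda>x. f x - g x"] form_sym[of h f] form_sym[of h g] dom_diff[of f g] by simp

lemma form_zero: "g \<in> \<F> \<Longrightarrow> \<E> (\<lambda>x. 0) g = 0"
  using form_scale[of "\<lambda>x. 0" g 0] dom_const[of 0] by simp

lemma form_sum: "(\<And>i. i \<in> I \<Longrightarrow> f i \<in> \<F>) \<Longrightarrow> g \<in> \<F> \<Longrightarrow> \<E> (\<lambda>x. \<Sum>i\<in>I. f i x) g = (\<Sum>i\<in>I. \<E> (f i) g)"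
proof (induction I rule: infinite_finite_induct)
  case (insert i I)
  then show ?case using form_add[of "f i" "\<lambda>x. \<Sum>i\<in>I. f i x" g] dom_sum[of I f] by simp
qed (auto simp: form_zero)

lemma form_AE_right: "f \<in> \<F> \<Longrightarrow> g \<in> \<F> \<Longrightarrow> h \<in> \<F> \<Longrightarrow> (AE x in M. f x = g x) \<Longrightarrow> \<E> h f = \<E> h g"
  using form_AE[of f g h] form_sym[of h f] form_sym[of h g] by simp

text \<open>The minimum over \<open>t\<close> is attained at \<open>-b/c\<close>; for
  \<open>c = 0\<close> an affine function bounded below is constant. Common source of the
  Cauchy-Schwarz inequalities for \<E> and for L^2, and of the estimate on approximate minimisers in
  \<open>resolvent_exists\<close>.\<close>

lemma discriminant_bound:
  fixes a b c :: real
  assumes "\<And>t. 0 \<le> a + 2 * t * b + t\<^sup>2 * c" "0 \<le> c"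
  shows "b\<^sup>2 \<le> a * c"
proof (cases "c = 0")
  case True
  have "b = 0"
  proof (rule ccontr)
    assume "b \<noteq> 0"
    then have "a + 2 * (- (a + 1) / (2 * b)) * b = -1" by (simp add: field_simps)
    with assms(1)[of "- (a + 1) / (2 * b)"] True show False by simp
  qed
  with True show ?thesis by simp
next
  case False
  with assms(2) have c: "c > 0" by simp
  have "0 \<le> a + 2 * (-b/c) * b + (-b/c)\<^sup>2 * c" by (rule assms(1))
  also have "\<dots> = a - b\<^sup>2 / c" using c by (simp add: power2_eq_square field_simps)
  finally show ?thesis using c by (simp add: field_simps)
qed

lemma form_expand:
  assumes "f \<in> \<F>" "g \<in> \<F>"
  shows "\<E> (\<lambda>x. f x + t * g x) (\<lambda>x. f x + t * g x) = \<E> f f + 2 * t * \<E> f g + t\<^sup>2 * \<E> g g"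
  using assms by (simp add: form_add form_add_right form_scale form_scale_right dom_add dom_scale
     form_sym[of g f] power2_eq_square algebra_simps)

lemma form_cs: "f \<in> \<F> \<Longrightarrow> g \<in> \<F> \<Longrightarrow> (\<E> f g)\<^sup>2 \<le> \<E> f f * \<E> g g"
  by (rule discriminant_bound) (auto simp: form_expand[symmetric] form_nonneg dom_add dom_scale)

lemma form_abs_le: "f \<in> \<F> \<Longrightarrow> g \<in> \<F> \<Longrightarrow> \<bar>\<E> f g\<bar> \<le> sqrt (\<E> f f) * sqrt (\<E> g g)"
  using real_sqrt_le_mono[OF form_cs[of f g]] by (simp add: real_sqrt_mult)

text \<open>Cauchy-Schwarz turns the vanishing energy of the constant 1 into orthogonality of
  constants to the whole domain, so that \<E> does not see shifts of its arguments.\<close>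

lemma form_const: "g \<in> \<F> \<Longrightarrow> \<E> (\<lambda>x. c) g = 0" "g \<in> \<F> \<Longrightarrow> \<E> g (\<lambda>x. c) = 0"
proof -
  assume g: "g \<in> \<F>"
  have "\<E> (\<lambda>x. 1) g = 0" using form_cs[OF one_dom g] one_form by simp
  then show "\<E> (\<lambda>x. c) g = 0" using form_scale[OF one_dom g, of c] by simp
  then show "\<E> g (\<lambda>x. c) = 0" using form_sym[OF g dom_const] by simp
qed

lemma integral_mult_sq_cs:
  fixes f g :: "'a \<Rightarrow> real"
  assumes [measurable]: "f \<in> borel_measurable M" "g \<in> borel_measurable M"
    and i: "integrable M (\<lambda>x. (f x)\<^sup>2)" "integrable M (\<lambda>x. (g x)\<^sup>2)"
  shows "(\<integral>x. f x * g x \<partial>M)\<^sup>2 \<le> (\<integral>x. (f x)\<^sup>2 \<partial>M) * (\<integral>x. (g x)\<^sup>2 \<partial>M)"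
proof (rule discriminant_bound)
  fix t :: real
  have ifg: "integrable M (\<lambda>x. f x * g x)" using integrable_mult_sq assms by blast
  have "0 \<le> (\<integral>x. (f x + t * g x)\<^sup>2 \<partial>M)" by simp
  also have "\<dots> = (\<integral>x. (f x)\<^sup>2 + 2 * t * (f x * g x) + t\<^sup>2 * (g x)\<^sup>2 \<partial>M)"
    by (rule Bochner_Integration.integral_cong) (auto simp: power2_eq_square algebra_simps)
  also have "\<dots> = (\<integral>x. (f x)\<^sup>2 \<partial>M) + 2 * t * (\<integral>x. f x * g x \<partial>M) + t\<^sup>2 * (\<integral>x. (g x)\<^sup>2 \<partial>M)"
    using i ifg by simp
  finally show "0 \<le> (\<integral>x. (f x)\<^sup>2 \<partial>M) + 2 * t * (\<integral>x. f x * g x \<partial>M) + t\<^sup>2 * (\<integral>x. (g x)\<^sup>2 \<partial>M)" .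
qed simp

lemma energy_dist_sq:
  assumes "f \<in> \<F>" "g \<in> \<F>"
  shows "energy_dist M \<E> f g = sqrt (\<E> (\<lambda>x. f x - g x) (\<lambda>x. f x - g x) + (\<integral>x. (f x - g x)\<^sup>2 \<partial>M))"
  by (simp add: energy_dist_def energy_inner_def power2_eq_square)

lemma sq_diff_int:
  fixes f g :: "'a \<Rightarrow> real"
  assumes [measurable]: "f \<in> borel_measurable M" "g \<in> borel_measurable M"
    and i: "integrable M (\<lambda>x. (f x)\<^sup>2)" "integrable M (\<lambda>x. (g x)\<^sup>2)"
  shows "integrable M (\<lambda>x. (f x - g x)\<^sup>2)"
proof -
  have "integrable M (\<lambda>x. (f x)\<^sup>2 - 2 * (f x * g x) + (g x)\<^sup>2)"
    using integrable_mult_sq[of f g] assms by auto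
  then show ?thesis by (simp add: power2_diff algebra_simps)
qed

lemma L2_triangle:
  fixes f g h :: "'a \<Rightarrow> real"
  assumes [measurable]: "f \<in> borel_measurable M" "g \<in> borel_measurable M" "h \<in> borel_measurable M"
    and i: "integrable M (\<lambda>x. (f x)\<^sup>2)" "integrable M (\<lambda>x. (g x)\<^sup>2)" "integrable M (\<lambda>x. (h x)\<^sup>2)"
  shows "(\<integral>x. (f x - h x)\<^sup>2 \<partial>M) \<le> 2 * (\<integral>x. (f x - g x)\<^sup>2 \<partial>M) + 2 * (\<integral>x. (g x - h x)\<^sup>2 \<partial>M)"
proof -
  have "(\<integral>x. (f x - h x)\<^sup>2 \<partial>M) \<le> (\<integral>x. 2 * (f x - g x)\<^sup>2 + 2 * (g x - h x)\<^sup>2 \<partial>M)"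
  proof (rule integral_mono)
    show "integrable M (\<lambda>x. (f x - h x)\<^sup>2)" using sq_diff_int assms by blast
    show "integrable M (\<lambda>x. 2 * (f x - g x)\<^sup>2 + 2 * (g x - h x)\<^sup>2)"
      using sq_diff_int[of f g] sq_diff_int[of g h] assms by auto
    fix x
    have "0 \<le> ((f x - g x) - (g x - h x))\<^sup>2" by simp
    then show "(f x - h x)\<^sup>2 \<le> 2 * (f x - g x)\<^sup>2 + 2 * (g x - h x)\<^sup>2"
      by (simp add: power2_eq_square algebra_simps)
  qed
  also have "\<dots> = 2 * (\<integral>x. (f x - g x)\<^sup>2 \<partial>M) + 2 * (\<integral>x. (g x - h x)\<^sup>2 \<partial>M)"
    using sq_diff_int[of f g] sq_diff_int[of g h] assms by auto
  finally show ?thesis .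
qed

text \<open>This is where completeness of the domain enters.\<close>

lemma form_closed:
  assumes u: "\<And>n :: nat. u n \<in> \<F>"
    and g: "g \<in> L2_space M"
    and lim: "(\<lambda>n. \<integral>x. (u n x - g x)\<^sup>2 \<partial>M) \<longlonglongrightarrow> 0"
    and cauchy: "\<And>e. 0 < e \<Longrightarrow> \<exists>N. \<forall>m\<ge>N. \<forall>n\<ge>N. \<E> (\<lambda>x. u m x - u n x) (\<lambda>x. u m x - u n x) < e"
  shows "g \<in> \<F>" "(\<lambda>n. energy_dist M \<E> (u n) g) \<longlonglongrightarrow> 0"
proof -
  have gm [measurable]: "g \<in> borel_measurable M" and gi: "integrable M (\<lambda>x. (g x)\<^sup>2)"
    using g by (auto simp: L2_space_def)
  have um [measurable]: "u n \<in> borel_measurable M" and ui: "integrable M (\<lambda>x. (u n x)\<^sup>2)" for n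
    using u dom_meas dom_sq_int by auto
  have "\<exists>f\<in>\<F>. (\<lambda>n. energy_dist M \<E> (u n) f) \<longlonglongrightarrow> 0"
  proof (rule complete[OF u])
    fix e :: real assume e: "0 < e"
    obtain N1 where N1: "\<And>m n. m \<ge> N1 \<Longrightarrow> n \<ge> N1 \<Longrightarrow> \<E> (\<lambda>x. u m x - u n x) (\<lambda>x. u m x - u n x) < e\<^sup>2 / 2"
      using cauchy[of "e\<^sup>2 / 2"] e by auto
    have "eventually (\<lambda>n. (\<integral>x. (u n x - g x)\<^sup>2 \<partial>M) < e\<^sup>2 / 8) sequentially"
      using order_tendstoD(2)[OF lim, of "e\<^sup>2 / 8"] e by simp
    then obtain N2 where N2: "\<And>n. n \<ge> N2 \<Longrightarrow> (\<integral>x. (u n x - g x)\<^sup>2 \<partial>M) < e\<^sup>2 / 8"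
      by (auto simp: eventually_sequentially)
    show "\<exists>N. \<forall>m\<ge>N. \<forall>n\<ge>N. energy_dist M \<E> (u m) (u n) < e"
    proof (intro exI allI impI)
      fix m n assume mn: "max N1 N2 \<le> m" "max N1 N2 \<le> n"
      have "(\<integral>x. (u m x - u n x)\<^sup>2 \<partial>M) \<le> 2 * (\<integral>x. (u m x - g x)\<^sup>2 \<partial>M) + 2 * (\<integral>x. (g x - u n x)\<^sup>2 \<partial>M)"
        by (rule L2_triangle) (use um gm ui gi in auto)
      moreover have "(\<integral>x. (g x - u n x)\<^sup>2 \<partial>M) = (\<integral>x. (u n x - g x)\<^sup>2 \<partial>M)"
        by (simp add: power2_commute)
      ultimately have "(\<integral>x. (u m x - u n x)\<^sup>2 \<partial>M) < e\<^sup>2 / 2"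
        using N2[of m] N2[of n] mn by simp
      with N1[of m n] mn have "\<E> (\<lambda>x. u m x - u n x) (\<lambda>x. u m x - u n x) + (\<integral>x. (u m x - u n x)\<^sup>2 \<partial>M) < e\<^sup>2"
        by simp
      then have "sqrt (\<E> (\<lambda>x. u m x - u n x) (\<lambda>x. u m x - u n x) + (\<integral>x. (u m x - u n x)\<^sup>2 \<partial>M)) < sqrt (e\<^sup>2)"
        by (rule real_sqrt_less_mono)
      then show "energy_dist M \<E> (u m) (u n) < e"
        using energy_dist_sq[OF u u] e by simp
    qed
  qed
  \<comment> \<open>The axiom only yields some limit \<open>f\<close>. Uniqueness of limits in L^2
    identifies it with \<open>g\<close> up to a null set, and the domain is closed under such
    changes.\<close>
  then obtain f where f: "f \<in> \<F>" and fl: "(\<lambda>n. energy_dist M \<E> (u n) f) \<longlonglongrightarrow> 0" by blast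
  have fm [measurable]: "f \<in> borel_measurable M" and fi: "integrable M (\<lambda>x. (f x)\<^sup>2)"
    using f dom_meas dom_sq_int by auto
  have "(\<lambda>n. (energy_dist M \<E> (u n) f)\<^sup>2) \<longlonglongrightarrow> 0\<^sup>2" by (intro tendsto_intros fl)
  then have "(\<lambda>n. (energy_dist M \<E> (u n) f)\<^sup>2) \<longlonglongrightarrow> 0" by simp
  moreover have "(\<integral>x. (u n x - f x)\<^sup>2 \<partial>M) \<le> (energy_dist M \<E> (u n) f)\<^sup>2" for n
    unfolding energy_dist_sq[OF u f] using form_nonneg[OF dom_diff[OF u f], of n] by simp
  ultimately have l2: "(\<lambda>n. \<integral>x. (u n x - f x)\<^sup>2 \<partial>M) \<longlonglongrightarrow> 0"
    by (intro tendsto_sandwich[of "\<lambda>_. 0" "\<lambda>n. \<integral>x. (u n x - f x)\<^sup>2 \<partial>M" sequentially "\<lambda>n. (energy_dist M \<E> (u n) f)\<^sup>2" 0]) auto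
  have le: "(\<integral>x. (f x - g x)\<^sup>2 \<partial>M) \<le> 2 * (\<integral>x. (u n x - f x)\<^sup>2 \<partial>M) + 2 * (\<integral>x. (u n x - g x)\<^sup>2 \<partial>M)" for n
    using L2_triangle[OF fm um gm fi ui gi, of n] by (simp add: power2_commute)
  have "(\<lambda>n. 2 * (\<integral>x. (u n x - f x)\<^sup>2 \<partial>M) + 2 * (\<integral>x. (u n x - g x)\<^sup>2 \<partial>M)) \<longlonglongrightarrow> 2 * 0 + 2 * 0"
    by (intro tendsto_intros l2 lim)
  then have "(\<integral>x. (f x - g x)\<^sup>2 \<partial>M) \<le> 0"
    using le by (intro LIMSEQ_le_const[of _ "2 * 0 + 2 * 0 :: real", simplified]) auto
  then have "(\<integral>x. (f x - g x)\<^sup>2 \<partial>M) = 0" by (intro antisym) auto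
  then have "AE x in M. (f x - g x)\<^sup>2 = 0"
    using integral_nonneg_eq_0_iff_AE[OF sq_diff_int[OF fm gm fi gi]] by simp
  then have fg: "AE x in M. f x = g x" by auto
  then show gF: "g \<in> \<F>" using dom_AE[OF f gm] by simp
  have "energy_dist M \<E> (u n) g = energy_dist M \<E> (u n) f" for n
  proof -
    have "AE x in M. u n x - g x = u n x - f x" using fg by auto
    then have "\<E> (\<lambda>x. u n x - g x) (\<lambda>x. u n x - g x) = \<E> (\<lambda>x. u n x - f x) (\<lambda>x. u n x - f x)"
      using form_AE[OF dom_diff[OF u gF] dom_diff[OF u f] dom_diff[OF u gF], of n n n]
        form_AE_right[OF dom_diff[OF u gF] dom_diff[OF u f] dom_diff[OF u f], of n n n] by presburger
    moreover have "(\<integral>x. (u n x - g x)\<^sup>2 \<partial>M) = (\<integral>x. (u n x - f x)\<^sup>2 \<partial>M)"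
      by (rule integral_cong_AE) (use fg in auto)
    ultimately show ?thesis using energy_dist_sq u f gF by simp
  qed
  then show "(\<lambda>n. energy_dist M \<E> (u n) g) \<longlonglongrightarrow> 0" using fl by simp
qed

end

section \<open>Layers of a real number and the interpolated square\<close>

definition slice :: "real \<Rightarrow> real \<Rightarrow> real \<Rightarrow> real" where
  "slice a d t = max 0 (min (t - a) d)"

lemma slice_nonneg: "0 \<le> slice a d t" by (simp add: slice_def)

lemma slice_le: "0 \<le> d \<Longrightarrow> slice a d t \<le> d" by (simp add: slice_def)

lemma slice_add: "0 \<le> d \<Longrightarrow> 0 \<le> d' \<Longrightarrow> slice a d t + slice (a + d) d' t = slice a (d + d') t"
  by (auto simp: slice_def max_def min_def)

text \<open>A layer is full wherever a higher one is nonzero. This is the form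
  \<open>(f + a) * g = 0\<close> in which strong locality can be applied to two layers of one
  function.\<close>

lemma slice_mult: "0 \<le> d \<Longrightarrow> a + d \<le> b \<Longrightarrow> slice a d t * slice b d' t = d * slice b d' t"
  by (auto simp: slice_def max_def min_def)

lemma slice_id: "a \<le> t \<Longrightarrow> t \<le> a + d \<Longrightarrow> slice a d t = t - a"
  by (auto simp: slice_def max_def min_def)

lemma slice_sum:
  assumes "0 \<le> d"
  shows "(\<Sum>k<N. slice (a + real k * d) d t) = slice a (real N * d) t"
proof (induction N)
  case 0 then show ?case by (simp add: slice_def)
next
  case (Suc N)
  then show ?case using slice_add[of "real N * d" d a t] assms by (simp add: algebra_simps)
qed

lemma slice_sum_shift:
  assumes "0 \<le> d"
  shows "(\<Sum>k=n..<n+m. slice (real k * d) d t) = slice (real n * d) (real m * d) t"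
proof -
  have "(\<Sum>k=n..<n+m. slice (real k * d) d t) = (\<Sum>k<m. slice (real (k + n) * d) d t)"
    by (rule sum.reindex_bij_witness[of _ "\<lambda>k. k + n" "\<lambda>k. k - n"]) auto
  also have "\<dots> = (\<Sum>k<m. slice (real n * d + real k * d) d t)"
    by (simp add: algebra_simps)
  finally show ?thesis using slice_sum[OF assms, of "real n * d" t m] by simp
qed

text \<open>Piecewise linear interpolation of the square function on \<open>[0, 1]\<close>. By strong locality the slices
  of a function are orthogonal for the form, which gives the energy of the interpolation.\<close>

definition sq_interp :: "nat \<Rightarrow> real \<Rightarrow> real" where
  "sq_interp j t = (\<Sum>k<2^j. (2 * real k + 1) / 2^j * slice (real k * (1 / 2^j)) (1 / 2^j) t)"

text \<open>When the sum of the layers is squared, the product of a layer with all lower ones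
  collapses to a multiple of that layer, because the lower ones are full wherever it is
  nonzero.\<close>

lemma sq_slice_sum:
  assumes "0 \<le> d"
  shows "(\<Sum>k<N. 2 * real k * d * slice (real k * d) d t + (slice (real k * d) d t)\<^sup>2)
     = (slice 0 (real N * d) t)\<^sup>2"
proof (induction N)
  case 0 then show ?case by (simp add: slice_def)
next
  case (Suc N)
  have "(slice 0 (real (Suc N) * d) t)\<^sup>2 = (slice 0 (real N * d) t + slice (real N * d) d t)\<^sup>2"
    using slice_add[of "real N * d" d 0 t] assms by (simp add: algebra_simps)
  also have "\<dots> = (slice 0 (real N * d) t)\<^sup>2 + 2 * (slice 0 (real N * d) t * slice (real N * d) d t)
      + (slice (real N * d) d t)\<^sup>2"
    by (simp add: power2_eq_square algebra_simps)
  also have "slice 0 (real N * d) t * slice (real N * d) d t = real N * d * slice (real N * d) d t"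
    using slice_mult[of "real N * d" 0 "real N * d" t d] assms by simp
  finally show ?case using Suc.IH by simp
qed

text \<open>On layer \<open>k\<close> the interpolation exceeds the square by
  \<open>S k * (d - S k)\<close>. Bounding this by \<open>S k * d\<close> and adding up the layers
  gives \<open>t * d\<close>.\<close>

lemma sq_interp_approx:
  assumes "0 \<le> t" "t \<le> 1"
  shows "\<bar>sq_interp j t - t\<^sup>2\<bar> \<le> 1 / 2^j"
proof -
  define d :: real where "d = 1 / 2^j"
  have d: "0 \<le> d" "real (2^j) * d = 1" by (auto simp: d_def)
  define S where "S k = slice (real k * d) d t" for k
  have t: "t = slice 0 1 t" using assms slice_id[of 0 t 1] by simp
  have "t\<^sup>2 = (\<Sum>k<2^j. 2 * real k * d * S k + (S k)\<^sup>2)"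
    using sq_slice_sum[OF d(1), of t "2^j"] d t by (simp add: S_def)
  moreover have "sq_interp j t = (\<Sum>k<2^j. (2 * real k + 1) * d * S k)"
    unfolding sq_interp_def S_def d_def by simp
  ultimately have eq: "sq_interp j t - t\<^sup>2 = (\<Sum>k<2^j. S k * (d - S k))"
    by (simp add: sum_subtractf[symmetric] power2_eq_square algebra_simps)
  have S: "0 \<le> S k" "S k \<le> d" for k using slice_nonneg slice_le d by (auto simp: S_def)
  have "0 \<le> (\<Sum>k<2^j. S k * (d - S k))" using S by (intro sum_nonneg) auto
  moreover have "(\<Sum>k<2^j. S k * (d - S k)) \<le> (\<Sum>k<2^j. S k * d)"
    using S d by (intro sum_mono mult_left_mono) auto
  moreover have "(\<Sum>k<2^j. S k * d) = t * d"
    using slice_sum[OF d(1), of 0 t "2^j"] d t by (simp add: S_def sum_distrib_right[symmetric])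
  moreover have "t * d \<le> d" using assms d by (simp add: mult_left_le_one_le)
  ultimately show ?thesis using eq by (simp add: d_def)
qed

text \<open>On the finer grid the coarse interpolation uses the same layers as the fine one, so the
  difference of the two is again a combination of orthogonal layers.\<close>

lemma sq_interp_refine:
  assumes "i \<le> j"
  shows "sq_interp i t = (\<Sum>k<2^j. (2 * real (k div 2^(j-i)) + 1) / 2^i * slice (real k * (1 / 2^j)) (1 / 2^j) t)"
proof -
  define m :: nat where "m = 2^(j-i)"
  have m: "2^j = 2^i * m" "m > 0" using assms by (auto simp: m_def power_add[symmetric])
  have md: "real m * (1 / 2^j) = 1 / 2^i"
  proof -
    have "(2::real)^j = 2^i * real m" using m by (metis of_nat_mult of_nat_numeral of_nat_power)
    then show ?thesis using m by simp
  qed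
  have "(\<Sum>k<2^j. (2 * real (k div m) + 1) / 2^i * slice (real k * (1 / 2^j)) (1 / 2^j) t)
      = (\<Sum>\<kappa><2^i. \<Sum>k=\<kappa>*m..<\<kappa>*m+m. (2 * real (k div m) + 1) / 2^i * slice (real k * (1 / 2^j)) (1 / 2^j) t)"
    unfolding m(1) by (rule sum.nat_group[symmetric])
  also have "\<dots> = (\<Sum>\<kappa><2^i. (2 * real \<kappa> + 1) / 2^i * (\<Sum>k=\<kappa>*m..<\<kappa>*m+m. slice (real k * (1 / 2^j)) (1 / 2^j) t))"
  proof (rule sum.cong[OF refl])
    fix \<kappa>
    have "k div m = \<kappa>" if "k \<in> {\<kappa>*m..<\<kappa>*m+m}" for k
      using that by (intro div_nat_eqI) (auto simp: algebra_simps)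
    then show "(\<Sum>k=\<kappa>*m..<\<kappa>*m+m. (2 * real (k div m) + 1) / 2^i * slice (real k * (1 / 2^j)) (1 / 2^j) t)
      = (2 * real \<kappa> + 1) / 2^i * (\<Sum>k=\<kappa>*m..<\<kappa>*m+m. slice (real k * (1 / 2^j)) (1 / 2^j) t)"
      unfolding sum_distrib_left by (intro sum.cong) auto
  qed
  also have "\<dots> = sq_interp i t"
    unfolding sq_interp_def
  proof (rule sum.cong[OF refl])
    fix \<kappa>
    have "(\<Sum>k=\<kappa>*m..<\<kappa>*m+m. slice (real k * (1 / 2^j)) (1 / 2^j) t) = slice (real (\<kappa> * m) * (1 / 2^j)) (real m * (1 / 2^j)) t"
      by (rule slice_sum_shift) simp
    also have "real (\<kappa> * m) * (1 / 2^j) = real \<kappa> * (1 / 2^i)"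
      by (metis md mult.assoc of_nat_mult)
    finally show "(2 * real \<kappa> + 1) / 2^i * (\<Sum>k=\<kappa>*m..<\<kappa>*m+m. slice (real k * (1 / 2^j)) (1 / 2^j) t)
      = (2 * real \<kappa> + 1) / 2^i * slice (real \<kappa> * (1 / 2^i)) (1 / 2^i) t" using md by simp
  qed
  finally show ?thesis by (simp add: m_def)
qed

text \<open>With \<open>k = q m + r\<close> the difference is
  \<open>(m - 2 r - 1) / (2^i m)\<close>, and \<open>r < m\<close>. The bound depends on the coarser
  level only, which is what makes the interpolations a Cauchy sequence in energy.\<close>

lemma refine_slope:
  assumes "i \<le> j"
  shows "\<bar>(2 * real (k div 2^(j-i)) + 1) / 2^i - (2 * real k + 1) / 2^j\<bar> \<le> 1 / 2^i"
proof -
  define m :: nat where "m = 2^(j-i)"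
  have m: "2^j = 2^i * m" "m > 0" using assms by (auto simp: m_def power_add[symmetric])
  have m2: "(2::real)^j = 2^i * real m" using m by (metis of_nat_mult of_nat_numeral of_nat_power)
  define q r where "q = k div m" and "r = k mod m"
  have k: "real k = real q * real m + real r"
    unfolding q_def r_def by (metis div_mult_mod_eq of_nat_add of_nat_mult)
  have r: "real r + 1 \<le> real m" 
  proof -
    have "Suc r \<le> m" using m(2) by (simp add: r_def Suc_leI)
    then have "real (Suc r) \<le> real m" by (rule of_nat_mono)
    then show ?thesis by simp
  qed
  have "(2 * real q + 1) / 2^i - (2 * real k + 1) / 2^j = (real m - 2 * real r - 1) / (2^i * real m)"
    unfolding m2 using m(2) by (simp add: field_simps k)
  also have "\<bar>\<dots>\<bar> = \<bar>real m - 2 * real r - 1\<bar> / (2^i * real m)" using m(2) by (simp add: abs_mult)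
  also have "\<dots> \<le> real m / (2^i * real m)" using r m(2) by (intro divide_right_mono) auto
  also have "\<dots> = 1 / 2^i" using m(2) by simp
  finally show ?thesis by (simp add: q_def m_def)
qed

section \<open>Energies of layers; the square of a bounded function\<close>

context dirichlet_structure
begin

text \<open>The Markov axiom speaks of truncation to [0, 1]. The affine change \<open>u\<close>
  reduces every layer to it: the shift costs no energy, and the two factors \<open>d\<close> squared
  cancel.\<close>

lemma slice_dom:
  assumes f: "f \<in> \<F>" and d: "0 < d"
  shows "(\<lambda>x. slice a d (f x)) \<in> \<F>" "\<E> (\<lambda>x. slice a d (f x)) (\<lambda>x. slice a d (f x)) \<le> \<E> f f"
proof -
  define u where "u = (\<lambda>x. -a/d + (1/d) * f x)"
  have u: "u \<in> \<F>" unfolding u_def by (intro dom_add dom_scale f dom_const)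
  have eq: "slice a d (f x) = d * max 0 (min (u x) 1)" for x
    unfolding slice_def u_def using d by (auto simp: max_def min_def field_simps)
  show 1: "(\<lambda>x. slice a d (f x)) \<in> \<F>"
    unfolding eq by (intro dom_scale markov_dom u)
  have "\<E> u u = (1/d)\<^sup>2 * \<E> f f"
    unfolding u_def form_expand[OF dom_const f] using form_const(1) f dom_const by simp
  then have "\<E> f f = d\<^sup>2 * \<E> u u" using d by (simp add: power_divide)
  moreover have "\<E> (\<lambda>x. d * max 0 (min (u x) 1)) (\<lambda>x. d * max 0 (min (u x) 1))
     = d\<^sup>2 * \<E> (\<lambda>x. max 0 (min (u x) 1)) (\<lambda>x. max 0 (min (u x) 1))"
    using u by (simp add: form_scale form_scale_right markov_dom dom_scale power2_eq_square)
  moreover have "d\<^sup>2 * \<E> (\<lambda>x. max 0 (min (u x) 1)) (\<lambda>x. max 0 (min (u x) 1)) \<le> d\<^sup>2 * \<E> u u"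
    by (intro mult_left_mono markov u) simp
  ultimately show "\<E> (\<lambda>x. slice a d (f x)) (\<lambda>x. slice a d (f x)) \<le> \<E> f f"
    unfolding eq by simp
qed

lemma slice_orth:
  assumes f: "f \<in> \<F>" and d: "0 < d" "0 < d'" "a + d \<le> b"
  shows "\<E> (\<lambda>x. slice a d (f x)) (\<lambda>x. slice b d' (f x)) = 0"
        "\<E> (\<lambda>x. slice b d' (f x)) (\<lambda>x. slice a d (f x)) = 0"
proof -
  show 1: "\<E> (\<lambda>x. slice a d (f x)) (\<lambda>x. slice b d' (f x)) = 0"
  proof (rule strong_local)
    show "AE x in M. (slice a d (f x) + - d) * slice b d' (f x) = 0"
      using slice_mult[of d a b _ d'] d by (intro AE_I2) (simp add: algebra_simps)
  qed (auto intro: slice_dom f d)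
  then show "\<E> (\<lambda>x. slice b d' (f x)) (\<lambda>x. slice a d (f x)) = 0"
    using form_sym slice_dom f d by metis
qed

lemma form_sum_orth:
  assumes fin: "finite I" and f: "\<And>i. i \<in> I \<Longrightarrow> f i \<in> \<F>"
    and orth: "\<And>i j. i \<in> I \<Longrightarrow> j \<in> I \<Longrightarrow> i \<noteq> j \<Longrightarrow> \<E> (f i) (f j) = 0"
  shows "\<E> (\<lambda>x. \<Sum>i\<in>I. c i * f i x) (\<lambda>x. \<Sum>i\<in>I. c i * f i x) = (\<Sum>i\<in>I. (c i)\<^sup>2 * \<E> (f i) (f i))"
proof -
  have S: "(\<lambda>x. \<Sum>i\<in>I. c i * f i x) \<in> \<F>" by (intro dom_sum dom_scale f)
  have "\<E> (\<lambda>x. \<Sum>i\<in>I. c i * f i x) (\<lambda>x. \<Sum>i\<in>I. c i * f i x)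
      = (\<Sum>i\<in>I. \<E> (\<lambda>x. c i * f i x) (\<lambda>x. \<Sum>j\<in>I. c j * f j x))"
    by (intro form_sum S dom_scale f)
  also have "\<dots> = (\<Sum>i\<in>I. c i * (\<Sum>j\<in>I. c j * \<E> (f j) (f i)))"
  proof (rule sum.cong[OF refl])
    fix i assume i: "i \<in> I"
    have "\<E> (\<lambda>x. c i * f i x) (\<lambda>x. \<Sum>j\<in>I. c j * f j x) = c i * \<E> (\<lambda>x. \<Sum>j\<in>I. c j * f j x) (f i)"
      using form_scale[OF f[OF i] S] form_sym[OF S f[OF i]] by simp
    also have "\<E> (\<lambda>x. \<Sum>j\<in>I. c j * f j x) (f i) = (\<Sum>j\<in>I. \<E> (\<lambda>x. c j * f j x) (f i))"
      by (intro form_sum dom_scale f i)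
    also have "\<dots> = (\<Sum>j\<in>I. c j * \<E> (f j) (f i))"
      using f i by (intro sum.cong refl form_scale)
    finally show "\<E> (\<lambda>x. c i * f i x) (\<lambda>x. \<Sum>j\<in>I. c j * f j x) = c i * (\<Sum>j\<in>I. c j * \<E> (f j) (f i))" .
  qed
  also have "\<dots> = (\<Sum>i\<in>I. c i * (\<Sum>j\<in>I. if j = i then c i * \<E> (f i) (f i) else 0))"
    using orth by (intro sum.cong refl arg_cong2[where f="(*)"]) auto
  also have "\<dots> = (\<Sum>i\<in>I. (c i)\<^sup>2 * \<E> (f i) (f i))"
    using fin by (simp add: power2_eq_square mult.assoc)
  finally show ?thesis .
qed

lemma form_slices:
  assumes f: "f \<in> \<F>" and d: "0 < d"
  shows "\<E> (\<lambda>x. \<Sum>k<N. c k * slice (real k * d) d (f x)) (\<lambda>x. \<Sum>k<N. c k * slice (real k * d) d (f x))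
    = (\<Sum>k<N. (c k)\<^sup>2 * \<E> (\<lambda>x. slice (real k * d) d (f x)) (\<lambda>x. slice (real k * d) d (f x)))"
proof (rule form_sum_orth)
  fix i j :: nat assume "i \<noteq> j"
  then consider "i < j" | "j < i" by linarith
  then show "\<E> (\<lambda>x. slice (real i * d) d (f x)) (\<lambda>x. slice (real j * d) d (f x)) = 0"
  proof cases
    case 1
    then have "real (Suc i) * d \<le> real j * d" using d by (intro mult_right_mono) auto
    then show ?thesis using f d by (intro slice_orth) (auto simp: algebra_simps)
  next
    case 2
    then have "real (Suc j) * d \<le> real i * d" using d by (intro mult_right_mono) auto
    then show ?thesis using f d by (intro slice_orth) (auto simp: algebra_simps)
  qed
qed (auto intro: slice_dom f d)

lemma form_slices_total:
  assumes f: "f \<in> \<F>" and d: "0 < d" and b: "\<And>x. 0 \<le> f x" "\<And>x. f x \<le> real N * d"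
  shows "(\<Sum>k<N. \<E> (\<lambda>x. slice (real k * d) d (f x)) (\<lambda>x. slice (real k * d) d (f x))) = \<E> f f"
proof -
  have "(\<Sum>k<N. 1 * slice (real k * d) d (f x)) = f x" for x
    using slice_sum[of d 0 "f x" N] slice_id[of 0 "f x" "real N * d"] b[of x] d by simp
  then show ?thesis using form_slices[OF f d, of "\<lambda>_. 1" N] by simp
qed

text \<open>A contraction principle for piecewise linear functions of \<open>f\<close>: by
  orthogonality the energy is a sum over the layers weighted with squared slopes, and the energies
  of the layers add up to that of \<open>f\<close>.\<close>

lemma form_slices_bound:
  assumes f: "f \<in> \<F>" and d: "0 < d" and b: "\<And>x. 0 \<le> f x" "\<And>x. f x \<le> real N * d"
    and c: "\<And>k. k < N \<Longrightarrow> \<bar>c k\<bar> \<le> L"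
  shows "\<E> (\<lambda>x. \<Sum>k<N. c k * slice (real k * d) d (f x)) (\<lambda>x. \<Sum>k<N. c k * slice (real k * d) d (f x))
    \<le> L\<^sup>2 * \<E> f f"
  unfolding form_slices[OF f d] form_slices_total[OF f d b, symmetric] sum_distrib_left
  using c by (intro sum_mono mult_right_mono form_nonneg slice_dom f d)
     (metis abs_ge_zero abs_le_square_iff abs_of_nonneg lessThan_iff order_trans)

lemma AE_bounded_L2:
  assumes [measurable]: "g \<in> borel_measurable M" and "AE x in M. \<bar>g x\<bar> \<le> C"
  shows "integrable M g" "integrable M (\<lambda>x. (g x)\<^sup>2)" "g \<in> L2_space M"
proof -
  show "integrable M g"
    using assms(2) by (intro integrable_const_bound[where B=C]) auto
  show "integrable M (\<lambda>x. (g x)\<^sup>2)"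
  proof (intro integrable_const_bound[where B="C\<^sup>2"])
    show "AE x in M. norm ((g x)\<^sup>2) \<le> C\<^sup>2"
      using assms(2) by eventually_elim (metis abs_ge_zero norm_power power_mono real_norm_def)
  qed auto
  then show "g \<in> L2_space M" by (simp add: L2_space_def)
qed

text \<open>Uniform convergence provides the limit in L^2, the decay of the slope differences
  provides the Cauchy property, and \<open>form_closed\<close> joins the two. The convergence in
  energy, not just membership of the square, is what later carries the derivation property to the
  limit.\<close>

lemma sq_interp_conv:
  assumes f: "f \<in> \<F>" and b: "\<And>x. 0 \<le> f x" "\<And>x. f x \<le> 1"
  shows "(\<lambda>x. sq_interp j (f x)) \<in> \<F>" "(\<lambda>x. (f x)\<^sup>2) \<in> \<F>"
    "(\<lambda>j. energy_dist M \<E> (\<lambda>x. sq_interp j (f x)) (\<lambda>x. (f x)\<^sup>2)) \<longlonglongrightarrow> 0"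
proof -
  have [measurable]: "f \<in> borel_measurable M" using f by (rule dom_meas)
  have u: "(\<lambda>x. sq_interp j (f x)) \<in> \<F>" for j
    unfolding sq_interp_def by (intro dom_sum dom_scale slice_dom f) simp
  then show "(\<lambda>x. sq_interp j (f x)) \<in> \<F>" .
  have g: "(\<lambda>x. (f x)\<^sup>2) \<in> L2_space M"
    by (rule AE_bounded_L2[where C=1]) (use b in \<open>auto simp: power_le_one\<close>)
  have lim: "(\<lambda>j. \<integral>x. (sq_interp j (f x) - (f x)\<^sup>2)\<^sup>2 \<partial>M) \<longlonglongrightarrow> 0"
  proof (rule tendsto_sandwich)
    show "\<forall>\<^sub>F j in sequentially. 0 \<le> (\<integral>x. (sq_interp j (f x) - (f x)\<^sup>2)\<^sup>2 \<partial>M)" by simp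
    show "\<forall>\<^sub>F j in sequentially. (\<integral>x. (sq_interp j (f x) - (f x)\<^sup>2)\<^sup>2 \<partial>M) \<le> (1 / 2^j)\<^sup>2"
    proof (rule always_eventually, rule allI)
      fix j
      have le: "(sq_interp j (f x) - (f x)\<^sup>2)\<^sup>2 \<le> (1 / 2^j)\<^sup>2" for x
        using sq_interp_approx[OF b(1)[of x] b(2)[of x], of j] by (metis abs_ge_zero power2_abs power_mono)
      have "(\<integral>x. (sq_interp j (f x) - (f x)\<^sup>2)\<^sup>2 \<partial>M) \<le> (\<integral>x. (1 / 2^j)\<^sup>2 \<partial>M)"
      proof (rule integral_mono)
        show "integrable M (\<lambda>x. (sq_interp j (f x) - (f x)\<^sup>2)\<^sup>2)"
          using u[of j] g dom_meas dom_sq_int by (intro sq_diff_int) (auto simp: L2_space_def)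
      qed (use le in auto)
      then show "(\<integral>x. (sq_interp j (f x) - (f x)\<^sup>2)\<^sup>2 \<partial>M) \<le> (1 / 2^j)\<^sup>2" by (simp add: prob_space)
    qed
    have "(\<lambda>j. (1/2::real)^j) \<longlonglongrightarrow> 0" by (rule LIMSEQ_realpow_zero) auto
    then have "(\<lambda>j. ((1/2::real)^j)\<^sup>2) \<longlonglongrightarrow> 0\<^sup>2" by (rule tendsto_power)
    then show "(\<lambda>j. (1 / 2^j :: real)\<^sup>2) \<longlonglongrightarrow> 0" by (simp add: power_divide)
  qed simp
  have *: "\<E> (\<lambda>x. sq_interp i (f x) - sq_interp j (f x)) (\<lambda>x. sq_interp i (f x) - sq_interp j (f x)) \<le> (1 / 2^i)\<^sup>2 * \<E> f f"
    if "i \<le> j" for i j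
  proof -
    have eq: "sq_interp i t - sq_interp j t = (\<Sum>k<2^j. ((2 * real (k div 2^(j-i)) + 1) / 2^i - (2 * real k + 1) / 2^j)
         * slice (real k * (1 / 2^j)) (1 / 2^j) t)" for t
      unfolding sq_interp_refine[OF that] by (simp add: sq_interp_def[of j] sum_subtractf[symmetric] algebra_simps)
    show ?thesis unfolding eq
      using b refine_slope[OF that] by (intro form_slices_bound f) auto
  qed
  have cauchy: "\<exists>N. \<forall>m\<ge>N. \<forall>n\<ge>N. \<E> (\<lambda>x. sq_interp m (f x) - sq_interp n (f x)) (\<lambda>x. sq_interp m (f x) - sq_interp n (f x)) < e"
    if e: "0 < e" for e
  proof -
    have "(\<lambda>j. (1/2::real)^j) \<longlonglongrightarrow> 0" by (rule LIMSEQ_realpow_zero) auto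
    then have "(\<lambda>j. ((1/2::real)^j)\<^sup>2 * \<E> f f) \<longlonglongrightarrow> 0\<^sup>2 * \<E> f f"
      by (intro tendsto_mult tendsto_power tendsto_const)
    then have "\<forall>\<^sub>F j in sequentially. ((1/2::real)^j)\<^sup>2 * \<E> f f < e"
      using e by (intro order_tendstoD) auto
    then obtain N where N: "\<And>j. j \<ge> N \<Longrightarrow> (1 / 2^j)\<^sup>2 * \<E> f f < e"
      by (auto simp: eventually_sequentially power_divide)
    show ?thesis
    proof (intro exI allI impI)
      fix m n assume mn: "N \<le> m" "N \<le> n"
      show "\<E> (\<lambda>x. sq_interp m (f x) - sq_interp n (f x)) (\<lambda>x. sq_interp m (f x) - sq_interp n (f x)) < e"
      proof (cases "m \<le> n")
        case True then show ?thesis using *[of m n] N[of m] mn by linarith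
      next
        case False
        then have le: "\<E> (\<lambda>x. sq_interp n (f x) - sq_interp m (f x)) (\<lambda>x. sq_interp n (f x) - sq_interp m (f x)) < e"
          using *[of n m] N[of n] mn by linarith
        have "\<E> (\<lambda>x. sq_interp m (f x) - sq_interp n (f x)) (\<lambda>x. sq_interp m (f x) - sq_interp n (f x))
           = \<E> (\<lambda>x. sq_interp n (f x) - sq_interp m (f x)) (\<lambda>x. sq_interp n (f x) - sq_interp m (f x))"
          using u by (simp add: form_diff form_diff_right dom_diff)
        with le show ?thesis by simp
      qed
    qed
  qed
  show "(\<lambda>x. (f x)\<^sup>2) \<in> \<F>" by (rule form_closed(1)[OF u g lim cauchy])
  show "(\<lambda>j. energy_dist M \<E> (\<lambda>x. sq_interp j (f x)) (\<lambda>x. (f x)\<^sup>2)) \<longlonglongrightarrow> 0"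
    by (rule form_closed(2)[OF u g lim cauchy])
qed

section \<open>The algebra of bounded functions in the domain\<close>

abbreviation \<F>b :: "('a \<Rightarrow> real) set" where "\<F>b \<equiv> \<F> \<inter> Linf_space M"

lemma FbI: "f \<in> \<F> \<Longrightarrow> (AE x in M. \<bar>f x\<bar> \<le> C) \<Longrightarrow> f \<in> \<F>b"
  using dom_meas by (auto simp: Linf_space_def)

lemma FbE:
  assumes "f \<in> \<F>b" obtains C where "0 < C" "AE x in M. \<bar>f x\<bar> \<le> C"
proof -
  obtain C where C: "AE x in M. \<bar>f x\<bar> \<le> C" using assms by (auto simp: Linf_space_def)
  show ?thesis by (rule that[of "max C 1"]) (use C in auto)
qed

lemma Fb_slice: "f \<in> \<F> \<Longrightarrow> 0 < d \<Longrightarrow> (\<lambda>x. slice a d (f x)) \<in> \<F>b"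
  using slice_nonneg slice_le by (intro FbI[where C=d] slice_dom) (auto simp: abs_of_nonneg slice_nonneg slice_le)

lemma Fb_const: "(\<lambda>x. c) \<in> \<F>b"
  by (intro FbI[where C="\<bar>c\<bar>"] dom_const) auto

lemma Fb_add: assumes "f \<in> \<F>b" "g \<in> \<F>b" shows "(\<lambda>x. f x + g x) \<in> \<F>b"
proof -
  obtain C D where "AE x in M. \<bar>f x\<bar> \<le> C" "AE x in M. \<bar>g x\<bar> \<le> D" using assms FbE by metis
  then have "AE x in M. \<bar>f x + g x\<bar> \<le> C + D" by eventually_elim auto
  then show ?thesis using assms by (intro FbI[where C="C+D"] dom_add) auto
qed

lemma Fb_scale: assumes "f \<in> \<F>b" shows "(\<lambda>x. c * f x) \<in> \<F>b"
proof -
  obtain C where "AE x in M. \<bar>f x\<bar> \<le> C" using assms FbE by metis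
  then have "AE x in M. \<bar>c * f x\<bar> \<le> \<bar>c\<bar> * C" by eventually_elim (auto simp: abs_mult mult_left_mono)
  then show ?thesis using assms by (intro FbI[where C="\<bar>c\<bar> * C"] dom_scale) auto
qed

lemma Fb_diff: "f \<in> \<F>b \<Longrightarrow> g \<in> \<F>b \<Longrightarrow> (\<lambda>x. f x - g x) \<in> \<F>b"
  using Fb_add[of f "\<lambda>x. (-1) * g x"] Fb_scale[of g "-1"] by simp

lemma Fb_sum: "(\<And>i. i \<in> I \<Longrightarrow> f i \<in> \<F>b) \<Longrightarrow> (\<lambda>x. \<Sum>i\<in>I. f i x) \<in> \<F>b"
proof (induction I rule: infinite_finite_induct)
  case (insert i I)
  have "(\<lambda>x. f i x + (\<Sum>i\<in>I. f i x)) \<in> \<F>b" using insert by (intro Fb_add) blast+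
  then show ?case using insert by simp
qed (simp_all add: Fb_const[of 0, simplified])

text \<open>Interpolation lives on [0, 1] with bounds valid everywhere, whereas membership in
  \<open>\<F>b\<close> bounds a function only almost everywhere. Cutting with a layer gives
  everywhere valid bounds, and the identity with \<open>f\<close> holds almost everywhere.\<close>

lemma Fb_normal:
  assumes f: "f \<in> \<F>b"
  obtains u L where "u \<in> \<F>b" "\<And>x. 0 \<le> u x" "\<And>x. u x \<le> 1" "0 < L" "AE x in M. f x = 2 * L * u x - L"
proof -
  obtain L where L: "0 < L" "AE x in M. \<bar>f x\<bar> \<le> L" using f FbE by metis
  define u where "u x = (1/(2*L)) * slice (-L) (2*L) (f x)" for x
  have "u \<in> \<F>b" unfolding u_def using f L by (intro Fb_scale Fb_slice) auto
  moreover have "0 \<le> u x" "u x \<le> 1" for x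
    unfolding u_def using slice_nonneg[of "-L" "2*L" "f x"] slice_le[of "2*L" "-L" "f x"] L by auto
  moreover have "AE x in M. f x = 2 * L * u x - L"
    using L(2)
  proof eventually_elim
    fix x assume "\<bar>f x\<bar> \<le> L"
    then have "slice (-L) (2*L) (f x) = f x - (-L)" by (intro slice_id) auto
    then show "f x = 2 * L * u x - L" using L(1) by (simp add: u_def)
  qed
  ultimately show ?thesis using that L by blast
qed

lemma Fb_square: assumes f: "f \<in> \<F>b" shows "(\<lambda>x. (f x)\<^sup>2) \<in> \<F>b"
proof -
  obtain u L where u: "u \<in> \<F>b" "\<And>x. 0 \<le> u x" "\<And>x. u x \<le> 1" "0 < L" "AE x in M. f x = 2 * L * u x - L"
    using Fb_normal[OF f] by metis
  have usq: "(\<lambda>x. (u x)\<^sup>2) \<in> \<F>" using sq_interp_conv(2) u by blast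
  have 1: "(\<lambda>x. (4*L^2) * (u x)\<^sup>2 + ((- 4*L^2) * u x + L^2)) \<in> \<F>"
    using u usq by (intro dom_add dom_scale dom_const) auto
  have 2: "AE x in M. (4*L^2) * (u x)\<^sup>2 + ((- 4*L^2) * u x + L^2) = (f x)\<^sup>2"
    using u(5)
  proof eventually_elim
    fix x assume eq: "f x = 2 * L * u x - L"
    show "(4*L^2) * (u x)\<^sup>2 + ((- 4*L^2) * u x + L^2) = (f x)\<^sup>2"
      unfolding eq by (simp add: power2_eq_square algebra_simps)
  qed
  have fm: "(\<lambda>x. (f x)\<^sup>2) \<in> borel_measurable M"
    using f by (intro borel_measurable_power dom_meas) simp
  have F: "(\<lambda>x. (f x)\<^sup>2) \<in> \<F>" by (rule dom_AE[OF 1 fm 2])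
  obtain C where C: "0 < C" "AE x in M. \<bar>f x\<bar> \<le> C" using f FbE by metis
  have "AE x in M. \<bar>(f x)\<^sup>2\<bar> \<le> C\<^sup>2"
    using C(2)
  proof eventually_elim
    fix x assume "\<bar>f x\<bar> \<le> C"
    then show "\<bar>(f x)\<^sup>2\<bar> \<le> C\<^sup>2" using abs_le_square_iff[of "f x" C] C(1) by simp
  qed
  then show ?thesis using F by (rule FbI[rotated])
qed

text \<open>Polarisation of the square.\<close>

lemma Fb_mult: assumes "f \<in> \<F>b" "g \<in> \<F>b" shows "(\<lambda>x. f x * g x) \<in> \<F>b"
proof -
  have "(\<lambda>x. (1/2) * ((f x + g x)\<^sup>2 - ((f x)\<^sup>2 + (g x)\<^sup>2))) \<in> \<F>b"
    by (intro Fb_scale Fb_diff Fb_add Fb_square assms)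
  moreover have "(1/2) * ((f x + g x)\<^sup>2 - ((f x)\<^sup>2 + (g x)\<^sup>2)) = f x * g x" for x
    by (simp add: power2_eq_square algebra_simps)
  ultimately show ?thesis by simp
qed

end

section \<open>The derivation property of the carre du champ\<close>

locale carre_structure = dirichlet_structure +
  fixes \<gamma> :: "('a \<Rightarrow> real) \<Rightarrow> ('a \<Rightarrow> real) \<Rightarrow> 'a \<Rightarrow> real"
  assumes cdc: "carre_du_champ M \<E> \<F> \<gamma>"
begin

lemma carre_int: "f \<in> \<F> \<Longrightarrow> g \<in> \<F> \<Longrightarrow> integrable M (\<gamma> f g)"
  using cdc by (simp add: carre_du_champ_def)

lemma carre_meas [measurable_dest]: "f \<in> \<F> \<Longrightarrow> g \<in> \<F> \<Longrightarrow> \<gamma> f g \<in> borel_measurable M"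
  using carre_int by blast

lemma carre_cong: "f \<in> \<F> \<Longrightarrow> f' \<in> \<F> \<Longrightarrow> g \<in> \<F> \<Longrightarrow> (AE x in M. f x = f' x) \<Longrightarrow> AE x in M. \<gamma> f g x = \<gamma> f' g x"
  using cdc by (simp add: carre_du_champ_def)

lemma carre_nonneg: "f \<in> \<F> \<Longrightarrow> AE x in M. 0 \<le> \<gamma> f f x"
  using cdc by (simp add: carre_du_champ_def)

lemma carre_sym: "f \<in> \<F> \<Longrightarrow> g \<in> \<F> \<Longrightarrow> AE x in M. \<gamma> f g x = \<gamma> g f x"
  using cdc by (simp add: carre_du_champ_def)

lemma carre_add: "f \<in> \<F> \<Longrightarrow> g \<in> \<F> \<Longrightarrow> h \<in> \<F> \<Longrightarrow> AE x in M. \<gamma> (\<lambda>y. f y + g y) h x = \<gamma> f h x + \<gamma> g h x"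
  using cdc by (simp add: carre_du_champ_def)

lemma carre_scale: "f \<in> \<F> \<Longrightarrow> g \<in> \<F> \<Longrightarrow> AE x in M. \<gamma> (\<lambda>y. c * f y) g x = c * \<gamma> f g x"
  using cdc by (simp add: carre_du_champ_def)

lemma carre_cont: "f \<in> \<F> \<Longrightarrow> g \<in> \<F> \<Longrightarrow> 0 < e \<Longrightarrow> \<exists>d>0. \<forall>f'\<in>\<F>. \<forall>g'\<in>\<F>.
        energy_dist M \<E> f' f < d \<longrightarrow> energy_dist M \<E> g' g < d \<longrightarrow>
        (\<integral>x. \<bar>\<gamma> f' g' x - \<gamma> f g x\<bar> \<partial>M) < e"
  using cdc by (simp add: carre_du_champ_def)

lemma carre_formula: "f \<in> \<F>b \<Longrightarrow> g \<in> \<F>b \<Longrightarrow> h \<in> \<F>b \<Longrightarrow>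
   1/2 * \<E> (\<lambda>x. f x * h x) g + 1/2 * \<E> (\<lambda>x. g x * h x) f - 1/2 * \<E> h (\<lambda>x. f x * g x)
          = (\<integral>x. h x * \<gamma> f g x \<partial>M)"
  using cdc unfolding carre_du_champ_def by blast

lemma carre_add_right:
  assumes "f \<in> \<F>" "g \<in> \<F>" "h \<in> \<F>"
  shows "AE x in M. \<gamma> h (\<lambda>y. f y + g y) x = \<gamma> h f x + \<gamma> h g x"
  using carre_add[OF assms] carre_sym[OF assms(3) dom_add[OF assms(1,2)]] carre_sym[OF assms(3,1)] carre_sym[OF assms(3,2)]
  by eventually_elim simp

lemma carre_scale_right:
  assumes "f \<in> \<F>" "g \<in> \<F>"
  shows "AE x in M. \<gamma> g (\<lambda>y. c * f y) x = c * \<gamma> g f x"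
  using carre_scale[OF assms, of c] carre_sym[OF assms(2) dom_scale[OF assms(1)], of c] carre_sym[OF assms(2,1)]
  by eventually_elim simp

lemma carre_diff:
  assumes "f \<in> \<F>" "g \<in> \<F>" "h \<in> \<F>"
  shows "AE x in M. \<gamma> (\<lambda>y. f y - g y) h x = \<gamma> f h x - \<gamma> g h x"
  using carre_add[OF assms(1) dom_scale[OF assms(2), of "-1"] assms(3)] carre_scale[OF assms(2,3), of "-1"]
  by eventually_elim simp

lemma carre_sum:
  assumes "finite I" "\<And>i. i \<in> I \<Longrightarrow> f i \<in> \<F>" "g \<in> \<F>"
  shows "AE x in M. \<gamma> (\<lambda>y. \<Sum>i\<in>I. f i y) g x = (\<Sum>i\<in>I. \<gamma> (f i) g x)"
  using assms
proof (induction I)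
  case empty
  have "AE x in M. \<gamma> (\<lambda>y. 0 * (0::real)) g x = 0 * \<gamma> (\<lambda>y. 0) g x"
    by (rule carre_scale) (use empty dom_const in auto)
  then show ?case by simp
next
  case (insert i I)
  have "AE x in M. \<gamma> (\<lambda>y. f i y + (\<Sum>i\<in>I. f i y)) g x = \<gamma> (f i) g x + \<gamma> (\<lambda>y. \<Sum>i\<in>I. f i y) g x"
    using insert by (intro carre_add dom_sum) auto
  moreover have "AE x in M. \<gamma> (\<lambda>y. \<Sum>i\<in>I. f i y) g x = (\<Sum>i\<in>I. \<gamma> (f i) g x)"
    using insert by simp
  ultimately show ?case using insert(1,2) by (auto elim: eventually_elim2)
qed

section \<open>Positivity and locality of the carre du champ\<close>

lemma carre_expand:
  assumes g: "g \<in> \<F>" and u: "u \<in> \<F>"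
  shows "AE x in M. 0 \<le> \<gamma> g g x + 2 * c * \<gamma> u g x + c\<^sup>2 * \<gamma> u u x"
proof -
  have cu: "(\<lambda>y. c * u y) \<in> \<F>" and s: "(\<lambda>y. g y + c * u y) \<in> \<F>" by (intro dom_add dom_scale g u)+
  show ?thesis
    using carre_nonneg[OF s] carre_add[OF g cu s] carre_add_right[OF g cu g] carre_add_right[OF g cu cu]
      carre_scale[OF u g, of c] carre_scale[OF u cu, of c] carre_scale_right[OF u g, of c] carre_scale_right[OF u u, of c]
      carre_sym[OF u g]
    by eventually_elim (simp add: power2_eq_square algebra_simps)
qed

text \<open>The values \<open>c = 1\<close> and \<open>c = -1\<close> of the quadratic suffice: a
  linear substitute for Cauchy-Schwarz that avoids uncountably many exceptional sets.\<close>

lemma carre_half: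
  assumes g: "g \<in> \<F>" and u: "u \<in> \<F>"
  shows "AE x in M. \<bar>\<gamma> u g x\<bar> \<le> (\<gamma> u u x + \<gamma> g g x) / 2"
  using carre_expand[OF g u, of 1] carre_expand[OF g u, of "-1"]
  by eventually_elim auto

text \<open>If \<open>\<gamma> u u x = 0\<close>, the quadratic of \<open>carre_expand\<close> is
  affine in \<open>c\<close>, and nonnegativity at all integers of both signs forces its slope to
  vanish. Integers are taken because the exceptional null set depends on \<open>c\<close>.\<close>

lemma carre_degenerate:
  assumes g: "g \<in> \<F>" and u: "u \<in> \<F>"
  shows "AE x in M. \<gamma> u u x = 0 \<longrightarrow> \<gamma> u g x = 0"
proof -
  have "AE x in M. \<forall>z::int. 0 \<le> \<gamma> g g x + 2 * real_of_int z * \<gamma> u g x + (real_of_int z)\<^sup>2 * \<gamma> u u x"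
    unfolding AE_all_countable by (intro allI carre_expand g u)
  then show ?thesis
  proof eventually_elim
    fix x assume *: "\<forall>z::int. 0 \<le> \<gamma> g g x + 2 * real_of_int z * \<gamma> u g x + (real_of_int z)\<^sup>2 * \<gamma> u u x"
    show "\<gamma> u u x = 0 \<longrightarrow> \<gamma> u g x = 0"
    proof (intro impI, rule ccontr)
      assume 0: "\<gamma> u u x = 0" and n: "\<gamma> u g x \<noteq> 0"
      obtain n :: nat where "\<gamma> g g x < real n * \<bar>\<gamma> u g x\<bar>"
        using reals_Archimedean3[of "\<bar>\<gamma> u g x\<bar>"] n by auto
      moreover have "0 \<le> \<gamma> g g x + 2 * real n * \<gamma> u g x" "0 \<le> \<gamma> g g x - 2 * real n * \<gamma> u g x"
        using *[rule_format, of "int n"] *[rule_format, of "- int n"] 0 by auto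
      moreover have "0 \<le> real n * \<bar>\<gamma> u g x\<bar>" by simp
      ultimately show False by (cases "\<gamma> u g x \<ge> 0") (simp_all add: abs_if split: if_splits)
    qed
  qed
qed

lemma integral_abs_zero:
  fixes r :: "'a \<Rightarrow> real"
  assumes "integrable M r" "(\<integral>x. \<bar>r x\<bar> \<partial>M) \<le> 0"
  shows "AE x in M. r x = 0"
proof -
  have "(\<integral>x. \<bar>r x\<bar> \<partial>M) = 0" using assms(2) by (intro antisym) auto
  then have "AE x in M. \<bar>r x\<bar> = 0"
    using integral_nonneg_eq_0_iff_AE[of M "\<lambda>x. \<bar>r x\<bar>"] assms(1) by simp
  then show ?thesis by simp
qed

text \<open>The defining formula with \<open>h = 1\<close>; constants are orthogonal to the
  domain.\<close>

lemma carre_integral_Fb: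
  assumes u: "u \<in> \<F>b" and v: "v \<in> \<F>b"
  shows "(\<integral>x. \<gamma> u v x \<partial>M) = \<E> u v"
proof -
  have "1/2 * \<E> (\<lambda>x. u x * 1) v + 1/2 * \<E> (\<lambda>x. v x * 1) u - 1/2 * \<E> (\<lambda>x. 1) (\<lambda>x. u x * v x)
          = (\<integral>x. 1 * \<gamma> u v x \<partial>M)"
    by (rule carre_formula[OF u v Fb_const])
  moreover have "\<E> (\<lambda>x. 1) (\<lambda>x. u x * v x) = 0"
    using Fb_mult[OF u v] by (intro form_const) auto
  moreover have "\<E> v u = \<E> u v" using u v form_sym by auto
  ultimately show ?thesis by simp
qed

lemma carre_const:
  assumes g: "g \<in> \<F>"
  shows "AE x in M. \<gamma> (\<lambda>x. c) g x = 0"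
proof -
  have "(\<integral>x. \<gamma> (\<lambda>x. c) (\<lambda>x. c) x \<partial>M) = 0"
    using carre_integral_Fb[OF Fb_const Fb_const] form_const dom_const by simp
  then have "AE x in M. \<gamma> (\<lambda>x. c) (\<lambda>x. c) x = 0"
    using integral_nonneg_eq_0_iff_AE[OF carre_int carre_nonneg] dom_const by metis
  then show ?thesis using carre_degenerate[OF g dom_const[of c]] by eventually_elim simp
qed

lemma bounded_mult_int:
  fixes v r :: "'a \<Rightarrow> real"
  assumes "v \<in> borel_measurable M" "AE x in M. \<bar>v x\<bar> \<le> C" "integrable M r"
  shows "integrable M (\<lambda>x. v x * r x)"
proof (rule Bochner_Integration.integrable_bound[where f="\<lambda>x. C * r x"])
  show "AE x in M. norm (v x * r x) \<le> norm (C * r x)"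
    using assms(2) by eventually_elim (simp add: abs_mult mult_right_mono)
qed (use assms in auto)

lemma Fb_mult_int: "v \<in> \<F>b \<Longrightarrow> integrable M r \<Longrightarrow> integrable M (\<lambda>x. v x * r x)"
  using FbE[of v thesis for thesis] bounded_mult_int dom_meas by (metis FbE IntE)

text \<open>Strong locality for the density instead of the integral: \<open>u\<close> is the
  constant \<open>-a\<close> wherever \<open>v\<close> is nonzero. Every term of the defining
  formula with \<open>h = v\<close> vanishes, which gives \<open>v * \<gamma> u u = 0\<close> by
  positivity, and \<open>carre_degenerate\<close> passes from \<open>\<gamma> u u\<close> to
  \<open>\<gamma> u g\<close>.\<close>

lemma carre_local:
  assumes u: "u \<in> \<F>b" and v: "v \<in> \<F>b" "\<And>x. 0 \<le> v x" and uv: "AE x in M. (u x + a) * v x = 0"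
    and g: "g \<in> \<F>"
  shows "AE x in M. v x * \<gamma> u g x = 0"
proof -
  have uF: "u \<in> \<F>" and vF: "v \<in> \<F>" using u v by auto
  have E: "\<E> u v = 0" by (rule strong_local[OF uF vF uv])
  \<comment> \<open>Here \<open>u v = -a v\<close>, and \<open>\<E> u v\<close> already vanishes by
    locality.\<close>
  have "\<E> (\<lambda>x. u x * v x) u = \<E> (\<lambda>x. (-a) * v x) u"
    using Fb_mult[OF u v(1)] by (intro form_AE dom_scale vF uF) (use uv in \<open>auto simp: algebra_simps\<close>)
  then have 1: "\<E> (\<lambda>x. u x * v x) u = 0"
    using form_scale[OF vF uF, of "-a"] E form_sym[OF uF vF] by simp
  \<comment> \<open>The difference of squares has the factor \<open>u + a\<close>, so locality
    applies to the square of \<open>u\<close> as well.\<close>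
  have "\<E> (\<lambda>x. u x * u x) v = 0"
  proof (rule strong_local)
    show "AE x in M. (u x * u x + - (a*a)) * v x = 0"
      using uv
    proof eventually_elim
      fix x assume 0: "(u x + a) * v x = 0"
      have "(u x * u x + - (a*a)) * v x = (u x - a) * ((u x + a) * v x)" by (simp add: algebra_simps)
      then show "(u x * u x + - (a*a)) * v x = 0" using 0 by simp
    qed
  qed (use Fb_mult[OF u u] vF in auto)
  then have 2: "\<E> v (\<lambda>x. u x * u x) = 0" using Fb_mult[OF u u] vF form_sym by auto
  have "(\<integral>x. v x * \<gamma> u u x \<partial>M) = 0"
    using carre_formula[OF u u v(1)] 1 2 by simp
  moreover have "AE x in M. 0 \<le> v x * \<gamma> u u x" using carre_nonneg[OF uF] by eventually_elim (simp add: v)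
  ultimately have "AE x in M. v x * \<gamma> u u x = 0"
    using integral_nonneg_eq_0_iff_AE[OF Fb_mult_int[OF v(1) carre_int[OF uF uF]]] by simp
  then show ?thesis using carre_degenerate[OF g uF] by eventually_elim auto
qed

section \<open>The square rule and the Leibniz rule\<close>

lemma carre_tendsto:
  assumes f: "\<And>n. f n \<in> \<F>" "f' \<in> \<F>" and g: "g \<in> \<F>" and lim: "(\<lambda>n::nat. energy_dist M \<E> (f n) f') \<longlonglongrightarrow> 0"
  shows "(\<lambda>n. \<integral>x. \<bar>\<gamma> (f n) g x - \<gamma> f' g x\<bar> \<partial>M) \<longlonglongrightarrow> 0"
proof (rule LIMSEQ_I)
  fix e :: real assume "0 < e"
  then obtain d where d: "d > 0" "\<And>h h'. h \<in> \<F> \<Longrightarrow> h' \<in> \<F> \<Longrightarrow>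
        energy_dist M \<E> h f' < d \<Longrightarrow> energy_dist M \<E> h' g < d \<Longrightarrow>
        (\<integral>x. \<bar>\<gamma> h h' x - \<gamma> f' g x\<bar> \<partial>M) < e"
    using carre_cont[OF f(2) g] by metis
  have gg: "energy_dist M \<E> g g < d" using d(1) form_const(1)[OF dom_const, of 0 0] by (simp add: energy_dist_def energy_inner_def)
  have "eventually (\<lambda>n. energy_dist M \<E> (f n) f' < d) sequentially"
    using order_tendstoD(2)[OF lim d(1)] .
  then obtain N where "\<And>n. n \<ge> N \<Longrightarrow> energy_dist M \<E> (f n) f' < d" by (auto simp: eventually_sequentially)
  then show "\<exists>no. \<forall>n\<ge>no. norm ((\<integral>x. \<bar>\<gamma> (f n) g x - \<gamma> f' g x\<bar> \<partial>M) - 0) < e"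
    using d(2)[OF f(1) g _ gg] by auto
qed

text \<open>Closed layers overlap at their endpoints, so a point may lie in two of them. They have
  to be closed because locality only makes \<gamma> vanish strictly below and strictly above a
  layer.\<close>

lemma card_active_le:
  fixes t d :: real
  assumes "0 < d" "0 \<le> t"
  shows "(\<Sum>k<N. indicator {real k * d .. real k * d + d} t :: real) \<le> 2"
proof -
  define m where "m = nat \<lfloor>t / d\<rfloor>"
  have "(\<Sum>k<N. indicator {real k * d .. real k * d + d} t :: real) = real (card {k\<in>{..<N}. t \<in> {real k * d .. real k * d + d}})"
    by (simp add: indicator_def sum.If_cases Int_def)
  also have "{k\<in>{..<N}. t \<in> {real k * d .. real k * d + d}} \<subseteq> {m - 1, m}"
  proof
    fix k assume "k \<in> {k\<in>{..<N}. t \<in> {real k * d .. real k * d + d}}"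
    then have "real k * d \<le> t" "t \<le> (real k + 1) * d" by (auto simp: algebra_simps)
    then have "real k \<le> t / d" "t / d \<le> real k + 1" using assms by (auto simp: field_simps)
    then have "int k \<le> \<lfloor>t/d\<rfloor>" "\<lfloor>t/d\<rfloor> \<le> int k + 1" by linarith+
    then show "k \<in> {m - 1, m}" unfolding m_def by auto
  qed
  then have "card {k\<in>{..<N}. t \<in> {real k * d .. real k * d + d}} \<le> card {m - 1, m}"
    by (intro card_mono) auto
  also have "\<dots> \<le> 2" by (simp add: card_insert_if)
  finally show ?thesis by simp
qed

text \<open>The auxiliary functions \<open>v1\<close> and \<open>v2\<close> are positive below and
  above the layer, where \<open>S\<close> is constant, so \<open>\<gamma> S g\<close> is carried by
  the closed layer. There the slope \<open>(2 k + 1) d\<close> of the interpolation differs from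
  \<open>2 u\<close> by at most \<open>d\<close>.\<close>

lemma carre_slice:
  assumes u: "u \<in> \<F>b" "\<And>x. 0 \<le> u x" "\<And>x. u x \<le> 1" and g: "g \<in> \<F>" and d: "0 < d"
  shows "AE x in M. \<bar>((2 * real k + 1) * d - 2 * u x) * \<gamma> (\<lambda>x. slice (real k * d) d (u x)) g x\<bar>
    \<le> d / 2 * (\<gamma> (\<lambda>x. slice (real k * d) d (u x)) (\<lambda>x. slice (real k * d) d (u x)) x
        + indicator {real k * d .. real k * d + d} (u x) * \<gamma> g g x)"
proof -
  define a where "a = real k * d"
  have a: "0 \<le> a" using d by (simp add: a_def)
  define S where "S = (\<lambda>x. slice a d (u x))"
  have uF: "u \<in> \<F>" and SF: "S \<in> \<F>b" using u d unfolding S_def by (auto intro: slice_dom intro!: Fb_slice simp del: Int_iff)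
  define v1 where "v1 = (\<lambda>x. slice (-a) (a + 1) (-1 * u x))"
  define v2 where "v2 = (\<lambda>x. slice (a + d) 1 (u x))"
  have "v1 \<in> \<F>b" "v2 \<in> \<F>b" unfolding v1_def v2_def using uF a by (intro Fb_slice dom_scale; simp)+
  have "AE x in M. v1 x * \<gamma> S g x = 0"
  proof (rule carre_local[OF SF \<open>v1 \<in> \<F>b\<close> _ _ g, where a=0])
    show "AE x in M. (S x + 0) * v1 x = 0"
      by (intro AE_I2) (auto simp: S_def v1_def slice_def max_def min_def)
  qed (simp add: v1_def slice_nonneg)
  moreover have "AE x in M. v2 x * \<gamma> S g x = 0"
  proof (rule carre_local[OF SF \<open>v2 \<in> \<F>b\<close> _ _ g, where a="-d"])
    show "AE x in M. (S x + -d) * v2 x = 0"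
      using d by (intro AE_I2) (auto simp: S_def v2_def slice_def max_def min_def)
  qed (simp add: v2_def slice_nonneg)
  moreover have "AE x in M. \<bar>\<gamma> S g x\<bar> \<le> (\<gamma> S S x + \<gamma> g g x) / 2"
    using SF by (intro carre_half g) auto
  moreover have "AE x in M. 0 \<le> \<gamma> S S x" using SF by (intro carre_nonneg) auto
  ultimately have "AE x in M. \<bar>((2 * real k + 1) * d - 2 * u x) * \<gamma> S g x\<bar>
    \<le> d / 2 * (\<gamma> S S x + indicator {a .. a + d} (u x) * \<gamma> g g x)"
  proof eventually_elim
    fix x assume A: "v1 x * \<gamma> S g x = 0" "v2 x * \<gamma> S g x = 0" "\<bar>\<gamma> S g x\<bar> \<le> (\<gamma> S S x + \<gamma> g g x) / 2" "0 \<le> \<gamma> S S x"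
    show "\<bar>((2 * real k + 1) * d - 2 * u x) * \<gamma> S g x\<bar>
      \<le> d / 2 * (\<gamma> S S x + indicator {a .. a + d} (u x) * \<gamma> g g x)"
    proof (cases "u x \<in> {a..a+d}")
      case True
      then have "\<bar>(2 * real k + 1) * d - 2 * u x\<bar> \<le> d" by (auto simp: a_def algebra_simps)
      then have "\<bar>((2 * real k + 1) * d - 2 * u x) * \<gamma> S g x\<bar> \<le> d * ((\<gamma> S S x + \<gamma> g g x) / 2)"
        unfolding abs_mult using A(3) d by (intro mult_mono) auto
      then show ?thesis using True by simp
    next
      case False
      then have "v1 x > 0 \<or> v2 x > 0" using a u(2)[of x] u(3)[of x] by (auto simp: v1_def v2_def slice_def)
      then have "\<gamma> S g x = 0" using A by auto
      then show ?thesis using A(4) d False by simp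
    qed
  qed
  then show ?thesis by (simp add: S_def a_def)
qed

text \<open>The interpolations satisfy the rule up to an error of order \<open>1 / 2^j\<close> in
  L^1, since on each layer their slope is \<open>2 u\<close> up to \<open>d\<close>. Continuity of
  \<gamma> along energy convergence transfers the rule to the square itself.\<close>

lemma carre_square_01:
  assumes u: "u \<in> \<F>b" "\<And>x. 0 \<le> u x" "\<And>x. u x \<le> 1" and g: "g \<in> \<F>"
  shows "AE x in M. \<gamma> (\<lambda>x. (u x)\<^sup>2) g x = 2 * u x * \<gamma> u g x"
proof -
  have uF: "u \<in> \<F>" and usq: "(\<lambda>x. (u x)\<^sup>2) \<in> \<F>" using u Fb_square by auto
  have I: "(\<lambda>x. sq_interp j (u x)) \<in> \<F>" for j using sq_interp_conv(1) uF u by blast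
  define r where "r = (\<lambda>x. \<gamma> (\<lambda>x. (u x)\<^sup>2) g x - 2 * u x * \<gamma> u g x)"
  define C where "C = (\<E> u u + 2 * (\<integral>x. \<gamma> g g x \<partial>M)) / 2"
  have i1: "integrable M (\<lambda>x. 2 * u x * \<gamma> u g x)"
    using Fb_mult_int[OF Fb_scale[OF u(1), of 2] carre_int[OF uF g]] by simp
  have ri: "integrable M r" unfolding r_def using i1 usq by (intro Bochner_Integration.integrable_diff carre_int g)
  have D: "(\<integral>x. \<bar>\<gamma> (\<lambda>x. sq_interp j (u x)) g x - 2 * u x * \<gamma> u g x\<bar> \<partial>M) \<le> 1 / 2^j * C" for j
  proof -
    define d :: real where "d = 1 / 2^j"
    have d: "0 < d" "real (2^j) * d = 1" by (auto simp: d_def)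
    define S where "S k = (\<lambda>x. slice (real k * d) d (u x))" for k
    have SF: "S k \<in> \<F>" for k unfolding S_def by (intro slice_dom uF d)
    have usum: "(\<Sum>k<2^j. S k x) = u x" for x
      using slice_sum[of d 0 "u x" "2^j"] slice_id[of 0 "u x" 1] u(2,3)[of x] d by (simp add: S_def)
    have A1: "AE x in M. \<gamma> u g x = (\<Sum>k<2^j. \<gamma> (S k) g x)"
      using carre_sum[of "{..<2^j}" S g] SF g unfolding usum by simp
    have Ieq: "sq_interp j (u x) = (\<Sum>k<2^j. (2 * real k + 1) * d * S k x)" for x
      by (simp add: sq_interp_def S_def d_def)
    have A2: "AE x in M. \<gamma> (\<lambda>x. sq_interp j (u x)) g x = (\<Sum>k<2^j. \<gamma> (\<lambda>x. (2 * real k + 1) * d * S k x) g x)"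
      unfolding Ieq by (rule carre_sum) (auto intro: dom_scale SF g)
    have A3: "AE x in M. \<forall>k. \<gamma> (\<lambda>x. (2 * real k + 1) * d * S k x) g x = (2 * real k + 1) * d * \<gamma> (S k) g x"
      unfolding AE_all_countable by (intro allI carre_scale SF g)
    have A4: "AE x in M. \<forall>k. \<bar>((2 * real k + 1) * d - 2 * u x) * \<gamma> (S k) g x\<bar>
      \<le> d / 2 * (\<gamma> (S k) (S k) x + indicator {real k * d .. real k * d + d} (u x) * \<gamma> g g x)"
      unfolding AE_all_countable S_def by (intro allI carre_slice u g d)
    have A: "AE x in M. \<bar>\<gamma> (\<lambda>x. sq_interp j (u x)) g x - 2 * u x * \<gamma> u g x\<bar>
       \<le> d / 2 * ((\<Sum>k<2^j. \<gamma> (S k) (S k) x) + 2 * \<gamma> g g x)"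
      using A1 A2 A3 A4 carre_nonneg[OF g]
    proof eventually_elim
      fix x assume A: "\<gamma> u g x = (\<Sum>k<2^j. \<gamma> (S k) g x)"
        "\<gamma> (\<lambda>x. sq_interp j (u x)) g x = (\<Sum>k<2^j. \<gamma> (\<lambda>x. (2 * real k + 1) * d * S k x) g x)"
        "\<forall>k. \<gamma> (\<lambda>x. (2 * real k + 1) * d * S k x) g x = (2 * real k + 1) * d * \<gamma> (S k) g x"
        "\<forall>k. \<bar>((2 * real k + 1) * d - 2 * u x) * \<gamma> (S k) g x\<bar>
           \<le> d / 2 * (\<gamma> (S k) (S k) x + indicator {real k * d .. real k * d + d} (u x) * \<gamma> g g x)"
        "0 \<le> \<gamma> g g x"
      have "\<gamma> (\<lambda>x. sq_interp j (u x)) g x - 2 * u x * \<gamma> u g x = (\<Sum>k<2^j. ((2 * real k + 1) * d - 2 * u x) * \<gamma> (S k) g x)"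
        unfolding A(1,2) using A(3) by (simp add: sum_distrib_left sum_subtractf[symmetric] algebra_simps)
      then have "\<bar>\<gamma> (\<lambda>x. sq_interp j (u x)) g x - 2 * u x * \<gamma> u g x\<bar> \<le> (\<Sum>k<2^j. \<bar>((2 * real k + 1) * d - 2 * u x) * \<gamma> (S k) g x\<bar>)"
        by (simp only: sum_abs)
      also have "\<dots> \<le> (\<Sum>k<2^j. d / 2 * (\<gamma> (S k) (S k) x + indicator {real k * d .. real k * d + d} (u x) * \<gamma> g g x))"
        using A(4) by (intro sum_mono) auto
      also have "\<dots> = d / 2 * ((\<Sum>k<2^j. \<gamma> (S k) (S k) x) + (\<Sum>k<2^j. indicator {real k * d .. real k * d + d} (u x)) * \<gamma> g g x)"
        by (simp add: sum_distrib_left[symmetric] sum_distrib_right sum.distrib)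
      also have "\<dots> \<le> d / 2 * ((\<Sum>k<2^j. \<gamma> (S k) (S k) x) + 2 * \<gamma> g g x)"
        using card_active_le[OF d(1) u(2)] d(1) A(5) by (intro mult_left_mono add_left_mono mult_right_mono) auto
      finally show "\<bar>\<gamma> (\<lambda>x. sq_interp j (u x)) g x - 2 * u x * \<gamma> u g x\<bar>
         \<le> d / 2 * ((\<Sum>k<2^j. \<gamma> (S k) (S k) x) + 2 * \<gamma> g g x)" .
    qed
    have "(\<integral>x. \<bar>\<gamma> (\<lambda>x. sq_interp j (u x)) g x - 2 * u x * \<gamma> u g x\<bar> \<partial>M)
      \<le> (\<integral>x. d / 2 * ((\<Sum>k<2^j. \<gamma> (S k) (S k) x) + 2 * \<gamma> g g x) \<partial>M)"
    proof (rule integral_mono_AE)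
      show "integrable M (\<lambda>x. \<bar>\<gamma> (\<lambda>x. sq_interp j (u x)) g x - 2 * u x * \<gamma> u g x\<bar>)"
        using i1 carre_int[OF I g] by auto
      show "integrable M (\<lambda>x. d / 2 * ((\<Sum>k<2^j. \<gamma> (S k) (S k) x) + 2 * \<gamma> g g x))"
        using carre_int SF g by auto
    qed (rule A)
    also have "\<dots> = d / 2 * ((\<Sum>k<2^j. (\<integral>x. \<gamma> (S k) (S k) x \<partial>M)) + 2 * (\<integral>x. \<gamma> g g x \<partial>M))"
      by (simp add: Bochner_Integration.integral_sum carre_int SF g)
    \<comment> \<open>The energies of the layers add up to \<open>\<E> u u\<close> whatever their
      number; this keeps the constant \<open>C\<close> independent of \<open>j\<close>.\<close>
    also have "(\<Sum>k<2^j. (\<integral>x. \<gamma> (S k) (S k) x \<partial>M)) = (\<Sum>k<2^j. \<E> (S k) (S k))"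
      using uF d by (intro sum.cong refl carre_integral_Fb) (auto simp: S_def intro!: Fb_slice simp del: Int_iff)
    also have "\<dots> = \<E> u u"
      using form_slices_total[OF uF d(1), of "2^j"] u d by (simp add: S_def)
    finally show ?thesis by (simp add: C_def d_def algebra_simps)
  qed
  define T where "T j = (\<integral>x. \<bar>\<gamma> (\<lambda>x. sq_interp j (u x)) g x - \<gamma> (\<lambda>x. (u x)\<^sup>2) g x\<bar> \<partial>M)" for j
  have T: "T \<longlonglongrightarrow> 0" unfolding T_def
    by (rule carre_tendsto[OF I usq g sq_interp_conv(3)[OF uF u(2,3)]])
  have le: "(\<integral>x. \<bar>r x\<bar> \<partial>M) \<le> T j + (1/2)^j * C" for j
  proof -
    have "(\<integral>x. \<bar>r x\<bar> \<partial>M) \<le> (\<integral>x. \<bar>\<gamma> (\<lambda>x. sq_interp j (u x)) g x - \<gamma> (\<lambda>x. (u x)\<^sup>2) g x\<bar>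
      + \<bar>\<gamma> (\<lambda>x. sq_interp j (u x)) g x - 2 * u x * \<gamma> u g x\<bar> \<partial>M)"
      using ri i1 carre_int[OF I g] carre_int[OF usq g] by (intro integral_mono) (auto simp: r_def)
    also have "\<dots> = T j + (\<integral>x. \<bar>\<gamma> (\<lambda>x. sq_interp j (u x)) g x - 2 * u x * \<gamma> u g x\<bar> \<partial>M)"
      unfolding T_def using i1 carre_int[OF I g] carre_int[OF usq g] by (intro Bochner_Integration.integral_add) auto
    also have "\<dots> \<le> T j + (1/2)^j * C" using D[of j] by (simp add: power_divide)
    finally show ?thesis .
  qed
  have "(\<lambda>j. T j + (1/2)^j * C) \<longlonglongrightarrow> 0 + 0 * C"
    by (intro tendsto_intros T LIMSEQ_realpow_zero) auto
  then have "(\<integral>x. \<bar>r x\<bar> \<partial>M) \<le> 0"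
    using le by (intro LIMSEQ_le_const[of _ "0 + 0 * C", simplified]) auto
  from integral_abs_zero[OF ri this] show ?thesis by (simp add: r_def)
qed

lemma carre_square:
  assumes f: "f \<in> \<F>b" and g: "g \<in> \<F>"
  shows "AE x in M. \<gamma> (\<lambda>x. (f x)\<^sup>2) g x = 2 * f x * \<gamma> f g x"
proof -
  obtain u L where u: "u \<in> \<F>b" "\<And>x. 0 \<le> u x" "\<And>x. u x \<le> 1" "0 < L" "AE x in M. f x = 2 * L * u x - L"
    using Fb_normal[OF f] by metis
  have uF: "u \<in> \<F>" and usq: "(\<lambda>x. (u x)\<^sup>2) \<in> \<F>" and fF: "f \<in> \<F>" and fsq: "(\<lambda>x. (f x)\<^sup>2) \<in> \<F>"
    using u f Fb_square by auto
  have w: "(\<lambda>x. (-4*L^2) * u x + L^2) \<in> \<F>" by (intro dom_add dom_scale uF dom_const)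
  have w2: "(\<lambda>x. 2 * L * u x + (-L)) \<in> \<F>" by (intro dom_add dom_scale uF dom_const)
  have w3: "(\<lambda>x. (4*L^2) * (u x)\<^sup>2 + ((-4*L^2) * u x + L^2)) \<in> \<F>" by (intro dom_add dom_scale uF usq dom_const)
  have "AE x in M. \<gamma> f g x = \<gamma> (\<lambda>x. 2 * L * u x + (-L)) g x"
    by (rule carre_cong[OF fF w2 g]) (use u(5) in auto)
  moreover have "AE x in M. \<gamma> (\<lambda>x. (f x)\<^sup>2) g x = \<gamma> (\<lambda>x. (4*L^2) * (u x)\<^sup>2 + ((-4*L^2) * u x + L^2)) g x"
  proof (rule carre_cong[OF fsq w3 g])
    show "AE x in M. (f x)\<^sup>2 = (4*L^2) * (u x)\<^sup>2 + ((-4*L^2) * u x + L^2)"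
      using u(5)
    proof eventually_elim
      fix x assume eq: "f x = 2 * L * u x - L"
      show "(f x)\<^sup>2 = (4*L^2) * (u x)\<^sup>2 + ((-4*L^2) * u x + L^2)"
        unfolding eq by (simp add: power2_eq_square algebra_simps)
    qed
  qed
  ultimately show ?thesis
    using carre_add[OF dom_scale[OF uF, of "2*L"] dom_const[of "-L"] g]
      carre_add[OF dom_scale[OF usq, of "4*L^2"] w g] carre_add[OF dom_scale[OF uF, of "-4*L^2"] dom_const[of "L^2"] g]
      carre_scale[OF uF g, of "2*L"] carre_scale[OF uF g, of "-4*L^2"] carre_scale[OF usq g, of "4*L^2"]
      carre_const[OF g, of "-L"] carre_const[OF g, of "L^2"] carre_square_01[OF u(1-3) g] u(5)
    by eventually_elim (simp (no_asm_simp) only:, simp (no_asm) add: power2_eq_square algebra_simps)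
qed

text \<open>Polarisation of \<open>carre_square\<close>.\<close>

lemma carre_mult:
  assumes f: "f \<in> \<F>b" and h: "h \<in> \<F>b" and g: "g \<in> \<F>"
  shows "AE x in M. \<gamma> (\<lambda>x. f x * h x) g x = f x * \<gamma> h g x + h x * \<gamma> f g x"
proof -
  have F: "f \<in> \<F>" "h \<in> \<F>" "(\<lambda>x. (f x)\<^sup>2) \<in> \<F>" "(\<lambda>x. (h x)\<^sup>2) \<in> \<F>" "(\<lambda>x. (f x + h x)\<^sup>2) \<in> \<F>"
    using f h Fb_square Fb_add by blast+
  have eq: "(\<lambda>x. f x * h x) = (\<lambda>x. (1/2) * ((f x + h x)\<^sup>2 - ((f x)\<^sup>2 + (h x)\<^sup>2)))"
    by (auto simp: power2_eq_square algebra_simps)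
  have F2: "(\<lambda>x. (f x + h x)\<^sup>2 - ((f x)\<^sup>2 + (h x)\<^sup>2)) \<in> \<F>" by (intro dom_diff dom_add F)
  show ?thesis
    unfolding eq
    using carre_scale[OF F2 g, of "1/2"] carre_diff[OF F(5) dom_add[OF F(3,4)] g] carre_add[OF F(3,4) g]
      carre_square[OF f g] carre_square[OF h g] carre_square[OF Fb_add[OF f h] g] carre_add[OF F(1,2) g]
    by eventually_elim (simp add: algebra_simps)
qed

end

section \<open>Truncation and the generator\<close>

definition trunc :: "real \<Rightarrow> real \<Rightarrow> real" where
  "trunc N t = max (- N) (min t N)"

lemma trunc_slice: "0 < N \<Longrightarrow> trunc N t = slice (-N) (2*N) t + (-N)"
  by (auto simp: trunc_def slice_def max_def min_def)

lemma trunc_bound: "0 \<le> N \<Longrightarrow> \<bar>trunc N t\<bar> \<le> N" "0 \<le> N \<Longrightarrow> \<bar>trunc N t - t\<bar> \<le> \<bar>t\<bar>"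
  by (auto simp: trunc_def max_def min_def)

lemma trunc_id: "\<bar>t\<bar> \<le> N \<Longrightarrow> trunc N t = t"
  by (auto simp: trunc_def max_def min_def)

lemma trunc_measurable [measurable]: "trunc N \<in> borel_measurable borel"
  unfolding trunc_def by measurable

context dirichlet_structure
begin

lemma form_shift: "f \<in> \<F> \<Longrightarrow> g \<in> \<F> \<Longrightarrow> \<E> (\<lambda>x. f x + c) (\<lambda>x. g x + d) = \<E> f g"
  by (simp add: form_add form_add_right form_const dom_const dom_add)

lemma trunc_Fb: "f \<in> \<F> \<Longrightarrow> 0 < N \<Longrightarrow> (\<lambda>x. trunc N (f x)) \<in> \<F>b"
  unfolding trunc_slice by (intro Fb_add Fb_slice Fb_const) simp_all

lemma trunc_dom: "f \<in> \<F> \<Longrightarrow> 0 < N \<Longrightarrow> (\<lambda>x. trunc N (f x)) \<in> \<F>"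
  using trunc_Fb by blast

lemma trunc_form_le: "f \<in> \<F> \<Longrightarrow> 0 < N \<Longrightarrow> \<E> (\<lambda>x. trunc N (f x)) (\<lambda>x. trunc N (f x)) \<le> \<E> f f"
  unfolding trunc_slice by (subst form_shift) (auto intro: slice_dom)

text \<open>Pythagoras: truncation at \<open>K\<close> consists of three orthogonal layers, the
  middle one being truncation at \<open>N\<close> up to a constant. Energies of truncations
  therefore increase, and their gaps measure distances.\<close>

lemma trunc_form_diff:
  assumes f: "f \<in> \<F>" and N: "0 < N" "N < K"
  shows "\<E> (\<lambda>x. trunc K (f x) - trunc N (f x)) (\<lambda>x. trunc K (f x) - trunc N (f x))
       = \<E> (\<lambda>x. trunc K (f x)) (\<lambda>x. trunc K (f x)) - \<E> (\<lambda>x. trunc N (f x)) (\<lambda>x. trunc N (f x))"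
proof -
  define S1 where "S1 = (\<lambda>x. slice (-K) (K-N) (f x))"
  define S2 where "S2 = (\<lambda>x. slice (-N) (2*N) (f x))"
  define S3 where "S3 = (\<lambda>x. slice N (K-N) (f x))"
  have F: "S1 \<in> \<F>" "S2 \<in> \<F>" "S3 \<in> \<F>" unfolding S1_def S2_def S3_def using N by (auto intro!: slice_dom f)
  have o: "\<E> S1 S2 = 0" "\<E> S2 S1 = 0" "\<E> S1 S3 = 0" "\<E> S3 S1 = 0" "\<E> S2 S3 = 0" "\<E> S3 S2 = 0"
    unfolding S1_def S2_def S3_def
    using slice_orth[OF f, of "K-N" "2*N" "-K" "-N"] slice_orth[OF f, of "K-N" "K-N" "-K" N]
      slice_orth[OF f, of "2*N" "K-N" "-N" N] N by simp_all
  have eq: "trunc K (f x) = S1 x + S2 x + S3 x + (-K)" "trunc N (f x) = S2 x + (-N)"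
    "trunc K (f x) - trunc N (f x) = S1 x + S3 x + (N - K)" for x
  proof -
    show "trunc N (f x) = S2 x + (-N)" using N by (simp add: trunc_slice S2_def)
    show 1: "trunc K (f x) = S1 x + S2 x + S3 x + (-K)"
      using N slice_add[of "K-N" "2*N" "-K" "f x"] slice_add[of "N+K" "K-N" "-K" "f x"]
      by (simp add: trunc_slice S1_def S2_def S3_def)
    then show "trunc K (f x) - trunc N (f x) = S1 x + S3 x + (N - K)" using N by (simp add: trunc_slice[of N] S2_def)
  qed
  show ?thesis unfolding eq(3) unfolding eq(1,2) using o by (simp only: form_shift dom_add F) (simp add: F dom_add form_add form_add_right)
qed

lemma energy_dist_tendstoD:
  assumes u: "\<And>n. u n \<in> \<F>" "f \<in> \<F>" and lim: "(\<lambda>n::nat. energy_dist M \<E> (u n) f) \<longlonglongrightarrow> 0"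
  shows "(\<lambda>n. \<E> (\<lambda>x. u n x - f x) (\<lambda>x. u n x - f x)) \<longlonglongrightarrow> 0"
    "(\<lambda>n. \<integral>x. (u n x - f x)\<^sup>2 \<partial>M) \<longlonglongrightarrow> 0"
    "\<And>v. v \<in> \<F> \<Longrightarrow> (\<lambda>n. \<E> (u n) v) \<longlonglongrightarrow> \<E> f v"
    "\<And>v. v \<in> \<F> \<Longrightarrow> (\<lambda>n. \<integral>x. u n x * v x \<partial>M) \<longlonglongrightarrow> (\<integral>x. f x * v x \<partial>M)"
proof -
  have "(\<lambda>n. (energy_dist M \<E> (u n) f)\<^sup>2) \<longlonglongrightarrow> 0\<^sup>2" by (rule tendsto_power[OF lim])
  moreover have "(energy_dist M \<E> (u n) f)\<^sup>2 = \<E> (\<lambda>x. u n x - f x) (\<lambda>x. u n x - f x) + (\<integral>x. (u n x - f x)\<^sup>2 \<partial>M)" for n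
    unfolding energy_dist_sq[OF u] using form_nonneg[OF dom_diff[OF u], of n] by simp
  ultimately have l: "(\<lambda>n. \<E> (\<lambda>x. u n x - f x) (\<lambda>x. u n x - f x) + (\<integral>x. (u n x - f x)\<^sup>2 \<partial>M)) \<longlonglongrightarrow> 0" by simp
  show 1: "(\<lambda>n. \<E> (\<lambda>x. u n x - f x) (\<lambda>x. u n x - f x)) \<longlonglongrightarrow> 0"
    by (rule tendsto_sandwich[OF _ _ tendsto_const l]) (auto intro!: always_eventually form_nonneg dom_diff u)
  show 2: "(\<lambda>n. \<integral>x. (u n x - f x)\<^sup>2 \<partial>M) \<longlonglongrightarrow> 0"
    by (rule tendsto_sandwich[OF _ _ tendsto_const l]) (auto intro!: always_eventually form_nonneg dom_diff u)
  fix v assume v: "v \<in> \<F>"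
  have "(\<lambda>n. \<E> (\<lambda>x. u n x - f x) v) \<longlonglongrightarrow> 0"
  proof (rule Lim_null_comparison)
    show "\<forall>\<^sub>F n in sequentially. norm (\<E> (\<lambda>x. u n x - f x) v) \<le> sqrt (\<E> (\<lambda>x. u n x - f x) (\<lambda>x. u n x - f x)) * sqrt (\<E> v v)"
      using form_abs_le[OF dom_diff[OF u] v] by (intro always_eventually) auto
    show "(\<lambda>n. sqrt (\<E> (\<lambda>x. u n x - f x) (\<lambda>x. u n x - f x)) * sqrt (\<E> v v)) \<longlonglongrightarrow> 0"
      using tendsto_mult[OF tendsto_real_sqrt[OF 1] tendsto_const, of "sqrt (\<E> v v)"] by simp
  qed
  then show "(\<lambda>n. \<E> (u n) v) \<longlonglongrightarrow> \<E> f v"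
    using u v by (simp add: form_diff LIM_zero_iff)
  have "(\<lambda>n. (\<integral>x. (u n x - f x) * v x \<partial>M)) \<longlonglongrightarrow> 0"
  proof (rule Lim_null_comparison)
    show "\<forall>\<^sub>F n in sequentially. norm (\<integral>x. (u n x - f x) * v x \<partial>M) \<le> sqrt (\<integral>x. (u n x - f x)\<^sup>2 \<partial>M) * sqrt (\<integral>x. (v x)\<^sup>2 \<partial>M)"
    proof (rule always_eventually, rule allI)
      fix n
      have "(\<integral>x. (u n x - f x) * v x \<partial>M)\<^sup>2 \<le> (\<integral>x. (u n x - f x)\<^sup>2 \<partial>M) * (\<integral>x. (v x)\<^sup>2 \<partial>M)"
        using dom_diff[OF u, of n] v dom_meas dom_sq_int by (intro integral_mult_sq_cs) blast+
      from real_sqrt_le_mono[OF this] show "norm (\<integral>x. (u n x - f x) * v x \<partial>M)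
          \<le> sqrt (\<integral>x. (u n x - f x)\<^sup>2 \<partial>M) * sqrt (\<integral>x. (v x)\<^sup>2 \<partial>M)"
        by (simp add: real_sqrt_mult)
    qed
    show "(\<lambda>n. sqrt (\<integral>x. (u n x - f x)\<^sup>2 \<partial>M) * sqrt (\<integral>x. (v x)\<^sup>2 \<partial>M)) \<longlonglongrightarrow> 0"
      using tendsto_mult[OF tendsto_real_sqrt[OF 2] tendsto_const, of "sqrt (\<integral>x. (v x)\<^sup>2 \<partial>M)"] by simp
  qed
  moreover have "(\<integral>x. (u n x - f x) * v x \<partial>M) = (\<integral>x. u n x * v x \<partial>M) - (\<integral>x. f x * v x \<partial>M)" for n
    using dom_mult_int[OF u(1) v, of n] dom_mult_int[OF u(2) v] by (simp add: left_diff_distrib)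
  ultimately show "(\<lambda>n. \<integral>x. u n x * v x \<partial>M) \<longlonglongrightarrow> (\<integral>x. f x * v x \<partial>M)"
    by (simp add: LIM_zero_iff)
qed

section \<open>Truncations and resolvents as limits in energy\<close>

lemma form_diff_swap: "f \<in> \<F> \<Longrightarrow> g \<in> \<F> \<Longrightarrow>
   \<E> (\<lambda>x. f x - g x) (\<lambda>x. f x - g x) = \<E> (\<lambda>x. g x - f x) (\<lambda>x. g x - f x)"
  by (simp add: form_diff form_diff_right dom_diff)

text \<open>The energies increase to a finite limit, and the distance between two members is bounded
  by the gap between their energies. Serves the truncations and the resolvents alike.\<close>

lemma form_cauchy_of_mono:
  assumes u: "\<And>n::nat. u n \<in> \<F>"
    and mono: "\<And>m n. m < n \<Longrightarrow> \<E> (\<lambda>x. u n x - u m x) (\<lambda>x. u n x - u m x) \<le> \<E> (u n) (u n) - \<E> (u m) (u m)"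
    and bd: "\<And>n. \<E> (u n) (u n) \<le> B" and e: "0 < e"
  shows "\<exists>N. \<forall>m\<ge>N. \<forall>n\<ge>N. \<E> (\<lambda>x. u m x - u n x) (\<lambda>x. u m x - u n x) < e"
proof -
  have inc: "incseq (\<lambda>n. \<E> (u n) (u n))"
  proof (rule incseq_SucI)
    fix n
    show "\<E> (u n) (u n) \<le> \<E> (u (Suc n)) (u (Suc n))"
      using mono[of n "Suc n"] form_nonneg[OF dom_diff[OF u u], of "Suc n" n] by simp
  qed
  obtain L where L: "(\<lambda>n. \<E> (u n) (u n)) \<longlonglongrightarrow> L" "\<And>i. \<E> (u i) (u i) \<le> L"
    using incseq_convergent[OF inc] bd by metis
  have "\<forall>\<^sub>F n in sequentially. L - e < \<E> (u n) (u n)" using e by (intro order_tendstoD(1)[OF L(1)]) simp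
  then obtain N where N: "\<And>n. n \<ge> N \<Longrightarrow> L - e < \<E> (u n) (u n)" by (auto simp: eventually_sequentially)
  have *: "\<E> (\<lambda>x. u n x - u m x) (\<lambda>x. u n x - u m x) < e" if "N \<le> m" "m < n" for m n
    using mono[OF that(2)] N[OF that(1)] L(2)[of n] by linarith
  show ?thesis
  proof (intro exI[of _ N] allI impI)
    fix m n assume mn: "N \<le> m" "N \<le> n"
    consider "m < n" | "n < m" | "m = n" by linarith
    then show "\<E> (\<lambda>x. u m x - u n x) (\<lambda>x. u m x - u n x) < e"
    proof cases
      case 1 then show ?thesis using *[OF mn(1) 1] form_diff_swap[OF u u, of m n] by simp
    next
      case 2 then show ?thesis using *[OF mn(2) 2] by simp
    next
      case 3 then show ?thesis using e form_zero[OF dom_const[of 0]] by simp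
    qed
  qed
qed

lemma trunc_conv:
  assumes f: "f \<in> \<F>"
  shows "(\<lambda>n. energy_dist M \<E> (\<lambda>x. trunc (real (Suc n)) (f x)) f) \<longlonglongrightarrow> 0"
proof (rule form_closed(2))
  have [measurable]: "f \<in> borel_measurable M" and fi: "integrable M (\<lambda>x. (f x)\<^sup>2)"
    using f dom_meas dom_sq_int by auto
  show "(\<lambda>x. trunc (real (Suc n)) (f x)) \<in> \<F>" for n using f by (intro trunc_dom) auto
  show "f \<in> L2_space M" using f dom_L2 by auto
  have "(\<lambda>n. \<integral>x. (trunc (real (Suc n)) (f x) - f x)\<^sup>2 \<partial>M) \<longlonglongrightarrow> (\<integral>x. 0 \<partial>M)"
  proof (rule integral_dominated_convergence[OF _ _ fi])
    show "AE x in M. (\<lambda>n. (trunc (real (Suc n)) (f x) - f x)\<^sup>2) \<longlonglongrightarrow> 0"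
    proof (rule AE_I2)
      fix x
      obtain n0 where n0: "\<bar>f x\<bar> \<le> real n0" using real_arch_simple by blast
      have "\<forall>\<^sub>F n in sequentially. (trunc (real (Suc n)) (f x) - f x)\<^sup>2 = 0"
        using eventually_ge_at_top[of n0]
      proof eventually_elim
        fix n assume "n0 \<le> n"
        then have "\<bar>f x\<bar> \<le> real (Suc n)" using n0 by simp
        then show "(trunc (real (Suc n)) (f x) - f x)\<^sup>2 = 0" by (simp add: trunc_id)
      qed
      then show "(\<lambda>n. (trunc (real (Suc n)) (f x) - f x)\<^sup>2) \<longlonglongrightarrow> 0" by (rule tendsto_eventually)
    qed
    fix n
    show "AE x in M. norm ((trunc (real (Suc n)) (f x) - f x)\<^sup>2) \<le> (f x)\<^sup>2"
      using trunc_bound(2)[of "real (Suc n)"] by (intro AE_I2) (simp add: abs_le_square_iff)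
  qed simp_all
  then show "(\<lambda>n. \<integral>x. (trunc (real (Suc n)) (f x) - f x)\<^sup>2 \<partial>M) \<longlonglongrightarrow> 0" by simp
next
  fix e :: real assume "0 < e"
  then show "\<exists>N. \<forall>m\<ge>N. \<forall>n\<ge>N. \<E> (\<lambda>x. trunc (real (Suc m)) (f x) - trunc (real (Suc n)) (f x))
     (\<lambda>x. trunc (real (Suc m)) (f x) - trunc (real (Suc n)) (f x)) < e"
    using f by (intro form_cauchy_of_mono[where B="\<E> f f"] trunc_dom trunc_form_le) (auto simp: trunc_form_diff)
qed

text \<open>The identity is the Euler equation for minimising \<open>J u\<close>, the energy of
  \<open>u\<close> plus \<alpha> times the squared L^2 distance to \<open>f\<close>. The minimiser
  is the resolvent image \<alpha> (\<alpha> - L)^(-1) f, where L is the generator of the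
  form.\<close>

lemma resolvent_exists:
  assumes f: "f \<in> \<F>" and \<alpha>: "0 < \<alpha>"
  shows "\<exists>g\<in>\<F>. \<forall>v\<in>\<F>. \<E> g v = \<alpha> * (\<integral>x. (f x - g x) * v x \<partial>M)"
proof -
  define B where "B u v = \<E> u v + \<alpha> * (\<integral>x. u x * v x \<partial>M)" for u v
  define J where "J u = \<E> u u + \<alpha> * (\<integral>x. (u x - f x)\<^sup>2 \<partial>M)" for u
  define m where "m = (INF u\<in>\<F>. J u)"
  have Bnn: "0 \<le> B u u" if "u \<in> \<F>" for u
    unfolding B_def using form_nonneg[OF that] \<alpha> by (simp flip: power2_eq_square)
  have J0: "0 \<le> J u" if "u \<in> \<F>" for u unfolding J_def using form_nonneg[OF that] \<alpha> by simp
  have mle: "m \<le> J u" if "u \<in> \<F>" for u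
    unfolding m_def using J0 that by (intro cINF_lower bdd_belowI2[where m=0])
  have "\<exists>u\<in>\<F>. J u < m + 1 / real (Suc k)" for k
    using cInf_lessD[of "J ` \<F>" "m + 1 / real (Suc k)"] f unfolding m_def by auto
  then obtain g where g: "\<And>k. g k \<in> \<F>" "\<And>k. J (g k) < m + 1 / real (Suc k)" by metis
  have expand: "J (\<lambda>x. u x + t * v x) = J u + 2 * t * (\<E> u v + \<alpha> * (\<integral>x. (u x - f x) * v x \<partial>M)) + t\<^sup>2 * B v v"
    if u: "u \<in> \<F>" and v: "v \<in> \<F>" for u v t
  proof -
    have i: "integrable M (\<lambda>x. (u x - f x)\<^sup>2)" "integrable M (\<lambda>x. (u x - f x) * v x)" "integrable M (\<lambda>x. v x * v x)"
      using dom_sq_int[OF dom_diff[OF u f]] dom_mult_int[OF dom_diff[OF u f] v] dom_mult_int[OF v v] by auto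
    have "(\<integral>x. (u x + t * v x - f x)\<^sup>2 \<partial>M) = (\<integral>x. (u x - f x)\<^sup>2 + 2 * t * ((u x - f x) * v x) + t\<^sup>2 * (v x * v x) \<partial>M)"
      by (rule Bochner_Integration.integral_cong) (auto simp: power2_eq_square algebra_simps)
    also have "\<dots> = (\<integral>x. (u x - f x)\<^sup>2 \<partial>M) + 2 * t * (\<integral>x. (u x - f x) * v x \<partial>M) + t\<^sup>2 * (\<integral>x. v x * v x \<partial>M)"
      using i by simp
    finally show ?thesis unfolding J_def B_def form_expand[OF u v] by (simp add: algebra_simps)
  qed
  \<comment> \<open>Both functions are compared with their midpoint, \<open>g l\<close> plus half of
    \<open>v\<close>. By the parallelogram law, near minimisers of \<open>J\<close> are close to
    each other in \<open>B\<close>.\<close>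
  have par: "B (\<lambda>x. g k x - g l x) (\<lambda>x. g k x - g l x) \<le> 2 / real (Suc k) + 2 / real (Suc l)" for k l
  proof -
    define v where "v = (\<lambda>x. g k x - g l x)"
    have v: "v \<in> \<F>" unfolding v_def by (intro dom_diff g)
    define b where "b = \<E> (g l) v + \<alpha> * (\<integral>x. (g l x - f x) * v x \<partial>M)"
    have e1: "J (g k) = J (g l) + 2 * b + B v v"
      using expand[OF g(1) v, of l 1] by (simp add: v_def[symmetric] b_def) (simp add: v_def)
    have e2: "m \<le> J (g l) + b + (1/4) * B v v"
      using expand[OF g(1) v, of l "1/2"] mle[OF dom_add[OF g(1) dom_scale[OF v]], of l "1/2"]
      by (simp add: b_def power2_eq_square)
    have "2 / real (Suc k) = 2 * (1 / real (Suc k))" "2 / real (Suc l) = 2 * (1 / real (Suc l))" by simp_all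
    then show ?thesis using e1 e2 g(2)[of k] g(2)[of l] unfolding v_def[symmetric] by linarith
  qed
  have ed: "energy_dist M \<E> (g k) (g l) \<le> sqrt ((1 + 1/\<alpha>) * (2 / real (Suc k) + 2 / real (Suc l)))" for k l
  proof -
    define v where "v = (\<lambda>x. g k x - g l x)"
    have v: "v \<in> \<F>" unfolding v_def by (intro dom_diff g)
    have "0 \<le> \<E> v v / \<alpha>" "0 \<le> \<alpha> * (\<integral>x. v x * v x \<partial>M)" using \<alpha> form_nonneg[OF v] by auto
    then have "\<E> v v + (\<integral>x. v x * v x \<partial>M) \<le> (1 + 1/\<alpha>) * B v v"
      unfolding B_def using \<alpha> by (simp add: field_simps)
    also have "\<dots> \<le> (1 + 1/\<alpha>) * (2 / real (Suc k) + 2 / real (Suc l))"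
      using par[of k l] \<alpha> unfolding v_def by (intro mult_left_mono) auto
    finally show ?thesis unfolding energy_dist_def energy_inner_def v_def by (rule real_sqrt_le_mono)
  qed
  have "\<exists>h\<in>\<F>. (\<lambda>n. energy_dist M \<E> (g n) h) \<longlonglongrightarrow> 0"
  proof (rule complete[OF g(1)])
    fix e :: real assume e: "0 < e"
    have "(\<lambda>n. sqrt ((1 + 1/\<alpha>) * (4 * (1 / real (Suc n))))) \<longlonglongrightarrow> sqrt ((1 + 1/\<alpha>) * (4 * 0))"
      using LIMSEQ_inverse_real_of_nat by (intro tendsto_intros) (simp add: inverse_eq_divide)
    then have "\<forall>\<^sub>F n in sequentially. sqrt ((1 + 1/\<alpha>) * (4 * (1 / real (Suc n)))) < e"
      using e by (intro order_tendstoD(2)) auto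
    then obtain N where N: "\<And>n. n \<ge> N \<Longrightarrow> sqrt ((1 + 1/\<alpha>) * (4 * (1 / real (Suc n)))) < e"
      by (auto simp: eventually_sequentially)
    show "\<exists>N. \<forall>m\<ge>N. \<forall>n\<ge>N. energy_dist M \<E> (g m) (g n) < e"
    proof (intro exI[of _ N] allI impI)
      fix m n assume mn: "N \<le> m" "N \<le> n"
      have "2 / real (Suc m) + 2 / real (Suc n) \<le> 4 * (1 / real (Suc N))"
      proof -
        have "2 / real (Suc m) \<le> 2 / real (Suc N)" "2 / real (Suc n) \<le> 2 / real (Suc N)"
          using mn by (auto intro!: divide_left_mono)
        then show ?thesis by simp
      qed
      then have "sqrt ((1 + 1/\<alpha>) * (2 / real (Suc m) + 2 / real (Suc n))) \<le> sqrt ((1 + 1/\<alpha>) * (4 * (1 / real (Suc N))))"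
        using \<alpha> by (intro real_sqrt_le_mono mult_left_mono) auto
      then show "energy_dist M \<E> (g m) (g n) < e" using ed[of m n] N[of N] by linarith
    qed
  qed
  then obtain h where h: "h \<in> \<F>" "(\<lambda>n. energy_dist M \<E> (g n) h) \<longlonglongrightarrow> 0" by blast
  show ?thesis
  proof (intro bexI[of _ h] ballI h(1))
    fix v assume v: "v \<in> \<F>"
    define b where "b k = \<E> (g k) v + \<alpha> * (\<integral>x. (g k x - f x) * v x \<partial>M)" for k
    \<comment> \<open>\<open>b k\<close> is half the derivative of \<open>J\<close> at
      \<open>g k\<close> in direction \<open>v\<close>. As \<open>g k\<close> is nearly minimal, the
      quadratic in \<open>t\<close> stays nonnegative after adding \<open>1 / (k + 1)\<close>, and
      its discriminant bounds \<open>b k\<close>.\<close>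
    have b2: "(b k)\<^sup>2 \<le> 1 / real (Suc k) * B v v" for k
    proof (rule discriminant_bound)
      fix t
      have "m \<le> J (\<lambda>x. g k x + t * v x)" by (intro mle dom_add dom_scale g v)
      then show "0 \<le> 1 / real (Suc k) + 2 * t * b k + t\<^sup>2 * B v v"
        using expand[OF g(1) v, of k t] g(2)[of k] unfolding b_def by linarith
    qed (rule Bnn[OF v])
    have bi: "b k = \<E> (g k) v + \<alpha> * ((\<integral>x. g k x * v x \<partial>M) - (\<integral>x. f x * v x \<partial>M))" for k
      unfolding b_def using dom_mult_int[OF g(1) v, of k] dom_mult_int[OF f v] by (simp add: left_diff_distrib)
    have "b \<longlonglongrightarrow> \<E> h v + \<alpha> * ((\<integral>x. h x * v x \<partial>M) - (\<integral>x. f x * v x \<partial>M))"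
      unfolding bi using energy_dist_tendstoD(3,4)[OF g(1) h v] by (intro tendsto_intros)
    moreover have "b \<longlonglongrightarrow> 0"
    proof -
      have "(\<lambda>k. 1 / real (Suc k) * B v v) \<longlonglongrightarrow> 0 * B v v"
        using LIMSEQ_inverse_real_of_nat by (intro tendsto_intros) (simp add: inverse_eq_divide)
      then have L: "(\<lambda>k. 1 / real (Suc k) * B v v) \<longlonglongrightarrow> 0" by simp
      have "(\<lambda>k. (b k)\<^sup>2) \<longlonglongrightarrow> 0"
        by (rule tendsto_sandwich[OF _ _ tendsto_const L]) (intro always_eventually allI b2 zero_le_power2)+
      from tendsto_real_sqrt[OF this] show ?thesis by (simp add: tendsto_rabs_zero_iff)
    qed
    ultimately have "\<E> h v + \<alpha> * ((\<integral>x. h x * v x \<partial>M) - (\<integral>x. f x * v x \<partial>M)) = 0"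
      using LIMSEQ_unique by blast
    then show "\<E> h v = \<alpha> * (\<integral>x. (f x - h x) * v x \<partial>M)"
      using dom_mult_int[OF h(1) v] dom_mult_int[OF f v] by (simp add: left_diff_distrib algebra_simps)
  qed
qed

text \<open>The resolvents with parameter \<open>n + 1\<close> converge to \<open>f\<close> in
  energy. Their equation tested with \<open>g n - f\<close> bounds the energies and yields
  convergence in L^2; comparing two of them shows that the energies increase. \<open>V\<close> is
  minus the generator applied to \<open>g\<close>.\<close>

lemma generator_dense:
  assumes f: "f \<in> \<F>" and e: "0 < e"
  obtains g V where "g \<in> \<F>" "V \<in> borel_measurable M" "integrable M (\<lambda>x. (V x)\<^sup>2)"
    "energy_dist M \<E> g f < e" "\<And>v. v \<in> \<F> \<Longrightarrow> \<E> g v = (\<integral>x. V x * v x \<partial>M)"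
proof -
  have "\<forall>n. \<exists>g\<in>\<F>. \<forall>v\<in>\<F>. \<E> g v = real (Suc n) * (\<integral>x. (f x - g x) * v x \<partial>M)"
    by (intro allI resolvent_exists f) simp
  then obtain g where gF: "\<And>n. g n \<in> \<F>"
    and g: "\<And>n v. v \<in> \<F> \<Longrightarrow> \<E> (g n) v = real (Suc n) * (\<integral>x. (f x - g n x) * v x \<partial>M)" by metis
  have bd: "\<E> (g n) (g n) + 2 * real (Suc n) * (\<integral>x. (g n x - f x)\<^sup>2 \<partial>M) \<le> \<E> f f" for n
  proof -
    have "\<E> (g n) (\<lambda>x. g n x - f x) = real (Suc n) * (\<integral>x. (f x - g n x) * (g n x - f x) \<partial>M)"
      by (intro g dom_diff gF f)
    also have "(\<integral>x. (f x - g n x) * (g n x - f x) \<partial>M) = (\<integral>x. - (g n x - f x)\<^sup>2 \<partial>M)"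
      by (rule Bochner_Integration.integral_cong) (auto simp: power2_eq_square algebra_simps)
    finally have "\<E> (g n) (g n) - \<E> (g n) f = - real (Suc n) * (\<integral>x. (g n x - f x)\<^sup>2 \<partial>M)"
      using gF f by (simp add: form_diff_right) (simp add: algebra_simps)
    moreover have "0 \<le> \<E> (\<lambda>x. g n x - f x) (\<lambda>x. g n x - f x)" by (intro form_nonneg dom_diff gF f)
    then have "0 \<le> \<E> (g n) (g n) - 2 * \<E> (g n) f + \<E> f f"
      using gF f form_sym[OF f gF] by (simp add: form_diff form_diff_right dom_diff)
    ultimately show ?thesis by (simp add: algebra_simps)
  qed
  have bd1: "\<E> (g n) (g n) \<le> \<E> f f" for n
  proof -
    have "0 \<le> 2 * real (Suc n) * (\<integral>x. (g n x - f x)\<^sup>2 \<partial>M)" by (intro mult_nonneg_nonneg) auto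
    then show ?thesis using bd[of n] by linarith
  qed
  have l2: "(\<lambda>n. \<integral>x. (g n x - f x)\<^sup>2 \<partial>M) \<longlonglongrightarrow> 0"
  proof -
    have "(\<lambda>n. \<E> f f / 2 * (1 / real (Suc n))) \<longlonglongrightarrow> \<E> f f / 2 * 0"
      using LIMSEQ_inverse_real_of_nat by (intro tendsto_intros) (simp add: inverse_eq_divide)
    then have L: "(\<lambda>n. \<E> f f / 2 * (1 / real (Suc n))) \<longlonglongrightarrow> 0" by simp
    have le: "(\<integral>x. (g n x - f x)\<^sup>2 \<partial>M) \<le> \<E> f f / 2 * (1 / real (Suc n))" for n
    proof -
      have "2 * real (Suc n) * (\<integral>x. (g n x - f x)\<^sup>2 \<partial>M) \<le> \<E> f f" using bd[of n] form_nonneg[OF gF, of n] by linarith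
      then show ?thesis by (simp add: field_simps)
    qed
    show ?thesis
      by (rule tendsto_sandwich[OF _ _ tendsto_const L]) (intro always_eventually allI le Bochner_Integration.integral_nonneg zero_le_power2)+
  qed
  have mono: "\<E> (\<lambda>x. g n x - g k x) (\<lambda>x. g n x - g k x) \<le> \<E> (g n) (g n) - \<E> (g k) (g k)" if "k < n" for k n
  proof -
    define v where "v = (\<lambda>x. g n x - g k x)"
    have v: "v \<in> \<F>" unfolding v_def by (intro dom_diff gF)
    define I where "I = (\<integral>x. (f x - g n x) * v x \<partial>M)"
    define Q where "Q = (\<integral>x. v x * v x \<partial>M)"
    have Q: "0 \<le> Q" unfolding Q_def by simp
    have "(\<integral>x. (f x - g k x) * v x \<partial>M) = (\<integral>x. (f x - g n x) * v x + v x * v x \<partial>M)"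
      by (rule Bochner_Integration.integral_cong) (auto simp: v_def algebra_simps)
    also have "\<dots> = I + Q"
      unfolding I_def Q_def by (intro Bochner_Integration.integral_add dom_mult_int dom_diff f gF v)
    finally have Ek: "\<E> (g k) v = real (Suc k) * (I + Q)" using g[OF v] by simp
    have En: "\<E> (g n) v = real (Suc n) * I" using g[OF v] by (simp add: I_def)
    \<comment> \<open>Subtracting the two resolvent equations tested with \<open>v\<close> forces
      \<open>I\<close> to be nonnegative, hence \<open>\<E> (g k) v\<close> as well. So passing from
      \<open>g k\<close> to \<open>g n\<close> raises the energy by at least that of the
      difference.\<close>
    have "\<E> v v = \<E> (g n) v - \<E> (g k) v" using form_diff[OF gF gF v, of n k] by (simp add: v_def)
    then have "0 \<le> real (Suc n) * I - real (Suc k) * (I + Q)" using form_nonneg[OF v] En Ek by simp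
    then have "real (Suc k) * Q \<le> (real n - real k) * I" by (simp add: algebra_simps)
    moreover have "0 \<le> real (Suc k) * Q" using Q by simp
    ultimately have "0 \<le> (real n - real k) * I" by linarith
    then have "0 \<le> I" using that by (simp add: zero_le_mult_iff)
    then have "0 \<le> \<E> (g k) v" unfolding Ek using Q by simp
    moreover have "\<E> (g n) (g n) = \<E> (g k) (g k) + 2 * \<E> (g k) v + \<E> v v"
      using form_expand[OF gF v, of k 1] by (simp add: v_def)
    ultimately show ?thesis unfolding v_def by linarith
  qed
  have "(\<lambda>n. energy_dist M \<E> (g n) f) \<longlonglongrightarrow> 0"
    by (rule form_closed(2)[OF gF _ l2 form_cauchy_of_mono[OF gF mono bd1]]) (use f dom_L2 in auto)
  then have "\<forall>\<^sub>F n in sequentially. energy_dist M \<E> (g n) f < e" using e by (rule order_tendstoD(2))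
  then obtain n where n: "energy_dist M \<E> (g n) f < e" by (auto simp: eventually_sequentially)
  define V where "V = (\<lambda>x. real (Suc n) * (f x - g n x))"
  have V: "V \<in> \<F>" unfolding V_def by (intro dom_scale dom_diff f gF)
  show ?thesis
  proof (rule that[OF gF dom_meas[OF V] dom_sq_int[OF V] n])
    fix v assume "v \<in> \<F>"
    then show "\<E> (g n) v = (\<integral>x. V x * v x \<partial>M)" using g[of v n] by (simp add: V_def mult.assoc)
  qed
qed

end

section \<open>The carre du champ of unbounded functions\<close>

context carre_structure
begin

text \<open>The defining formula covers bounded functions, but the approximants from the domain of
  the generator are unbounded. Truncation converges in energy, and both sides are continuous for
  it.\<close>

lemma carre_integral:
  assumes f: "f \<in> \<F>" and v: "v \<in> \<F>b"
  shows "(\<integral>x. \<gamma> f v x \<partial>M) = \<E> f v"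
proof -
  define u where "u n = (\<lambda>x. trunc (real (Suc n)) (f x))" for n
  have u: "u n \<in> \<F>b" for n unfolding u_def by (rule trunc_Fb[OF f]) simp
  have uF: "u n \<in> \<F>" and vF: "v \<in> \<F>" for n using u v by auto
  have lim: "(\<lambda>n. energy_dist M \<E> (u n) f) \<longlonglongrightarrow> 0" unfolding u_def by (rule trunc_conv[OF f])
  have "(\<lambda>n. \<E> (u n) v) \<longlonglongrightarrow> \<E> f v" by (rule energy_dist_tendstoD(3)[OF uF f lim vF])
  moreover have "(\<lambda>n. (\<integral>x. \<gamma> (u n) v x \<partial>M)) \<longlonglongrightarrow> (\<integral>x. \<gamma> f v x \<partial>M)"
  proof (rule Lim_transform2[OF tendsto_const], rule Lim_null_comparison[OF _ carre_tendsto[OF uF f vF lim]], rule always_eventually, rule allI)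
    fix n
    have "norm ((\<integral>x. \<gamma> f v x \<partial>M) - (\<integral>x. \<gamma> (u n) v x \<partial>M)) = \<bar>\<integral>x. \<gamma> (u n) v x - \<gamma> f v x \<partial>M\<bar>"
      using carre_int[OF uF vF, of n] carre_int[OF f vF] by (simp add: abs_minus_commute)
    also have "\<dots> \<le> (\<integral>x. \<bar>\<gamma> (u n) v x - \<gamma> f v x\<bar> \<partial>M)" by (rule integral_abs_bound)
    finally show "norm ((\<integral>x. \<gamma> f v x \<partial>M) - (\<integral>x. \<gamma> (u n) v x \<partial>M)) \<le> (\<integral>x. \<bar>\<gamma> (u n) v x - \<gamma> f v x\<bar> \<partial>M)" .
  qed
  ultimately show ?thesis using carre_integral_Fb[OF u v] LIMSEQ_unique by simp
qed

text \<open>Locality for an unbounded \<open>f\<close>. The weight \<open>v\<close> is positive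
  exactly where \<open>f\<close> lies strictly between \<open>-N\<close> and \<open>N\<close>; there
  all higher truncations agree with \<open>trunc N\<close>, so \<open>carre_local\<close> equates
  their densities, and the higher truncations converge to \<open>f\<close> in energy.\<close>

lemma carre_trunc_left:
  assumes f: "f \<in> \<F>" and g: "g \<in> \<F>" and N: "0 < N"
  shows "AE x in M. \<bar>f x\<bar> < N \<longrightarrow> \<gamma> f g x = \<gamma> (\<lambda>x. trunc N (f x)) g x"
proof -
  define v where "v = (\<lambda>x. slice (-N) (2*N) (f x) * slice (-N) (2*N) (-1 * f x))"
  have v: "v \<in> \<F>b" unfolding v_def using N by (intro Fb_mult Fb_slice dom_scale f) auto
  have v0: "0 \<le> v x" "\<bar>v x\<bar> \<le> 2*N * (2*N)" for x
  proof -
    show 1: "0 \<le> v x" unfolding v_def by (intro mult_nonneg_nonneg slice_nonneg)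
    have "v x \<le> 2*N * (2*N)" unfolding v_def
      using N by (intro mult_mono slice_le slice_nonneg) auto
    then show "\<bar>v x\<bar> \<le> 2*N * (2*N)" using 1 by simp
  qed
  define u where "u n = (\<lambda>x. trunc (real (Suc n)) (f x))" for n
  have u: "u n \<in> \<F>b" for n unfolding u_def by (rule trunc_Fb[OF f]) simp
  then have uF: "u n \<in> \<F>" for n by auto
  have lim: "(\<lambda>n. energy_dist M \<E> (u n) f) \<longlonglongrightarrow> 0" unfolding u_def by (rule trunc_conv[OF f])
  define t where "t = (\<lambda>x. trunc N (f x))"
  have t: "t \<in> \<F>b" unfolding t_def by (rule trunc_Fb[OF f N])
  then have tF: "t \<in> \<F>" by auto
  define r where "r = (\<lambda>x. v x * (\<gamma> f g x - \<gamma> t g x))"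
  have ri: "integrable M r" unfolding r_def
    by (intro Fb_mult_int[OF v] Bochner_Integration.integrable_diff carre_int f g tF)
  have le: "(\<integral>x. \<bar>r x\<bar> \<partial>M) \<le> 2*N*(2*N) * (\<integral>x. \<bar>\<gamma> (u n) g x - \<gamma> f g x\<bar> \<partial>M)" if n: "N \<le> real (Suc n)" for n
  proof -
    have "AE x in M. v x * \<gamma> (\<lambda>x. u n x - t x) g x = 0"
    proof (rule carre_local[OF Fb_diff[OF u t] v v0(1) _ g, where a=0])
      show "AE x in M. (u n x - t x + 0) * v x = 0"
        using n N unfolding u_def t_def v_def
        by (intro AE_I2) (auto simp: trunc_def slice_def max_def min_def)
    qed
    then have "AE x in M. \<bar>r x\<bar> \<le> 2*N*(2*N) * \<bar>\<gamma> (u n) g x - \<gamma> f g x\<bar>"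
      using carre_diff[OF uF tF g, of n]
    proof eventually_elim
      fix x assume 1: "v x * \<gamma> (\<lambda>x. u n x - t x) g x = 0" and 2: "\<gamma> (\<lambda>x. u n x - t x) g x = \<gamma> (u n) g x - \<gamma> t g x"
      have "r x = v x * (\<gamma> f g x - \<gamma> (u n) g x)" using 1 unfolding 2 r_def by (simp add: algebra_simps)
      then show "\<bar>r x\<bar> \<le> 2*N*(2*N) * \<bar>\<gamma> (u n) g x - \<gamma> f g x\<bar>"
        using v0(2)[of x] by (simp add: abs_mult abs_minus_commute mult_right_mono)
    qed
    then have "(\<integral>x. \<bar>r x\<bar> \<partial>M) \<le> (\<integral>x. 2*N*(2*N) * \<bar>\<gamma> (u n) g x - \<gamma> f g x\<bar> \<partial>M)"
      using ri carre_int[OF uF g] carre_int[OF f g] by (intro integral_mono_AE) auto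
    then show ?thesis by simp
  qed
  have "(\<lambda>n. 2*N*(2*N) * (\<integral>x. \<bar>\<gamma> (u n) g x - \<gamma> f g x\<bar> \<partial>M)) \<longlonglongrightarrow> 2*N*(2*N) * 0"
    by (intro tendsto_intros carre_tendsto uF f g lim)
  then have L: "(\<lambda>n. 2*N*(2*N) * (\<integral>x. \<bar>\<gamma> (u n) g x - \<gamma> f g x\<bar> \<partial>M)) \<longlonglongrightarrow> 0" by simp
  obtain n0 where n0: "N \<le> real n0" using real_arch_simple by blast
  have "(\<integral>x. \<bar>r x\<bar> \<partial>M) \<le> 0"
  proof (rule LIMSEQ_le_const[OF L], intro exI[of _ n0] allI impI le)
    fix n assume "n0 \<le> n"
    then show "N \<le> real (Suc n)" using n0 by simp
  qed
  from integral_abs_zero[OF ri this] show ?thesis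
  proof eventually_elim
    fix x assume rx: "r x = 0"
    show "\<bar>f x\<bar> < N \<longrightarrow> \<gamma> f g x = \<gamma> (\<lambda>x. trunc N (f x)) g x"
    proof
      assume "\<bar>f x\<bar> < N"
      then have "0 < v x" unfolding v_def slice_def by (intro mult_pos_pos) auto
      then show "\<gamma> f g x = \<gamma> (\<lambda>x. trunc N (f x)) g x" using rx by (simp add: r_def t_def)
    qed
  qed
qed

lemma carre_trunc:
  assumes f: "f \<in> \<F>" and g: "g \<in> \<F>" and N: "0 < N"
  shows "AE x in M. \<bar>f x\<bar> < N \<longrightarrow> \<bar>g x\<bar> < N \<longrightarrow> \<gamma> f g x = \<gamma> (\<lambda>x. trunc N (f x)) (\<lambda>x. trunc N (g x)) x"
  using carre_trunc_left[OF f g N] carre_trunc_left[OF g trunc_dom[OF f N] N]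
    carre_sym[OF g trunc_dom[OF f N]] carre_sym[OF trunc_dom[OF f N] trunc_dom[OF g N]]
  by eventually_elim simp

end

section \<open>A mollifier and its derivatives\<close>

text \<open>A paraboloid cut off at zero. Its fourth power has continuous third derivatives, which
  is the regularity used by the Lipschitz bound on second derivatives and by the two integrations by
  parts in \<open>bump2_integral_swap\<close>.\<close>

definition bump :: "real \<Rightarrow> real^'n \<Rightarrow> real" where
  "bump s z = max 0 (s\<^sup>2 - (norm z)\<^sup>2)"

text \<open>First and second partial derivatives of \<open>bump s ^ 4\<close>, and the derivative of the latter
  in direction \<open>v\<close>.\<close>

definition bump1 :: "'n \<Rightarrow> real \<Rightarrow> real^'n \<Rightarrow> real" where
  "bump1 i s z = - 8 * z $ i * bump s z ^ 3"

definition bump2 :: "'n \<Rightarrow> 'n \<Rightarrow> real \<Rightarrow> real^'n \<Rightarrow> real" where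
  "bump2 i j s z = 48 * z $ i * z $ j * bump s z ^ 2 - 8 * (if i = j then 1 else 0) * bump s z ^ 3"

definition bump3 :: "real^'n \<Rightarrow> 'n \<Rightarrow> 'n \<Rightarrow> real \<Rightarrow> real^'n \<Rightarrow> real" where
  "bump3 v i j s z = - 192 * z $ i * z $ j * (z \<bullet> v) * bump s z
     + 48 * (v $ i * z $ j + v $ j * z $ i + (if i = j then 1 else 0) * (z \<bullet> v)) * bump s z ^ 2"

text \<open>The dilates, with factor \<open>s ^ -n\<close> for dimension \<open>n\<close>, of the
  profile \<open>8 (1 - |z|^2)^3\<close> on the unit ball. Their mass is the same for all
  \<open>s\<close>, though not normalised to 1; the factor 8 is the one for which
  \<open>mollifier_deriv\<close> holds as stated.\<close>

definition mollifier :: "real \<Rightarrow> real^'n \<Rightarrow> real" where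
  "mollifier s z = 8 * bump s z ^ 3 / s ^ (CARD('n) + 6)"

section \<open>Size and derivatives of the kernels\<close>

lemma bump_nonneg: "0 \<le> bump s z" by (simp add: bump_def)

lemma bump_le: "bump s z \<le> s\<^sup>2" by (simp add: bump_def)

lemma bump_eq_0: "0 \<le> s \<Longrightarrow> s \<le> norm z \<Longrightarrow> bump s z = 0"
  by (simp add: bump_def power_mono)

lemma bump_kernels_eq_0:
  assumes "0 \<le> s" "s \<le> norm z"
  shows "bump1 i s z = 0" "bump2 i j s z = 0" "bump3 v i j s z = 0" "mollifier s z = 0"
  using bump_eq_0[OF assms] by (simp_all add: bump1_def bump2_def bump3_def mollifier_def)

lemma abs_component_le: "\<bar>z $ i\<bar> \<le> norm (z :: real^'n)"
  using component_le_norm_cart by blast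

lemma bump1_bound:
  assumes s: "0 < s" shows "\<bar>bump1 i s z\<bar> \<le> 8 * s ^ 7"
proof (cases "norm z < s")
  case True
  have "\<bar>bump1 i s z\<bar> = 8 * (\<bar>z $ i\<bar> * bump s z ^ 3)"
    by (simp add: bump1_def abs_mult bump_nonneg)
  also have "\<dots> \<le> 8 * (s * (s\<^sup>2) ^ 3)"
    using True s abs_component_le[of z i] bump_le[of s z] bump_nonneg[of s z]
    by (intro mult_left_mono mult_mono power_mono) auto
  also have "\<dots> = 8 * s ^ 7" by (simp add: power_mult[symmetric] power_Suc[symmetric] del: power_Suc)
  finally show ?thesis .
next
  case False then show ?thesis using bump_kernels_eq_0[of s z] s by simp
qed

lemma bump2_bound:
  assumes s: "0 < s" shows "\<bar>bump2 i j s z\<bar> \<le> 56 * s ^ 6"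
proof (cases "norm z < s")
  case True
  have "\<bar>bump2 i j s z\<bar> \<le> \<bar>48 * z $ i * z $ j * bump s z ^ 2\<bar> + \<bar>8 * (if i = j then 1 else 0) * bump s z ^ 3\<bar>"
    unfolding bump2_def by (rule abs_triangle_ineq4)
  also have "\<dots> \<le> 48 * (\<bar>z $ i\<bar> * \<bar>z $ j\<bar> * bump s z ^ 2) + 8 * bump s z ^ 3"
    by (auto simp: abs_mult bump_nonneg)
  also have "\<dots> \<le> 48 * (s * s * (s\<^sup>2) ^ 2) + 8 * (s\<^sup>2) ^ 3"
    using True s abs_component_le[of z i] abs_component_le[of z j] bump_le[of s z] bump_nonneg[of s z]
    by (intro add_mono mult_left_mono mult_mono power_mono) auto
  also have "\<dots> = 56 * s ^ 6" by (simp add: power_mult[symmetric] power2_eq_square eval_nat_numeral)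
  finally show ?thesis .
next
  case False then show ?thesis using bump_kernels_eq_0[of s z] s by simp
qed

lemma bump3_bound:
  assumes s: "0 < s" shows "\<bar>bump3 v i j s z\<bar> \<le> 336 * s ^ 5 * norm v"
proof (cases "norm z < s")
  case True
  have zv: "\<bar>z \<bullet> v\<bar> \<le> s * norm v"
    using Cauchy_Schwarz_ineq2[of z v] True mult_right_mono[of "norm z" s "norm v"] by auto
  have z: "\<bar>z $ i\<bar> \<le> s" "\<bar>z $ j\<bar> \<le> s" using abs_component_le[of z i] abs_component_le[of z j] True by auto
  have b: "0 \<le> bump s z" "bump s z \<le> s\<^sup>2" by (rule bump_nonneg bump_le)+
  define w where "w = v $ i * z $ j + v $ j * z $ i + (if i = j then 1 else 0) * (z \<bullet> v)"
  have "\<bar>bump3 v i j s z\<bar> \<le> \<bar>- 192 * z $ i * z $ j * (z \<bullet> v) * bump s z\<bar> + \<bar>48 * w * bump s z ^ 2\<bar>"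
    unfolding bump3_def w_def by (rule abs_triangle_ineq)
  also have "\<dots> = 192 * (\<bar>z $ i\<bar> * \<bar>z $ j\<bar> * \<bar>z \<bullet> v\<bar> * bump s z) + 48 * (\<bar>w\<bar> * bump s z ^ 2)"
    by (simp add: abs_mult bump_nonneg)
  also have "\<dots> \<le> 192 * (s * s * (s * norm v) * s\<^sup>2) + 48 * ((norm v * s + norm v * s + s * norm v) * (s\<^sup>2)^2)"
  proof (intro add_mono mult_left_mono mult_mono power_mono)
    have "\<bar>w\<bar> \<le> \<bar>v $ i * z $ j\<bar> + \<bar>v $ j * z $ i\<bar> + \<bar>z \<bullet> v\<bar>" by (auto simp: w_def)
    also have "\<dots> \<le> norm v * s + norm v * s + s * norm v"
      unfolding abs_mult using z zv abs_component_le[of v i] abs_component_le[of v j]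
      by (intro add_mono mult_mono) auto
    finally show "\<bar>w\<bar> \<le> norm v * s + norm v * s + s * norm v" .
  qed (use z zv b s in auto)
  also have "\<dots> = 336 * s ^ 5 * norm v" by (simp add: power2_eq_square eval_nat_numeral)
  finally show ?thesis .
next
  case False then show ?thesis using bump_kernels_eq_0[of s z] s by simp
qed

lemma mollifier_nonneg: "0 < s \<Longrightarrow> 0 \<le> mollifier s z"
  by (simp add: mollifier_def bump_nonneg)

lemma mollifier_bound:
  assumes s: "0 < s" shows "mollifier s (z :: real^'n) \<le> 8 / s ^ CARD('n)"
proof -
  have "8 * bump s z ^ 3 / s ^ (CARD('n) + 6) \<le> 8 * (s\<^sup>2) ^ 3 / s ^ (CARD('n) + 6)"
    using s bump_le[of s z] bump_nonneg[of s z] by (intro divide_right_mono mult_left_mono power_mono) auto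
  also have "\<dots> = 8 / s ^ CARD('n)" using s by (simp add: power_add power_mult[symmetric])
  finally show ?thesis by (simp add: mollifier_def)
qed

text \<open>At the kink the difference quotient is bounded by a positive power of the increment,
  which is where an exponent of at least 2 enters.\<close>

lemma DERIV_max_power:
  fixes x :: real
  shows "((\<lambda>t. max 0 t ^ (Suc (Suc k))) has_real_derivative real (k + 2) * max 0 x ^ Suc k) (at x)"
proof -
  consider "x > 0" | "x < 0" | "x = 0" by linarith
  then show ?thesis
  proof cases
    case 1
    have "((\<lambda>t::real. t ^ (Suc (Suc k))) has_real_derivative real (k + 2) * x ^ Suc k) (at x)"
      using DERIV_power[OF DERIV_ident, of "Suc (Suc k)" x] by (simp add: algebra_simps)
    then have "((\<lambda>t. max 0 t ^ (Suc (Suc k))) has_real_derivative real (k + 2) * x ^ Suc k) (at x)"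
      by (rule DERIV_cong_ev[THEN iffD1, OF refl _ refl, rotated])
         (use order_tendstoD(1)[OF tendsto_ident_at 1] eventually_nhds_in_open[of "{0<..}" x] 1 in
           \<open>auto elim!: eventually_mono\<close>)
    then show ?thesis using 1 by simp
  next
    case 2
    have "((\<lambda>t::real. 0) has_real_derivative 0) (at x)" by simp
    then have "((\<lambda>t. max 0 t ^ (Suc (Suc k))) has_real_derivative 0) (at x)"
      by (rule DERIV_cong_ev[THEN iffD1, OF refl _ refl, rotated])
         (use eventually_nhds_in_open[of "{..<0}" x] 2 in \<open>auto elim!: eventually_mono\<close>)
    then show ?thesis using 2 by simp
  next
    case 3
    have "((\<lambda>h. (max 0 h ^ (Suc (Suc k)) - 0) / h) \<longlongrightarrow> 0) (at (0::real))"
    proof (rule Lim_null_comparison)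
      show "\<forall>\<^sub>F h in at 0. norm ((max 0 h ^ (Suc (Suc k)) - 0) / h) \<le> \<bar>h\<bar> ^ Suc k"
        by (intro always_eventually) (auto simp: max_def abs_mult power_abs mult_nonpos_nonneg)
      have "((\<lambda>h::real. \<bar>h\<bar> ^ Suc k) \<longlongrightarrow> \<bar>0\<bar> ^ Suc k) (at 0)"
        by (intro tendsto_intros)
      then show "((\<lambda>h::real. \<bar>h\<bar> ^ Suc k) \<longlongrightarrow> 0) (at 0)" by simp
    qed
    then show ?thesis using 3 by (simp add: DERIV_def)
  qed
qed

lemma bump_line_deriv:
  "((\<lambda>t. bump s (z + t *\<^sub>R v) ^ (Suc (Suc k))) has_real_derivative
      real (k + 2) * bump s z ^ Suc k * (- 2 * (z \<bullet> v))) (at 0)"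
proof -
  have "((\<lambda>t. s\<^sup>2 - (z + t *\<^sub>R v) \<bullet> (z + t *\<^sub>R v)) has_real_derivative (- 2 * (z \<bullet> v))) (at 0)"
    by (simp add: inner_add_left inner_add_right inner_commute) (auto intro!: derivative_eq_intros)
  from DERIV_chain2[OF DERIV_max_power this, of k] show ?thesis
    by (simp add: bump_def power2_norm_eq_inner)
qed

lemma axis_one_nth: "axis j (1::real) $ i = (if i = j then 1 else 0)"
  by (simp add: axis_def)

lemma bump_line_deriv_2: "((\<lambda>t. bump s (z + t *\<^sub>R v) ^ 2) has_real_derivative 2 * bump s z * (- 2 * (z \<bullet> v))) (at 0)"
  and bump_line_deriv_3: "((\<lambda>t. bump s (z + t *\<^sub>R v) ^ 3) has_real_derivative 3 * bump s z ^ 2 * (- 2 * (z \<bullet> v))) (at 0)"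
  using bump_line_deriv[of s z v 0] bump_line_deriv[of s z v 1]
  by (simp_all add: numeral_2_eq_2 numeral_3_eq_3)

lemma bump1_line_deriv:
  "((\<lambda>t. bump1 i s (z + t *\<^sub>R axis j 1)) has_real_derivative bump2 i j s z) (at 0)"
proof -
  have l: "((\<lambda>t. - 8 * (z + t *\<^sub>R axis j 1) $ i) has_real_derivative - 8 * (if i = j then 1 else 0)) (at 0)"
    by (auto intro!: derivative_eq_intros simp: axis_one_nth)
  show ?thesis
    unfolding bump1_def bump2_def
    by (rule DERIV_cong[OF DERIV_mult[OF l bump_line_deriv_3]]) (simp add: inner_axis algebra_simps)
qed

lemma bump2_line_deriv:
  "((\<lambda>t. bump2 i j s (z + t *\<^sub>R v)) has_real_derivative bump3 v i j s z) (at 0)"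
proof -
  have l: "((\<lambda>t. 48 * (z + t *\<^sub>R v) $ i * (z + t *\<^sub>R v) $ j) has_real_derivative
      48 * (v $ i * z $ j + v $ j * z $ i)) (at 0)"
    by (auto intro!: derivative_eq_intros simp: algebra_simps)
  show ?thesis
    unfolding bump2_def bump3_def
    by (rule DERIV_cong[OF DERIV_diff[OF DERIV_mult[OF l bump_line_deriv_2] DERIV_cmult[OF bump_line_deriv_3]]])
       (simp add: algebra_simps power2_eq_square)
qed

text \<open>The right-hand side is the Laplacian of \<open>bump s z ^ 4 / s ^ (n + 7)\<close>,
  \<open>n\<close> the dimension, so integrating such Laplacians over \<open>s\<close> telescopes.
  The computation rests on \<open>|z|^2 b^2 = s^2 b^2 - b^3\<close> for \<open>b = bump s z\<close>,
  which holds off the support too.\<close>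

lemma mollifier_deriv:
  fixes z :: "real^'n"
  assumes s: "0 < s"
  shows "((\<lambda>s. mollifier s z) has_real_derivative (\<Sum>i\<in>UNIV. bump2 i i s z) / s ^ (CARD('n) + 7)) (at s)"
proof -
  let ?n = "CARD('n)"
  have d1: "((\<lambda>s. s\<^sup>2 - (norm z)\<^sup>2) has_real_derivative 2 * s) (at s)"
    by (auto intro!: derivative_eq_intros)
  have d2: "((\<lambda>s. bump s z ^ 3) has_real_derivative 3 * bump s z ^ 2 * (2 * s)) (at s)"
    using DERIV_chain2[OF DERIV_max_power d1, of 1] unfolding bump_def
    by (simp add: numeral_2_eq_2 numeral_3_eq_3)
  have nz: "s ^ (?n + 6) \<noteq> 0" using s by simp
  have d3: "((\<lambda>s. s ^ (?n + 6)) has_real_derivative real (?n + 6) * s ^ (?n + 5)) (at s)"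
    using DERIV_power[OF DERIV_ident, of "?n + 6" s] by (simp add: numeral_eq_Suc)
  have d: "((\<lambda>s. mollifier s z) has_real_derivative
     (8 * (3 * bump s z ^ 2 * (2 * s)) * s ^ (?n + 6) - 8 * bump s z ^ 3 * (real (?n + 6) * s ^ (?n + 5)))
       / (s ^ (?n + 6) * s ^ (?n + 6))) (at s)"
    unfolding mollifier_def by (intro DERIV_divide DERIV_cmult d2 d3 nz)
  define b where "b = bump s z"
  have zb: "(norm z)\<^sup>2 * b\<^sup>2 = s\<^sup>2 * b\<^sup>2 - b^3"
    unfolding b_def bump_def by (auto simp: max_def algebra_simps power2_eq_square power3_eq_cube)
  have "(\<Sum>i\<in>UNIV. bump2 i i s z) = 48 * ((norm z)\<^sup>2 * b\<^sup>2) - 8 * real ?n * b ^ 3"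
    unfolding bump2_def b_def[symmetric]
    by (simp add: sum_subtractf norm_vec_def L2_set_def sum_nonneg sum_distrib_left sum_distrib_right power2_eq_square algebra_simps)
  also have "\<dots> = 48 * s\<^sup>2 * b\<^sup>2 - 8 * real (?n + 6) * b^3" unfolding zb by (simp add: algebra_simps)
  finally have sum: "(\<Sum>i\<in>UNIV. bump2 i i s z) = 48 * s\<^sup>2 * b\<^sup>2 - 8 * real (?n + 6) * b^3" .
  have "(8 * (3 * b ^ 2 * (2 * s)) * s ^ (?n + 6) - 8 * b ^ 3 * (real (?n + 6) * s ^ (?n + 5)))
       / (s ^ (?n + 6) * s ^ (?n + 6)) = (48 * s\<^sup>2 * b\<^sup>2 - 8 * real (?n + 6) * b^3) / s ^ (?n + 7)"
    using s by (simp add: field_simps power_add power2_eq_square eval_nat_numeral)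
  then show ?thesis using d unfolding sum b_def by simp
qed

lemma bump2_lipschitz:
  assumes s: "0 < s"
  shows "\<bar>bump2 i j s z - bump2 i j s z'\<bar> \<le> 336 * s ^ 5 * norm (z - z')"
proof -
  define v where "v = z' - z"
  have D: "((\<lambda>t. bump2 i j s (z + t *\<^sub>R v)) has_real_derivative bump3 v i j s (z + t *\<^sub>R v)) (at t)" for t
  proof -
    have "((\<lambda>h. bump2 i j s ((z + t *\<^sub>R v) + h *\<^sub>R v)) has_real_derivative bump3 v i j s (z + t *\<^sub>R v)) (at 0)"
      by (rule bump2_line_deriv)
    moreover have "(z + t *\<^sub>R v) + h *\<^sub>R v = z + (h + t) *\<^sub>R v" for h by (simp add: algebra_simps)
    ultimately show ?thesis using DERIV_shift[of "\<lambda>t. bump2 i j s (z + t *\<^sub>R v)" _ 0 t] by simp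
  qed
  obtain t where "bump2 i j s (z + 1 *\<^sub>R v) - bump2 i j s (z + 0 *\<^sub>R v) = (1 - 0) * bump3 v i j s (z + t *\<^sub>R v)"
    using MVT2[of 0 1 "\<lambda>t. bump2 i j s (z + t *\<^sub>R v)" "\<lambda>t. bump3 v i j s (z + t *\<^sub>R v)"] D by auto
  then have "bump2 i j s z' - bump2 i j s z = bump3 v i j s (z + t *\<^sub>R v)" by (simp add: v_def)
  then show ?thesis using bump3_bound[OF s, of v i j "z + t *\<^sub>R v"]
    by (simp add: v_def abs_minus_commute norm_minus_commute)
qed

lemma continuous_bump [continuous_intros]:
  "continuous_on A f \<Longrightarrow> continuous_on A g \<Longrightarrow> continuous_on A (\<lambda>x. bump (f x) (g x))"
  unfolding bump_def by (intro continuous_intros)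

lemma continuous_bump1 [continuous_intros]:
  "continuous_on A f \<Longrightarrow> continuous_on A g \<Longrightarrow> continuous_on A (\<lambda>x. bump1 i (f x) (g x))"
  unfolding bump1_def by (intro continuous_intros)

lemma continuous_bump2 [continuous_intros]:
  "continuous_on A f \<Longrightarrow> continuous_on A g \<Longrightarrow> continuous_on A (\<lambda>x. bump2 i j (f x) (g x))"
  unfolding bump2_def by (intro continuous_intros)

lemma continuous_bump3 [continuous_intros]:
  "continuous_on A f \<Longrightarrow> continuous_on A g \<Longrightarrow> continuous_on A (\<lambda>x. bump3 v i j (f x) (g x))"
  unfolding bump3_def by (intro continuous_intros)

section \<open>Integration by parts for the kernels\<close>

lemma integrable_continuous_support:
  fixes F :: "'a::euclidean_space \<Rightarrow> real"
  assumes F: "continuous_on UNIV F" and supp: "\<And>x. R < norm x \<Longrightarrow> F x = 0"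
  shows "integrable lborel F"
proof -
  have "compact (F ` cball 0 R)"
    by (intro compact_continuous_image continuous_on_subset[OF F]) auto
  then obtain B where B: "\<And>x. x \<in> cball 0 R \<Longrightarrow> norm (F x) \<le> B"
    using compact_imp_bounded bounded_iff by (metis imageI)
  show ?thesis
  proof (rule Bochner_Integration.integrable_bound)
    show "integrable lborel (\<lambda>x::'a. indicator (cball 0 R) x * B)"
      using emeasure_bounded_finite[of "cball 0 R :: 'a set"] by (intro integrable_mult_left integrable_real_indicator) auto
    show "F \<in> borel_measurable lborel" using borel_measurable_continuous_onI[OF F] by simp
    show "AE x in lborel. norm (F x) \<le> norm (indicator (cball 0 R) x * B)"
    proof (rule AE_I2)
      fix x
      show "norm (F x) \<le> norm (indicator (cball 0 R) x * B)"
        using B[of x] supp[of x] by (cases "norm x \<le> R") auto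
    qed
  qed
qed

lemma integral_lborel_translate:
  fixes F :: "'a::euclidean_space \<Rightarrow> real"
  assumes "F \<in> borel_measurable borel"
  shows "(\<integral>x. F (x + c) \<partial>lborel) = (\<integral>x. F x \<partial>lborel)"
proof -
  have "(\<integral>x. F x \<partial>lborel) = (\<integral>x. F x \<partial>(distr lborel borel ((+) c)))" by (simp add: lborel_distr_plus)
  also have "\<dots> = (\<integral>x. F (c + x) \<partial>lborel)" by (rule integral_distr) (use assms in auto)
  finally show ?thesis by (simp add: add.commute)
qed

text \<open>Difference quotients have integral zero by translation invariance, and the mean value
  theorem bounds them by a constant on a fixed ball, so dominated convergence applies in any
  direction without iterated integrals.\<close>

lemma integral_directional_derivative:
  fixes F F' :: "'a::euclidean_space \<Rightarrow> real"
  assumes D: "\<And>x. ((\<lambda>t. F (x + t *\<^sub>R v)) has_real_derivative F' x) (at 0)"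
    and cF: "continuous_on UNIV F" and cF': "continuous_on UNIV F'"
    and supp: "\<And>x. R < norm x \<Longrightarrow> F x = 0" "\<And>x. R < norm x \<Longrightarrow> F' x = 0"
  shows "(\<integral>x. F' x \<partial>lborel) = 0"
proof -
  have [measurable]: "F \<in> borel_measurable borel" "F' \<in> borel_measurable borel"
    using cF cF' by (auto intro: borel_measurable_continuous_onI)
  have iF: "integrable lborel F" by (rule integrable_continuous_support[OF cF supp(1)])
  have Dt: "((\<lambda>t. F (x + t *\<^sub>R v)) has_real_derivative F' (x + t *\<^sub>R v)) (at t)" for x t
  proof -
    have "((\<lambda>h. F ((x + t *\<^sub>R v) + h *\<^sub>R v)) has_real_derivative F' (x + t *\<^sub>R v)) (at 0)" by (rule D)
    moreover have "(x + t *\<^sub>R v) + h *\<^sub>R v = x + (h + t) *\<^sub>R v" for h by (simp add: algebra_simps)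
    ultimately show ?thesis using DERIV_shift[of "\<lambda>t. F (x + t *\<^sub>R v)" _ 0 t] by simp
  qed
  have "compact (F' ` cball 0 R)"
    by (intro compact_continuous_image continuous_on_subset[OF cF']) auto
  then obtain B where B: "\<And>x. x \<in> cball 0 R \<Longrightarrow> norm (F' x) \<le> B"
    using compact_imp_bounded bounded_iff by (metis imageI)
  have B': "\<bar>F' x\<bar> \<le> \<bar>B\<bar> * indicator (cball 0 R) x" for x
    using B[of x] supp(2)[of x] by (cases "norm x \<le> R") auto
  define h where "h m = 1 / real (Suc m)" for m
  have h: "0 < h m" "h m \<le> 1" for m by (auto simp: h_def)
  define G where "G m x = (F (x + h m *\<^sub>R v) - F x) / h m" for m x
  have iT: "integrable lborel (\<lambda>x. F (x + h m *\<^sub>R v))" for m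
  proof (rule integrable_continuous_support[where R="R + norm v"])
    show "continuous_on UNIV (\<lambda>x. F (x + h m *\<^sub>R v))"
      by (rule continuous_on_compose2[OF cF]) (auto intro!: continuous_intros)
    fix x :: 'a assume "R + norm v < norm x"
    moreover have "norm x \<le> norm (x + h m *\<^sub>R v) + norm (h m *\<^sub>R v)" by (metis add_diff_cancel norm_triangle_ineq4)
    moreover have "norm (h m *\<^sub>R v) \<le> norm v" using h[of m] by (simp add: mult_left_le_one_le)
    ultimately show "F (x + h m *\<^sub>R v) = 0" by (intro supp(1)) linarith
  qed
  have G0: "(\<integral>x. G m x \<partial>lborel) = 0" for m
    unfolding G_def using iT iF integral_lborel_translate[of F "h m *\<^sub>R v"] by simp
  have "(\<lambda>m. \<integral>x. G m x \<partial>lborel) \<longlonglongrightarrow> (\<integral>x. F' x \<partial>lborel)"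
  proof (rule integral_dominated_convergence)
    show "integrable lborel (\<lambda>x::'a. \<bar>B\<bar> * indicator (cball 0 (R + norm v)) x)"
      using emeasure_bounded_finite[of "cball 0 (R + norm v) :: 'a set"]
      by (intro integrable_mult_right integrable_real_indicator) auto
    show "AE x in lborel. (\<lambda>m. G m x) \<longlonglongrightarrow> F' x"
    proof (rule AE_I2)
      fix x
      have "((\<lambda>t. (F (x + t *\<^sub>R v) - F x) / t) \<longlongrightarrow> F' x) (at 0)"
        using D[of x] by (simp add: DERIV_def)
      moreover have "filterlim h (at 0) sequentially"
        unfolding filterlim_at h_def using LIMSEQ_inverse_real_of_nat by (simp add: inverse_eq_divide)
      ultimately show "(\<lambda>m. G m x) \<longlonglongrightarrow> F' x"
        unfolding G_def by (rule filterlim_compose)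
    qed
    fix m
    show "AE x in lborel. norm (G m x) \<le> \<bar>B\<bar> * indicator (cball 0 (R + norm v)) x"
    proof (rule AE_I2)
      fix x
      obtain t where t: "0 < t" "t < h m" "F (x + h m *\<^sub>R v) - F (x + 0 *\<^sub>R v) = (h m - 0) * F' (x + t *\<^sub>R v)"
        using MVT2[OF h(1)[of m], of "\<lambda>t. F (x + t *\<^sub>R v)" "\<lambda>t. F' (x + t *\<^sub>R v)"] Dt by auto
      then have G: "G m x = F' (x + t *\<^sub>R v)" using h(1)[of m] by (simp add: G_def)
      have "indicator (cball 0 R) (x + t *\<^sub>R v) \<le> (indicator (cball 0 (R + norm v)) x :: real)"
      proof (cases "norm (x + t *\<^sub>R v) \<le> R")
        case True
        have "norm x \<le> norm (x + t *\<^sub>R v) + norm (t *\<^sub>R v)" by (metis add_diff_cancel norm_triangle_ineq4)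
        moreover have "norm (t *\<^sub>R v) \<le> norm v" using t h[of m] by (simp add: mult_left_le_one_le)
        ultimately show ?thesis using True by simp
      qed simp
      then show "norm (G m x) \<le> \<bar>B\<bar> * indicator (cball 0 (R + norm v)) x"
        unfolding G real_norm_def by (intro order_trans[OF B'] mult_left_mono) auto
    qed
  qed (auto simp: G_def)
  then show ?thesis using G0 LIMSEQ_unique[of "\<lambda>m. 0" 0] by simp
qed

lemma bump_support: "norm y + s < norm x \<Longrightarrow> s < norm (x - y)" for x y :: "real^'n"
  using norm_triangle_sub[of x y] by linarith

text \<open>Both integrals equal minus the integral of \<open>P\<close>, the first derivative in
  direction \<open>i\<close> of one fourth power times the third derivative in directions
  \<open>i\<close>, \<open>j\<close>, \<open>j\<close> of the other: on the left the derivative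
  \<open>j\<close> is moved, on the right the derivative \<open>i\<close>. This is the pointwise
  source of the equality between the L^2 norms of Hessian and Laplacian.\<close>

lemma bump2_integral_swap:
  fixes y y' :: "real^'n"
  assumes s: "0 < s" "0 < s'"
  shows "(\<integral>x. bump2 i j s (x - y) * bump2 i j s' (x - y') \<partial>lborel)
       = (\<integral>x. bump2 i i s (x - y) * bump2 j j s' (x - y') \<partial>lborel)"
proof -
  define R where "R = norm y + s"
  have z: "bump1 k s (x - y) = 0" "bump2 k l s (x - y) = 0" if "R < norm x" for k l x
    using bump_support[of y s x] that s unfolding R_def by (auto intro!: bump_kernels_eq_0)
  define P where "P = (\<lambda>x. bump1 i s (x - y) * bump3 (axis j 1) i j s' (x - y'))"
  have P': "P = (\<lambda>x. bump1 i s (x - y) * bump3 (axis i 1) j j s' (x - y'))"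
    by (auto simp: P_def bump3_def inner_axis axis_one_nth fun_eq_iff algebra_simps)
  have sh: "(x + t *\<^sub>R v) - w = (x - w) + t *\<^sub>R v" for x v w :: "real^'n" and t by simp
  have 1: "(\<integral>x. bump2 i j s (x - y) * bump2 i j s' (x - y') + P x \<partial>lborel) = 0"
  proof (rule integral_directional_derivative[where R=R and v="axis j 1"
        and F="\<lambda>x. bump1 i s (x - y) * bump2 i j s' (x - y')"])
    fix x
    show "((\<lambda>t. bump1 i s (x + t *\<^sub>R axis j 1 - y) * bump2 i j s' (x + t *\<^sub>R axis j 1 - y')) has_real_derivative
        bump2 i j s (x - y) * bump2 i j s' (x - y') + P x) (at 0)"
      unfolding sh P_def using DERIV_mult[OF bump1_line_deriv[of i s "x - y" j] bump2_line_deriv[of i j s' "x - y'" "axis j 1"]]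
      by (simp add: algebra_simps)
  qed (auto intro!: continuous_intros simp: P_def z)
  have 2: "(\<integral>x. bump2 i i s (x - y) * bump2 j j s' (x - y') + P x \<partial>lborel) = 0"
  proof (rule integral_directional_derivative[where R=R and v="axis i 1"
        and F="\<lambda>x. bump1 i s (x - y) * bump2 j j s' (x - y')"])
    fix x
    show "((\<lambda>t. bump1 i s (x + t *\<^sub>R axis i 1 - y) * bump2 j j s' (x + t *\<^sub>R axis i 1 - y')) has_real_derivative
        bump2 i i s (x - y) * bump2 j j s' (x - y') + P x) (at 0)"
      unfolding sh P' using DERIV_mult[OF bump1_line_deriv[of i s "x - y" i] bump2_line_deriv[of j j s' "x - y'" "axis i 1"]]
      by (simp add: algebra_simps)
  qed (auto intro!: continuous_intros simp: P_def z)
  have iP: "integrable lborel P"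
    by (rule integrable_continuous_support[where R=R]) (auto intro!: continuous_intros simp: P_def z)
  have i2: "integrable lborel (\<lambda>x. bump2 k l s (x - y) * bump2 k' l' s' (x - y'))" for k l k' l'
    by (rule integrable_continuous_support[where R=R]) (auto intro!: continuous_intros simp: z)
  show ?thesis using 1 2 iP i2 by simp
qed

lemma norm_sq_vec: "(norm (z :: real^'n))\<^sup>2 = (\<Sum>i\<in>UNIV. (z $ i)\<^sup>2)"
  unfolding power2_norm_eq_inner inner_vec_def by (simp add: power2_eq_square)

lemma bump_measurable [measurable]: "bump s \<in> borel_measurable borel"
  "bump1 i s \<in> borel_measurable borel" "bump2 i j s \<in> borel_measurable borel"
  by (auto intro!: borel_measurable_continuous_onI continuous_intros)

section \<open>Integration by parts\<close>

lemma vec_measurable: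
  fixes f :: "'n::finite \<Rightarrow> 'a \<Rightarrow> real"
  assumes "\<And>i. f i \<in> borel_measurable M"
  shows "(\<lambda>x. \<chi> i. f i x) \<in> borel_measurable M"
proof (rule borel_measurable_euclidean_space[THEN iffD2], rule ballI)
  fix b :: "real^'n" assume "b \<in> Basis"
  then obtain i where "b = axis i 1" by (auto simp: Basis_vec_def)
  then show "(\<lambda>x. (\<chi> i. f i x) \<bullet> b) \<in> borel_measurable M" using assms by (simp add: inner_axis)
qed

context carre_structure
begin

text \<open>Density of the domain gives closeness for the measure itself, whereas the error is
  weighed with a density \<open>r\<close> that is merely integrable. Splitting \<open>r\<close> at a
  level \<open>k\<close> leaves an excess of small integral, met by the bound \<open>2 C\<close>,
  and a bounded part, met by closeness in L^2. Truncating at \<open>C\<close> brings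
  \<open>g\<close> no farther from \<open>G\<close>.\<close>

lemma Fb_dense:
  assumes [measurable]: "G \<in> borel_measurable M" "r \<in> borel_measurable M"
    and C: "0 < C" "\<And>x. \<bar>G x\<bar> \<le> C" and r: "integrable M r" "\<And>x. 0 \<le> r x" and e: "0 < e"
  obtains h where "h \<in> \<F>b" "\<And>x. \<bar>h x\<bar> \<le> C" "(\<integral>x. \<bar>G x - h x\<bar> * r x \<partial>M) < e"
proof -
  have "(\<lambda>k. \<integral>x. r x - min (r x) (real k) \<partial>M) \<longlonglongrightarrow> (\<integral>x. 0 \<partial>M)"
  proof (rule integral_dominated_convergence[OF _ _ r(1)])
    show "AE x in M. (\<lambda>k. r x - min (r x) (real k)) \<longlonglongrightarrow> 0"
    proof (rule AE_I2)
      fix x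
      obtain k0 where "r x \<le> real k0" using real_arch_simple by blast
      then have "\<forall>\<^sub>F k in sequentially. r x - min (r x) (real k) = 0"
        by (intro eventually_mono[OF eventually_ge_at_top[of k0]]) auto
      then show "(\<lambda>k. r x - min (r x) (real k)) \<longlonglongrightarrow> 0" by (rule tendsto_eventually)
    qed
    show "AE x in M. norm (r x - min (r x) (real k)) \<le> r x" for k using r(2) by (intro AE_I2) (auto simp: min_def)
  qed simp_all
  then have "\<forall>\<^sub>F k in sequentially. (\<integral>x. r x - min (r x) (real k) \<partial>M) < e / (4 * C)"
    using e C by (intro order_tendstoD(2)) auto
  then obtain k where k: "(\<integral>x. r x - min (r x) (real k) \<partial>M) < e / (4 * C)"
    by (auto simp: eventually_sequentially)
  \<comment> \<open>Adding 1 keeps the quotient meaningful when \<open>k = 0\<close>.\<close>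
  define \<delta> where "\<delta> = e / (2 * (real k + 1))"
  have \<delta>: "0 < \<delta>" using e by (simp add: \<delta>_def)
  have GL: "G \<in> L2_space M" by (rule AE_bounded_L2[where C=C]) (use C in auto)
  obtain g where g: "g \<in> \<F>" "sqrt (\<integral>x. (G x - g x)\<^sup>2 \<partial>M) < \<delta>"
    using dom_dense[OF GL \<delta>] by blast
  define h where "h = (\<lambda>x. trunc C (g x))"
  have h: "h \<in> \<F>b" unfolding h_def by (rule trunc_Fb[OF g(1) C(1)])
  have hb: "\<bar>h x\<bar> \<le> C" for x unfolding h_def using C trunc_bound(1) by simp
  have [measurable]: "h \<in> borel_measurable M" "g \<in> borel_measurable M" using h g dom_meas by auto
  have Gh: "\<bar>G x - h x\<bar> \<le> \<bar>G x - g x\<bar>" "\<bar>G x - h x\<bar> \<le> 2 * C" for x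
    using C(2)[of x] hb[of x] by (auto simp: h_def trunc_def)
  have iGg: "integrable M (\<lambda>x. (G x - g x)\<^sup>2)" using GL g dom_sq_int by (intro sq_diff_int) (auto simp: L2_space_def)
  have iG: "integrable M (\<lambda>x. \<bar>G x - h x\<bar>)"
    using Gh(2) by (intro integrable_const_bound[where B="2*C"]) auto
  have "(\<integral>x. \<bar>G x - h x\<bar> \<partial>M) < \<delta>"
  proof -
    have "(\<integral>x. \<bar>G x - h x\<bar> * 1 \<partial>M)\<^sup>2 \<le> (\<integral>x. \<bar>G x - h x\<bar>\<^sup>2 \<partial>M) * (\<integral>x. 1\<^sup>2 \<partial>M)"
    proof (rule integral_mult_sq_cs)
      show "integrable M (\<lambda>x. \<bar>G x - h x\<bar>\<^sup>2)"
        using GL h dom_sq_int unfolding power2_abs by (intro sq_diff_int) (auto simp: L2_space_def)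
    qed auto
    also have "\<dots> = (\<integral>x. \<bar>G x - h x\<bar>\<^sup>2 \<partial>M)" by (simp add: prob_space)
    also have "\<dots> \<le> (\<integral>x. (G x - g x)\<^sup>2 \<partial>M)"
    proof (rule integral_mono[OF _ iGg])
      show "integrable M (\<lambda>x. \<bar>G x - h x\<bar>\<^sup>2)"
        using GL h dom_sq_int unfolding power2_abs by (intro sq_diff_int) (auto simp: L2_space_def)
      show "\<bar>G x - h x\<bar>\<^sup>2 \<le> (G x - g x)\<^sup>2" for x using Gh(1)[of x] by (simp add: abs_le_square_iff)
    qed
    finally have "(\<integral>x. \<bar>G x - h x\<bar> \<partial>M)\<^sup>2 \<le> (\<integral>x. (G x - g x)\<^sup>2 \<partial>M)" by simp
    then have "sqrt ((\<integral>x. \<bar>G x - h x\<bar> \<partial>M)\<^sup>2) \<le> sqrt (\<integral>x. (G x - g x)\<^sup>2 \<partial>M)" by (rule real_sqrt_le_mono)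
    then show ?thesis using g(2) by simp
  qed
  then have "real k * (\<integral>x. \<bar>G x - h x\<bar> \<partial>M) \<le> real k * \<delta>" by (intro mult_left_mono) auto
  also have "real k * \<delta> \<le> e / 2" using e unfolding \<delta>_def by (simp add: field_simps)
  finally have 1: "real k * (\<integral>x. \<bar>G x - h x\<bar> \<partial>M) \<le> e / 2" .
  have 2: "2 * C * (\<integral>x. r x - min (r x) (real k) \<partial>M) < e / 2"
    using mult_strict_left_mono[OF k, of "2 * C"] C by simp
  have im: "integrable M (\<lambda>x. min (r x) (real k))" using r by (intro integrable_min) auto
  have "(\<integral>x. \<bar>G x - h x\<bar> * r x \<partial>M) \<le> (\<integral>x. real k * \<bar>G x - h x\<bar> + 2 * C * (r x - min (r x) (real k)) \<partial>M)"
  proof (rule integral_mono)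
    show "integrable M (\<lambda>x. \<bar>G x - h x\<bar> * r x)"
      by (rule bounded_mult_int[where C="2*C"]) (use Gh r in auto)
    show "integrable M (\<lambda>x. real k * \<bar>G x - h x\<bar> + 2 * C * (r x - min (r x) (real k)))"
      using iG im r by auto
    fix x
    have "\<bar>G x - h x\<bar> * r x = \<bar>G x - h x\<bar> * min (r x) (real k) + \<bar>G x - h x\<bar> * (r x - min (r x) (real k))"
      by (simp add: algebra_simps)
    also have "\<dots> \<le> \<bar>G x - h x\<bar> * real k + 2 * C * (r x - min (r x) (real k))"
      using Gh[of x] by (intro add_mono mult_left_mono mult_right_mono) auto
    finally show "\<bar>G x - h x\<bar> * r x \<le> real k * \<bar>G x - h x\<bar> + 2 * C * (r x - min (r x) (real k))" by (simp add: mult.commute)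
  qed
  also have "\<dots> = real k * (\<integral>x. \<bar>G x - h x\<bar> \<partial>M) + 2 * C * (\<integral>x. r x - min (r x) (real k) \<partial>M)"
    using iG im r by simp
  also have "\<dots> < e" using 1 2 by linarith
  finally show ?thesis using that h hb by blast
qed

text \<open>Continuity of \<gamma> at each pair \<open>(f, \<phi> j)\<close> gives a radius, and the
  index type is finite, so the smallest radius serves all pairs with one \<open>g\<close>.\<close>

lemma generator_approx:
  fixes \<phi> :: "'n::finite \<Rightarrow> 'a \<Rightarrow> real"
  assumes f: "f \<in> \<F>" and \<phi>: "\<And>i. \<phi> i \<in> \<F>" and e: "0 < e"
  obtains g V where "g \<in> \<F>" "integrable M V" "\<And>v. v \<in> \<F>b \<Longrightarrow> \<E> g v = (\<integral>x. V x * v x \<partial>M)"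
    "\<And>j. (\<integral>x. \<bar>\<gamma> g (\<phi> j) x - \<gamma> f (\<phi> j) x\<bar> \<partial>M) < e"
proof -
  have "\<forall>j. \<exists>d>0. \<forall>f'\<in>\<F>. \<forall>g'\<in>\<F>. energy_dist M \<E> f' f < d \<longrightarrow> energy_dist M \<E> g' (\<phi> j) < d \<longrightarrow>
        (\<integral>x. \<bar>\<gamma> f' g' x - \<gamma> f (\<phi> j) x\<bar> \<partial>M) < e"
    by (intro allI carre_cont f \<phi> e)
  then obtain d where d: "\<And>j. 0 < d j" "\<And>j f' g'. f' \<in> \<F> \<Longrightarrow> g' \<in> \<F> \<Longrightarrow> energy_dist M \<E> f' f < d j \<Longrightarrow>
     energy_dist M \<E> g' (\<phi> j) < d j \<Longrightarrow> (\<integral>x. \<bar>\<gamma> f' g' x - \<gamma> f (\<phi> j) x\<bar> \<partial>M) < e" by metis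
  define d0 where "d0 = Min (range d)"
  have d0: "0 < d0" "d0 \<le> d j" for j unfolding d0_def using d(1) by (auto simp: Min_gr_iff)
  show ?thesis
  proof (rule generator_dense[OF f d0(1)])
    fix g V assume gV: "g \<in> \<F>" "V \<in> borel_measurable M" "integrable M (\<lambda>x. (V x)\<^sup>2)"
    "energy_dist M \<E> g f < d0" "\<And>v. v \<in> \<F> \<Longrightarrow> \<E> g v = (\<integral>x. V x * v x \<partial>M)"
  show ?thesis
  proof (rule that[OF gV(1)])
    have "integrable M (\<lambda>x. V x * 1)" by (rule integrable_mult_sq) (use gV in auto)
    then show "integrable M V" by simp
    show "\<E> g v = (\<integral>x. V x * v x \<partial>M)" if "v \<in> \<F>b" for v using gV(5) that by auto
    fix j
    have "energy_dist M \<E> (\<phi> j) (\<phi> j) < d j"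
      using d(1) form_const(1)[OF dom_const, of 0 0] by (simp add: energy_dist_def energy_inner_def)
    then show "(\<integral>x. \<bar>\<gamma> g (\<phi> j) x - \<gamma> f (\<phi> j) x\<bar> \<partial>M) < e"
      using gV(4) d0(2)[of j] by (intro d(2)[OF gV(1) \<phi>]) auto
  qed
  qed
qed

text \<open>Composed with \<open>\<phi>\<close>, \<open>bump\<close> is a layer \<open>u\<close> of
  the polynomial \<open>p\<close>. Locality identifies \<gamma> of \<open>u\<close> and of
  \<open>p\<close> after multiplication by \<open>u\<close>; the third power in \<open>bump1\<close>
  supplies that factor, and the Leibniz rule gives the rest.\<close>

lemma carre_bump1:
  fixes \<phi> :: "'n::finite \<Rightarrow> 'a \<Rightarrow> real" and y :: "real^'n"
  assumes \<phi>: "\<And>i. \<phi> i \<in> \<F>b" and g: "g \<in> \<F>" and s: "0 < s"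
  shows "(\<lambda>x. bump1 i s ((\<chi> k. \<phi> k x) - y)) \<in> \<F>b"
    "AE x in M. \<gamma> (\<lambda>x. bump1 i s ((\<chi> k. \<phi> k x) - y)) g x
        = (\<Sum>j\<in>UNIV. bump2 i j s ((\<chi> k. \<phi> k x) - y) * \<gamma> (\<phi> j) g x)"
proof -
  have \<phi>F: "\<phi> i \<in> \<F>" for i using \<phi> by auto
  define \<psi> where "\<psi> j = (\<lambda>x. \<phi> j x + - (y $ j))" for j
  have \<psi>: "\<psi> j \<in> \<F>b" for j unfolding \<psi>_def by (intro Fb_add \<phi> Fb_const)
  have \<psi>F: "\<psi> j \<in> \<F>" for j using \<psi> by auto
  have c\<psi>: "AE x in M. \<gamma> (\<psi> j) g x = \<gamma> (\<phi> j) g x" for j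
    unfolding \<psi>_def using carre_add[OF \<phi>F dom_const g, of j "- (y $ j)"] carre_const[OF g, of "- (y $ j)"]
    by eventually_elim simp
  define p where "p = (\<lambda>x. s\<^sup>2 - (\<Sum>j\<in>UNIV. (\<psi> j x)\<^sup>2))"
  have sqF: "(\<lambda>x. (\<psi> j x)\<^sup>2) \<in> \<F>" "(\<lambda>x. \<Sum>j\<in>UNIV. (\<psi> j x)\<^sup>2) \<in> \<F>b" for j
    using Fb_square[OF \<psi>] by (auto intro!: Fb_sum simp del: Int_iff)
  have p: "p \<in> \<F>b" unfolding p_def by (intro Fb_diff Fb_const sqF)
  have cp: "AE x in M. \<gamma> p g x = - 2 * (\<Sum>j\<in>UNIV. \<psi> j x * \<gamma> (\<phi> j) g x)"
  proof -
    have "AE x in M. \<forall>j. \<gamma> (\<lambda>x. (\<psi> j x)\<^sup>2) g x = 2 * \<psi> j x * \<gamma> (\<psi> j) g x"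
      unfolding AE_all_countable by (intro allI carre_square \<psi> g)
    moreover have "AE x in M. \<forall>j. \<gamma> (\<psi> j) g x = \<gamma> (\<phi> j) g x"
      unfolding AE_all_countable by (intro allI c\<psi>)
    moreover have "AE x in M. \<gamma> p g x = \<gamma> (\<lambda>x. s\<^sup>2) g x - \<gamma> (\<lambda>x. \<Sum>j\<in>UNIV. (\<psi> j x)\<^sup>2) g x"
      unfolding p_def using sqF(2) by (intro carre_diff dom_const g) auto
    moreover have "AE x in M. \<gamma> (\<lambda>x. \<Sum>j\<in>UNIV. (\<psi> j x)\<^sup>2) g x = (\<Sum>j\<in>UNIV. \<gamma> (\<lambda>x. (\<psi> j x)\<^sup>2) g x)"
      by (intro carre_sum sqF g) auto
    ultimately show ?thesis using carre_const[OF g, of "s\<^sup>2"]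
      by eventually_elim (simp add: sum_distrib_left algebra_simps sum_negf)
  qed
  define u where "u = (\<lambda>x. bump s ((\<chi> k. \<phi> k x) - y))"
  have up: "u x = max 0 (p x)" for x
    unfolding u_def bump_def norm_sq_vec p_def \<psi>_def by simp
  have "u x = slice 0 (s\<^sup>2) (p x)" for x
  proof -
    have "p x \<le> s\<^sup>2" unfolding p_def by (simp add: sum_nonneg)
    then show ?thesis unfolding up slice_def by simp
  qed
  then have ueq: "u = (\<lambda>x. slice 0 (s\<^sup>2) (p x))" by auto
  have u: "u \<in> \<F>b" unfolding ueq using p s by (intro Fb_slice) auto
  then have uF: "u \<in> \<F>" and pF: "p \<in> \<F>" using p by auto
  have cu: "AE x in M. u x * \<gamma> u g x = u x * \<gamma> p g x"
  proof -
    have "AE x in M. u x * \<gamma> (\<lambda>x. u x - p x) g x = 0"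
    proof (rule carre_local[OF Fb_diff[OF u p] u _ _ g, where a=0])
      show "0 \<le> u x" for x unfolding up by simp
      show "AE x in M. (u x - p x + 0) * u x = 0" unfolding up by (intro AE_I2) (auto simp: max_def)
    qed
    then show ?thesis using carre_diff[OF uF pF g] by eventually_elim (simp add: algebra_simps)
  qed
  have uu: "(\<lambda>x. u x * u x) \<in> \<F>b" by (intro Fb_mult u)
  have u3: "(\<lambda>x. u x * (u x * u x)) \<in> \<F>b" by (intro Fb_mult u)
  have cu3: "AE x in M. \<gamma> (\<lambda>x. u x * (u x * u x)) g x = 3 * (u x * u x) * \<gamma> p g x"
    using carre_mult[OF u uu g] carre_mult[OF u u g] cu
    by eventually_elim (simp add: algebra_simps)
  have B: "bump1 i s ((\<chi> k. \<phi> k x) - y) = (-8) * (\<psi> i x * (u x * (u x * u x)))" for x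
    unfolding bump1_def u_def \<psi>_def by (simp add: power3_eq_cube algebra_simps)
  show "(\<lambda>x. bump1 i s ((\<chi> k. \<phi> k x) - y)) \<in> \<F>b"
    unfolding B by (intro Fb_scale Fb_mult \<psi> u)
  have \<psi>u: "(\<lambda>x. \<psi> i x * (u x * (u x * u x))) \<in> \<F>" using Fb_mult[OF \<psi> u3] by auto
  have "AE x in M. \<gamma> (\<lambda>x. bump1 i s ((\<chi> k. \<phi> k x) - y)) g x =
     -8 * (\<psi> i x * (3 * (u x * u x) * (- 2 * (\<Sum>j\<in>UNIV. \<psi> j x * \<gamma> (\<phi> j) g x))) + u x * (u x * u x) * \<gamma> (\<phi> i) g x)"
    unfolding B using carre_scale[OF \<psi>u g, of "-8"] carre_mult[OF \<psi> u3 g, of i] cu3 cp c\<psi>[of i]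
    by eventually_elim simp
  then show "AE x in M. \<gamma> (\<lambda>x. bump1 i s ((\<chi> k. \<phi> k x) - y)) g x
        = (\<Sum>j\<in>UNIV. bump2 i j s ((\<chi> k. \<phi> k x) - y) * \<gamma> (\<phi> j) g x)"
  proof eventually_elim
    fix x assume *: "\<gamma> (\<lambda>x. bump1 i s ((\<chi> k. \<phi> k x) - y)) g x =
     -8 * (\<psi> i x * (3 * (u x * u x) * (- 2 * (\<Sum>j\<in>UNIV. \<psi> j x * \<gamma> (\<phi> j) g x))) + u x * (u x * u x) * \<gamma> (\<phi> i) g x)"
    have "(\<Sum>j\<in>UNIV. bump2 i j s ((\<chi> k. \<phi> k x) - y) * \<gamma> (\<phi> j) g x)
       = (\<Sum>j\<in>UNIV. 48 * \<psi> i x * (u x * u x) * (\<psi> j x * \<gamma> (\<phi> j) g x) - (if i = j then 8 * (u x * (u x * u x)) * \<gamma> (\<phi> j) g x else 0))"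
      unfolding bump2_def u_def[symmetric] by (intro sum.cong) (auto simp: \<psi>_def u_def power2_eq_square power3_eq_cube algebra_simps)
    also have "\<dots> = 48 * \<psi> i x * (u x * u x) * (\<Sum>j\<in>UNIV. \<psi> j x * \<gamma> (\<phi> j) g x) - 8 * (u x * (u x * u x)) * \<gamma> (\<phi> i) g x"
      by (simp add: sum_subtractf sum_distrib_left)
    finally show "\<gamma> (\<lambda>x. bump1 i s ((\<chi> k. \<phi> k x) - y)) g x
        = (\<Sum>j\<in>UNIV. bump2 i j s ((\<chi> k. \<phi> k x) - y) * \<gamma> (\<phi> j) g x)"
      unfolding * by (simp add: algebra_simps)
  qed
qed

text \<open>Says that the image of the measure on \<open>A\<close> has first derivatives which are finite measures, given
  by \<open>D\<close>, up to divergences \<open>E\<close> of small mass. The weights \<open>\<beta>\<close>, inverse to the carre du champ matrix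
  on \<open>A\<close>, and \<open>\<phi>\<close> itself are approximated so that the form can be integrated by parts.\<close>

lemma small_divergence:
  fixes \<phi> :: "'n::finite \<Rightarrow> 'a \<Rightarrow> real" and \<beta> :: "'n \<Rightarrow> 'n \<Rightarrow> 'a \<Rightarrow> real"
  assumes \<phi>: "\<And>i. \<phi> i \<in> \<F>b" and A [measurable]: "A \<in> sets M"
    and \<beta> [measurable]: "\<And>i l. \<beta> i l \<in> borel_measurable M" and \<beta>C: "\<And>i l x. \<bar>\<beta> i l x\<bar> \<le> C"
    and inv: "\<And>x i j. x \<in> A \<Longrightarrow> (\<Sum>l\<in>UNIV. \<beta> i l x * \<gamma> (\<phi> l) (\<phi> j) x) = (if i = j then 1 else 0)"
    and e: "0 < e"
  obtains E :: "'n \<Rightarrow> 'n \<Rightarrow> 'a \<Rightarrow> real" and D :: "'n \<Rightarrow> 'a \<Rightarrow> real" where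
    "\<And>i j. integrable M (E i j)" "\<And>i. integrable M (D i)"
    "(\<Sum>i\<in>UNIV. \<Sum>j\<in>UNIV. \<integral>x. \<bar>E i j x\<bar> \<partial>M) \<le> e"
    "\<And>s y. 0 < s \<Longrightarrow> (\<integral>x. indicator A x * (\<Sum>i\<in>UNIV. bump2 i i s ((\<chi> k. \<phi> k x) - y)) \<partial>M)
       = (\<Sum>i\<in>UNIV. \<Sum>j\<in>UNIV. \<integral>x. bump2 i j s ((\<chi> k. \<phi> k x) - y) * E i j x \<partial>M)
         + (\<Sum>i\<in>UNIV. \<integral>x. bump1 i s ((\<chi> k. \<phi> k x) - y) * D i x \<partial>M)"
proof -
  define n where "n = real CARD('n)"
  have n: "0 < n" by (simp add: n_def)
  define K where "K = max C 1"
  have K: "0 < K" "\<And>i l x. \<bar>\<beta> i l x\<bar> \<le> K"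
    unfolding K_def by (simp, rule order_trans[OF \<beta>C max.cobounded1])
  \<comment> \<open>The total error is a sum over three indices, and each of the \<open>n^3\<close>
    terms contributes at most \<open>e1 + K * e2\<close>: one part from replacing \<open>G\<close>
    by \<open>h\<close>, one from replacing \<open>\<phi> l\<close> by \<open>f l\<close>.\<close>
  define e1 where "e1 = e / (2 * n^3)"
  define e2 where "e2 = e / (2 * n^3 * K)"
  have e12: "0 < e1" "0 < e2" using e n K by (auto simp: e1_def e2_def)
  have \<phi>F: "\<phi> i \<in> \<F>" for i using \<phi> by auto
  have [measurable]: "\<phi> i \<in> borel_measurable M" for i using \<phi>F dom_meas by auto
  have [measurable]: "(\<lambda>x. (\<chi> k. \<phi> k x)) \<in> borel_measurable M" by (intro vec_measurable) simp
  define G where "G i l x = indicator A x * \<beta> i l x" for i l x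
  have [measurable]: "G i l \<in> borel_measurable M" for i l unfolding G_def by measurable
  have GK: "\<bar>G i l x\<bar> \<le> K" for i l x using K by (auto simp: G_def indicator_def)
  define r where "r l x = (\<Sum>j\<in>UNIV. \<bar>\<gamma> (\<phi> l) (\<phi> j) x\<bar>)" for l x
  have ri: "integrable M (r l)" for l unfolding r_def by (intro Bochner_Integration.integrable_sum integrable_abs carre_int \<phi>F)
  have rm [measurable]: "r l \<in> borel_measurable M" for l using ri by blast
  have r0: "0 \<le> r l x" for l x unfolding r_def by (intro sum_nonneg) auto
  have "\<forall>i l. \<exists>h. h \<in> \<F>b \<and> (\<forall>x. \<bar>h x\<bar> \<le> K) \<and> (\<integral>x. \<bar>G i l x - h x\<bar> * r l x \<partial>M) < e1"
  proof (intro allI)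
    fix i l
    show "\<exists>h. h \<in> \<F>b \<and> (\<forall>x. \<bar>h x\<bar> \<le> K) \<and> (\<integral>x. \<bar>G i l x - h x\<bar> * r l x \<partial>M) < e1"
      by (rule Fb_dense[of "G i l" "r l" K e1]) (use K GK ri r0 e12 in auto)
  qed
  then obtain h where h: "\<And>i l. h i l \<in> \<F>b" "\<And>i l x. \<bar>h i l x\<bar> \<le> K"
    "\<And>i l. (\<integral>x. \<bar>G i l x - h i l x\<bar> * r l x \<partial>M) < e1" by metis
  have hF: "h i l \<in> \<F>" for i l using h by auto
  have [measurable]: "h i l \<in> borel_measurable M" for i l using hF dom_meas by auto
  have "\<forall>l. \<exists>g V. g \<in> \<F> \<and> integrable M V \<and> (\<forall>v\<in>\<F>b. \<E> g v = (\<integral>x. V x * v x \<partial>M)) \<and>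
    (\<forall>j. (\<integral>x. \<bar>\<gamma> g (\<phi> j) x - \<gamma> (\<phi> l) (\<phi> j) x\<bar> \<partial>M) < e2)"
  proof
    fix l
    show "\<exists>g V. g \<in> \<F> \<and> integrable M V \<and> (\<forall>v\<in>\<F>b. \<E> g v = (\<integral>x. V x * v x \<partial>M)) \<and>
      (\<forall>j. (\<integral>x. \<bar>\<gamma> g (\<phi> j) x - \<gamma> (\<phi> l) (\<phi> j) x\<bar> \<partial>M) < e2)"
      by (rule generator_approx[of "\<phi> l" \<phi> e2]) (use \<phi>F e12 in blast)+
  qed
  then obtain f V where f: "\<And>l. f l \<in> \<F>" "\<And>l. integrable M (V l)"
    "\<And>l v. v \<in> \<F>b \<Longrightarrow> \<E> (f l) v = (\<integral>x. V l x * v x \<partial>M)"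
    "\<And>l j. (\<integral>x. \<bar>\<gamma> (f l) (\<phi> j) x - \<gamma> (\<phi> l) (\<phi> j) x\<bar> \<partial>M) < e2" by metis
  \<comment> \<open>With \<open>h = G\<close> and \<open>f = \<phi>\<close> this would vanish by
    \<open>inv\<close>, so only the two replacement errors remain.\<close>
  define E where "E i j x = indicator A x * (if i = j then 1 else 0) - (\<Sum>l\<in>UNIV. h i l x * \<gamma> (f l) (\<phi> j) x)" for i j x
  define D where "D i x = (\<Sum>l\<in>UNIV. h i l x * V l x - \<gamma> (f l) (h i l) x)" for i x
  have hi: "integrable M (\<lambda>x. h i l x * q x)" if "integrable M q" for i l q
    by (rule Fb_mult_int[OF h(1) that])
  have iA: "integrable M (\<lambda>x. indicator A x * (c::real))" for c
    by (intro integrable_mult_left integrable_real_indicator) (auto simp: emeasure_finite less_top[symmetric])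
  have Ei: "integrable M (E i j)" for i j
    unfolding E_def by (intro Bochner_Integration.integrable_diff Bochner_Integration.integrable_sum hi carre_int f \<phi>F iA)
  have Di: "integrable M (D i)" for i
    unfolding D_def by (intro Bochner_Integration.integrable_sum Bochner_Integration.integrable_diff hi carre_int f hF)
  have Eb: "(\<integral>x. \<bar>E i j x\<bar> \<partial>M) \<le> n * (e1 + K * e2)" for i j
  proof -
    have ig: "integrable M (\<lambda>x. \<bar>G i l x - h i l x\<bar> * r l x)" for l
    proof (rule bounded_mult_int[where C="2*K"])
      show "AE x in M. \<bar>\<bar>G i l x - h i l x\<bar>\<bar> \<le> 2 * K"
      proof (rule AE_I2)
        fix x
        show "\<bar>\<bar>G i l x - h i l x\<bar>\<bar> \<le> 2 * K" using GK[of i l x] h(2)[of i l x] by linarith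
      qed
    qed (use ri in auto)
    have id: "integrable M (\<lambda>x. \<bar>\<gamma> (f l) (\<phi> j) x - \<gamma> (\<phi> l) (\<phi> j) x\<bar>)" for l
      by (intro integrable_abs Bochner_Integration.integrable_diff carre_int f \<phi>F)
    have "(\<integral>x. \<bar>E i j x\<bar> \<partial>M) \<le> (\<integral>x. (\<Sum>l\<in>UNIV. \<bar>G i l x - h i l x\<bar> * r l x + K * \<bar>\<gamma> (f l) (\<phi> j) x - \<gamma> (\<phi> l) (\<phi> j) x\<bar>) \<partial>M)"
    proof (rule integral_mono)
      show "integrable M (\<lambda>x. \<bar>E i j x\<bar>)" using Ei by auto
      show "integrable M (\<lambda>x. \<Sum>l\<in>UNIV. \<bar>G i l x - h i l x\<bar> * r l x + K * \<bar>\<gamma> (f l) (\<phi> j) x - \<gamma> (\<phi> l) (\<phi> j) x\<bar>)"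
        by (intro Bochner_Integration.integrable_sum Bochner_Integration.integrable_add integrable_mult_right ig id)
      fix x assume "x \<in> space M"
      have "indicator A x * (if i = j then 1 else 0) = (\<Sum>l\<in>UNIV. G i l x * \<gamma> (\<phi> l) (\<phi> j) x)"
        by (cases "x \<in> A") (simp_all add: G_def inv)
      then have "E i j x = (\<Sum>l\<in>UNIV. (G i l x - h i l x) * \<gamma> (\<phi> l) (\<phi> j) x - h i l x * (\<gamma> (f l) (\<phi> j) x - \<gamma> (\<phi> l) (\<phi> j) x))"
        by (simp add: E_def sum_subtractf algebra_simps)
      then have "\<bar>E i j x\<bar> \<le> (\<Sum>l\<in>UNIV. \<bar>(G i l x - h i l x) * \<gamma> (\<phi> l) (\<phi> j) x - h i l x * (\<gamma> (f l) (\<phi> j) x - \<gamma> (\<phi> l) (\<phi> j) x)\<bar>)"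
        by (simp only: sum_abs)
      also have "\<dots> \<le> (\<Sum>l\<in>UNIV. \<bar>G i l x - h i l x\<bar> * r l x + K * \<bar>\<gamma> (f l) (\<phi> j) x - \<gamma> (\<phi> l) (\<phi> j) x\<bar>)"
      proof (rule sum_mono)
        fix l
        have "\<bar>\<gamma> (\<phi> l) (\<phi> j) x\<bar> \<le> r l x" unfolding r_def by (intro member_le_sum) auto
        then have "\<bar>(G i l x - h i l x) * \<gamma> (\<phi> l) (\<phi> j) x\<bar> \<le> \<bar>G i l x - h i l x\<bar> * r l x"
          unfolding abs_mult by (intro mult_left_mono) auto
        moreover have "\<bar>h i l x * (\<gamma> (f l) (\<phi> j) x - \<gamma> (\<phi> l) (\<phi> j) x)\<bar> \<le> K * \<bar>\<gamma> (f l) (\<phi> j) x - \<gamma> (\<phi> l) (\<phi> j) x\<bar>"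
          unfolding abs_mult using h(2) by (intro mult_right_mono) auto
        ultimately show "\<bar>(G i l x - h i l x) * \<gamma> (\<phi> l) (\<phi> j) x - h i l x * (\<gamma> (f l) (\<phi> j) x - \<gamma> (\<phi> l) (\<phi> j) x)\<bar>
          \<le> \<bar>G i l x - h i l x\<bar> * r l x + K * \<bar>\<gamma> (f l) (\<phi> j) x - \<gamma> (\<phi> l) (\<phi> j) x\<bar>" by linarith
      qed
      finally show "\<bar>E i j x\<bar> \<le> (\<Sum>l\<in>UNIV. \<bar>G i l x - h i l x\<bar> * r l x + K * \<bar>\<gamma> (f l) (\<phi> j) x - \<gamma> (\<phi> l) (\<phi> j) x\<bar>)" .
    qed
    also have "\<dots> = (\<Sum>l\<in>UNIV. (\<integral>x. \<bar>G i l x - h i l x\<bar> * r l x \<partial>M) + K * (\<integral>x. \<bar>\<gamma> (f l) (\<phi> j) x - \<gamma> (\<phi> l) (\<phi> j) x\<bar> \<partial>M))"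
      using ig id by (subst Bochner_Integration.integral_sum) auto
    also have "\<dots> \<le> (\<Sum>l\<in>(UNIV::'n set). e1 + K * e2)"
      using h(3) f(4) K by (intro sum_mono add_mono mult_left_mono) (auto simp: less_imp_le)
    finally show ?thesis by (simp add: n_def)
  qed
  have "(\<Sum>i\<in>UNIV. \<Sum>j\<in>UNIV. \<integral>x. \<bar>E i j x\<bar> \<partial>M) \<le> (\<Sum>i\<in>(UNIV::'n set). \<Sum>j\<in>(UNIV::'n set). n * (e1 + K * e2))"
    by (intro sum_mono Eb)
  also have "\<dots> = n * (n * (n * (e1 + K * e2)))" by (simp add: n_def)
  also have "\<dots> = e" using n K by (simp add: e1_def e2_def field_simps power3_eq_cube)
  finally have Esum: "(\<Sum>i\<in>UNIV. \<Sum>j\<in>UNIV. \<integral>x. \<bar>E i j x\<bar> \<partial>M) \<le> e" .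
  have id: "(\<integral>x. indicator A x * (\<Sum>i\<in>UNIV. bump2 i i s ((\<chi> k. \<phi> k x) - y)) \<partial>M)
       = (\<Sum>i\<in>UNIV. \<Sum>j\<in>UNIV. \<integral>x. bump2 i j s ((\<chi> k. \<phi> k x) - y) * E i j x \<partial>M)
         + (\<Sum>i\<in>UNIV. \<integral>x. bump1 i s ((\<chi> k. \<phi> k x) - y) * D i x \<partial>M)" if s: "0 < s" for s y
  proof -
    define b2 where "b2 i j x = bump2 i j s ((\<chi> k. \<phi> k x) - y)" for i j x
    define \<psi> where "\<psi> i = (\<lambda>x. bump1 i s ((\<chi> k. \<phi> k x) - y))" for i
    have b2m [measurable]: "b2 i j \<in> borel_measurable M" for i j unfolding b2_def by measurable
    have b2i: "integrable M (\<lambda>x. b2 i j x * q x)" if "integrable M q" for q i j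
      by (rule bounded_mult_int[OF _ _ that, where C="56 * s^6"]) (auto simp: b2_def bump2_bound[OF s])
    have \<psi>: "\<psi> i \<in> \<F>b" for i unfolding \<psi>_def by (rule carre_bump1(1)[OF \<phi> dom_const[of 0] s])
    have \<psi>F: "\<psi> i \<in> \<F>" for i using \<psi> by auto
    have \<psi>i: "integrable M (\<lambda>x. \<psi> i x * q x)" if "integrable M q" for q i by (rule Fb_mult_int[OF \<psi> that])
    have c\<psi>: "AE x in M. \<gamma> (f l) (\<psi> i) x = (\<Sum>j\<in>UNIV. b2 i j x * \<gamma> (f l) (\<phi> j) x)" for i l
    proof -
      have "AE x in M. \<forall>j. \<gamma> (\<phi> j) (f l) x = \<gamma> (f l) (\<phi> j) x"
        unfolding AE_all_countable by (intro allI carre_sym f \<phi>F)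
      with carre_bump1(2)[OF \<phi> f(1)[of l] s, where i=i and y=y] carre_sym[OF f(1)[of l] \<psi>F[of i]]
      show ?thesis unfolding \<psi>_def b2_def by eventually_elim simp
    qed
    \<comment> \<open>Integration by parts: the Leibniz rule writes
      \<open>h \<gamma>(f, \<psi>)\<close> as
      \<open>\<gamma>(f, h \<psi>) - \<psi> \<gamma>(f, h)\<close>. The first term integrates to
      \<open>\<E> f (h \<psi>)\<close>, which is the integral of \<open>V h \<psi>\<close> because
      \<open>f l\<close> comes from the domain of the generator.\<close>
    have key: "(\<integral>x. h i l x * (\<Sum>j\<in>UNIV. b2 i j x * \<gamma> (f l) (\<phi> j) x) \<partial>M) = (\<integral>x. \<psi> i x * (h i l x * V l x - \<gamma> (f l) (h i l) x) \<partial>M)" for i l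
    proof -
      have h\<psi>: "(\<lambda>x. h i l x * \<psi> i x) \<in> \<F>b" by (intro Fb_mult h \<psi>)
      then have h\<psi>F: "(\<lambda>x. h i l x * \<psi> i x) \<in> \<F>" by auto
      have "AE x in M. \<gamma> (f l) (\<lambda>x. h i l x * \<psi> i x) x = h i l x * \<gamma> (f l) (\<psi> i) x + \<psi> i x * \<gamma> (f l) (h i l) x"
        using carre_mult[OF h(1) \<psi> f(1), of i l i l] carre_sym[OF f(1) h\<psi>F, of l] carre_sym[OF f(1) \<psi>F, of l i] carre_sym[OF f(1) hF, of l i l]
        by eventually_elim simp
      then have "AE x in M. h i l x * (\<Sum>j\<in>UNIV. b2 i j x * \<gamma> (f l) (\<phi> j) x) = \<gamma> (f l) (\<lambda>x. h i l x * \<psi> i x) x - \<psi> i x * \<gamma> (f l) (h i l) x"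
        using c\<psi>[of l i] by eventually_elim simp
      then have "(\<integral>x. h i l x * (\<Sum>j\<in>UNIV. b2 i j x * \<gamma> (f l) (\<phi> j) x) \<partial>M) = (\<integral>x. \<gamma> (f l) (\<lambda>x. h i l x * \<psi> i x) x - \<psi> i x * \<gamma> (f l) (h i l) x \<partial>M)"
        by (intro integral_cong_AE borel_measurable_diff borel_measurable_times borel_measurable_sum carre_meas f \<phi>F h\<psi>F hF
            dom_meas[OF \<psi>F] dom_meas[OF hF] b2m)
      also have "\<dots> = (\<integral>x. \<gamma> (f l) (\<lambda>x. h i l x * \<psi> i x) x \<partial>M) - (\<integral>x. \<psi> i x * \<gamma> (f l) (h i l) x \<partial>M)"
        by (intro Bochner_Integration.integral_diff carre_int f h\<psi>F \<psi>i hF)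
      also have "(\<integral>x. \<gamma> (f l) (\<lambda>x. h i l x * \<psi> i x) x \<partial>M) = (\<integral>x. V l x * (h i l x * \<psi> i x) \<partial>M)"
        using carre_integral[OF f(1) h\<psi>] f(3)[OF h\<psi>] by simp
      also have "\<dots> = (\<integral>x. \<psi> i x * (h i l x * V l x) \<partial>M)"
        by (rule Bochner_Integration.integral_cong) (auto simp: algebra_simps)
      also have "\<dots> - (\<integral>x. \<psi> i x * \<gamma> (f l) (h i l) x \<partial>M) = (\<integral>x. \<psi> i x * (h i l x * V l x - \<gamma> (f l) (h i l) x) \<partial>M)"
        unfolding right_diff_distrib by (intro Bochner_Integration.integral_diff[symmetric] \<psi>i hi carre_int f hF)
      finally show ?thesis .
    qed
    have 1: "(\<Sum>i\<in>UNIV. \<integral>x. \<psi> i x * D i x \<partial>M) = (\<Sum>i\<in>UNIV. \<Sum>l\<in>UNIV. \<integral>x. h i l x * (\<Sum>j\<in>UNIV. b2 i j x * \<gamma> (f l) (\<phi> j) x) \<partial>M)"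
      unfolding key unfolding D_def sum_distrib_left
      by (intro sum.cong refl Bochner_Integration.integral_sum \<psi>i Bochner_Integration.integrable_diff hi carre_int f hF)
    have ih: "integrable M (\<lambda>x. b2 i j x * (h i l x * \<gamma> (f l) (\<phi> j) x))" for i j l
      by (intro b2i hi carre_int f \<phi>F)
    have iA2: "integrable M (\<lambda>x. b2 i j x * (indicator A x * c))" for i j c
      by (intro b2i iA)
    have 2: "(\<integral>x. b2 i j x * E i j x \<partial>M) = (\<integral>x. b2 i j x * (indicator A x * (if i = j then 1 else 0)) \<partial>M)
        - (\<Sum>l\<in>UNIV. \<integral>x. b2 i j x * (h i l x * \<gamma> (f l) (\<phi> j) x) \<partial>M)" for i j
    proof -
      have "(\<integral>x. b2 i j x * E i j x \<partial>M) = (\<integral>x. b2 i j x * (indicator A x * (if i = j then 1 else 0)) -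
           (\<Sum>l\<in>UNIV. b2 i j x * (h i l x * \<gamma> (f l) (\<phi> j) x)) \<partial>M)"
        unfolding E_def right_diff_distrib sum_distrib_left ..
      also have "\<dots> = (\<integral>x. b2 i j x * (indicator A x * (if i = j then 1 else 0)) \<partial>M) - (\<integral>x. (\<Sum>l\<in>UNIV. b2 i j x * (h i l x * \<gamma> (f l) (\<phi> j) x)) \<partial>M)"
        by (intro Bochner_Integration.integral_diff iA2 Bochner_Integration.integrable_sum ih)
      finally show ?thesis using ih by simp
    qed
    have 3: "(\<Sum>i\<in>UNIV. \<Sum>l\<in>UNIV. \<integral>x. h i l x * (\<Sum>j\<in>UNIV. b2 i j x * \<gamma> (f l) (\<phi> j) x) \<partial>M)
       = (\<Sum>i\<in>UNIV. \<Sum>j\<in>UNIV. \<Sum>l\<in>UNIV. \<integral>x. b2 i j x * (h i l x * \<gamma> (f l) (\<phi> j) x) \<partial>M)"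
    proof (rule sum.cong[OF refl])
      fix i
      have eq: "(\<integral>x. h i l x * (\<Sum>j\<in>UNIV. b2 i j x * \<gamma> (f l) (\<phi> j) x) \<partial>M) = (\<Sum>j\<in>UNIV. \<integral>x. b2 i j x * (h i l x * \<gamma> (f l) (\<phi> j) x) \<partial>M)" for l
      proof -
        have "(\<integral>x. h i l x * (\<Sum>j\<in>UNIV. b2 i j x * \<gamma> (f l) (\<phi> j) x) \<partial>M) = (\<integral>x. (\<Sum>j\<in>UNIV. b2 i j x * (h i l x * \<gamma> (f l) (\<phi> j) x)) \<partial>M)"
          by (simp add: sum_distrib_left mult.left_commute)
        then show ?thesis using ih by simp
      qed
      show "(\<Sum>l\<in>UNIV. \<integral>x. h i l x * (\<Sum>j\<in>UNIV. b2 i j x * \<gamma> (f l) (\<phi> j) x) \<partial>M)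
        = (\<Sum>j\<in>UNIV. \<Sum>l\<in>UNIV. \<integral>x. b2 i j x * (h i l x * \<gamma> (f l) (\<phi> j) x) \<partial>M)"
        unfolding eq by (rule sum.swap)
    qed
    have 4: "(\<Sum>i\<in>UNIV. \<Sum>j\<in>UNIV. \<integral>x. b2 i j x * (indicator A x * (if i = j then 1 else 0)) \<partial>M) = (\<integral>x. indicator A x * (\<Sum>i\<in>UNIV. b2 i i x) \<partial>M)"
    proof -
      have "(\<Sum>j\<in>UNIV. \<integral>x. b2 i j x * (indicator A x * (if i = j then 1 else 0)) \<partial>M) = (\<integral>x. b2 i i x * (indicator A x * 1) \<partial>M)" for i
      proof -
        have "(\<Sum>j\<in>UNIV. \<integral>x. b2 i j x * (indicator A x * (if i = j then 1 else 0)) \<partial>M)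
          = (\<Sum>j\<in>UNIV. if j = i then \<integral>x. b2 i i x * (indicator A x * 1) \<partial>M else 0)"
          by (intro sum.cong) auto
        then show ?thesis by simp
      qed
      moreover have "(\<Sum>i\<in>UNIV. \<integral>x. b2 i i x * (indicator A x * 1) \<partial>M) = (\<integral>x. (\<Sum>i\<in>UNIV. b2 i i x * (indicator A x * 1)) \<partial>M)"
        by (intro Bochner_Integration.integral_sum[symmetric] iA2)
      ultimately show ?thesis by (simp add: sum_distrib_left mult.commute)
    qed
    have "(\<Sum>i\<in>UNIV. \<Sum>j\<in>UNIV. \<integral>x. b2 i j x * E i j x \<partial>M) + (\<Sum>i\<in>UNIV. \<integral>x. \<psi> i x * D i x \<partial>M)
       = (\<integral>x. indicator A x * (\<Sum>i\<in>UNIV. b2 i i x) \<partial>M)"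
      unfolding 2 1 3 sum_subtractf 4 by simp
    then show ?thesis by (simp add: b2_def \<psi>_def)
  qed
  show ?thesis by (rule that[OF Ei Di Esum id])
qed

end

section \<open>The Hessian of the test function\<close>

text \<open>The circumscribed cube; this is the origin of the factors \<open>2 ^ CARD('n)\<close> in
  the bounds on \<open>grad\<close>, \<open>hess\<close> and \<open>conv\<close>.\<close>

lemma emeasure_ball_le:
  fixes x :: "real^'n"
  assumes s: "0 \<le> s"
  shows "emeasure lborel (ball x s) \<le> ennreal ((2 * s) ^ CARD('n))"
proof -
  define l u where "l = x - (\<chi> i. s)" and "u = x + (\<chi> i. s)"
  have b: "(u - l) \<bullet> b = 2 * s" if "b \<in> Basis" for b
    using that by (auto simp: Basis_vec_def l_def u_def inner_axis)
  have "ball x s \<subseteq> cbox l u"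
  proof
    fix z assume "z \<in> ball x s"
    then have "\<bar>z $ i - x $ i\<bar> \<le> s" for i
      using abs_component_le[of "z - x" i] by (auto simp: dist_norm norm_minus_commute)
    then show "z \<in> cbox l u"
      by (auto simp: mem_box_cart l_def u_def abs_le_iff algebra_simps)
  qed
  then have "emeasure lborel (ball x s) \<le> emeasure lborel (cbox l u)" by (intro emeasure_mono) auto
  also have "\<dots> = ennreal (\<Prod>b\<in>Basis. (u - l) \<bullet> b)"
    by (intro emeasure_lborel_cbox) (use b s in \<open>auto simp: inner_diff_left intro: ccontr\<close>, use b s in \<open>force simp: inner_diff_left\<close>)
  also have "(\<Prod>b\<in>Basis. (u - l) \<bullet> b) = (2 * s) ^ CARD('n)" using b by simp
  finally show ?thesis .
qed

lemma finite_Fubini: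
  assumes "finite_measure A" "finite_measure B"
    and F: "(\<lambda>(x, y). F x y :: real) \<in> borel_measurable (A \<Otimes>\<^sub>M B)" and C: "\<And>x y. \<bar>F x y\<bar> \<le> C"
  shows "(\<integral>x. \<integral>y. F x y \<partial>B \<partial>A) = (\<integral>y. \<integral>x. F x y \<partial>A \<partial>B)"
proof -
  interpret A: finite_measure A by fact
  interpret B: finite_measure B by fact
  interpret pair_sigma_finite A B ..
  interpret P: finite_measure "A \<Otimes>\<^sub>M B" by (rule finite_measure_pair_measure) fact+
  show ?thesis
    by (rule Fubini_integral[symmetric], rule P.integrable_const_bound[where B=C]) (use F C in auto)
qed

lemma bump_pair_measurable [measurable]:
  fixes f :: "'a \<Rightarrow> real" and g :: "'a \<Rightarrow> real^'n"
  assumes [measurable]: "f \<in> borel_measurable M" "g \<in> borel_measurable M"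
  shows "(\<lambda>x. bump1 i (f x) (g x)) \<in> borel_measurable M" "(\<lambda>x. bump2 i j (f x) (g x)) \<in> borel_measurable M"
    "(\<lambda>x. mollifier (f x) (g x)) \<in> borel_measurable M"
proof -
  have [measurable]: "(\<lambda>x. bump (f x) (g x)) \<in> borel_measurable M" unfolding bump_def by measurable
  have [measurable]: "(\<lambda>x. g x $ i) \<in> borel_measurable M" for i
  proof -
    have "(\<lambda>x. g x \<bullet> axis i 1) \<in> borel_measurable M" by measurable
    then show ?thesis by (simp add: inner_axis)
  qed
  show "(\<lambda>x. bump1 i (f x) (g x)) \<in> borel_measurable M" "(\<lambda>x. bump2 i j (f x) (g x)) \<in> borel_measurable M"
    "(\<lambda>x. mollifier (f x) (g x)) \<in> borel_measurable M"
    unfolding bump1_def bump2_def mollifier_def by measurable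
qed

text \<open>A positive \<sigma> keeps the parameter measure finite and the kernels bounded, so that
  all exchanges of integrals are unproblematic. The constants in \<open>grad_bound\<close>,
  \<open>hess_osc\<close> and \<open>hess_L2\<close> nevertheless do not involve \<sigma>, which is
  essential because \<sigma> is not controlled later.\<close>

locale kernel_field =
  fixes \<sigma> \<rho> :: real and Z :: "(real^'n) set"
  assumes \<sigma>: "0 < \<sigma>" and \<sigma>\<rho>: "\<sigma> \<le> \<rho>" and Z [measurable]: "Z \<in> sets borel" and bZ: "bounded Z"
begin

text \<open>The weight is the power of \<open>s\<close> by which \<open>mollifier_deriv\<close>
  divides the Laplacian.\<close>

definition P :: "(real \<times> (real^'n)) measure" where
  "P = density lborel (\<lambda>p. ennreal (indicator ({\<sigma>..\<rho>} \<times> Z) p / fst p ^ (CARD('n) + 7)))"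

text \<open>The indicators repeat the restriction built into \<open>P\<close>, so that bounds and
  supports of the kernels hold for every parameter and not just almost every one.\<close>

definition K2 :: "'n \<Rightarrow> 'n \<Rightarrow> real \<times> (real^'n) \<Rightarrow> real^'n \<Rightarrow> real" where
  "K2 i j p x = indicator {\<sigma>..\<rho>} (fst p) * indicator Z (snd p) * bump2 i j (fst p) (x - snd p)"

definition K1 :: "'n \<Rightarrow> real \<times> (real^'n) \<Rightarrow> real^'n \<Rightarrow> real" where
  "K1 i p x = indicator {\<sigma>..\<rho>} (fst p) * indicator Z (snd p) * bump1 i (fst p) (x - snd p)"

text \<open>Second and first derivatives of the test function
  \<open>x \<mapsto> \<integral>\<^sub>\<sigma>\<^sup>\<rho> \<integral>\<^sub>Z bump s (x - y) ^ 4 / s ^ (n + 7) dy ds\<close>, with \<open>n\<close> the dimension.\<close>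

definition hess :: "'n \<Rightarrow> 'n \<Rightarrow> real^'n \<Rightarrow> real" where "hess i j x = (\<integral>p. K2 i j p x \<partial>P)"

definition grad :: "'n \<Rightarrow> real^'n \<Rightarrow> real" where "grad i x = (\<integral>p. K1 i p x \<partial>P)"

definition conv :: "real \<Rightarrow> real^'n \<Rightarrow> real" where
  "conv s x = (\<integral>y. indicator Z y * mollifier s (x - y) \<partial>lborel)"

section \<open>Pointwise estimates of gradient and Hessian\<close>

lemma sets_P [measurable_cong, simp]: "sets P = sets borel" by (simp add: P_def)

lemma space_P [simp]: "space P = UNIV" by (simp add: P_def)

lemma weight_measurable [measurable]:
  "(\<lambda>p::real \<times> (real^'n). indicator ({\<sigma>..\<rho>} \<times> Z) p / fst p ^ (CARD('n) + 7) :: real) \<in> borel_measurable borel"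
proof -
  have "{\<sigma>..\<rho>} \<times> Z \<in> sets (borel \<Otimes>\<^sub>M borel)" by measurable
  then have [measurable]: "{\<sigma>..\<rho>} \<times> Z \<in> sets (borel :: (real \<times> (real^'n)) measure)" unfolding borel_prod .
  have [measurable]: "(fst :: real \<times> (real^'n) \<Rightarrow> real) \<in> borel_measurable borel"
    by (intro borel_measurable_continuous_onI continuous_intros)
  show ?thesis by measurable
qed

lemma fst_snd_measurable [measurable]:
  "(fst :: real \<times> (real^'n) \<Rightarrow> real) \<in> borel_measurable borel"
  "(snd :: real \<times> (real^'n) \<Rightarrow> real^'n) \<in> borel_measurable borel"
  by (intro borel_measurable_continuous_onI continuous_intros)+

lemma nn_P:
  assumes F [measurable]: "F \<in> borel_measurable borel"
  shows "(\<integral>\<^sup>+p. F p \<partial>P) = (\<integral>\<^sup>+s. indicator {\<sigma>..\<rho>} s * (\<integral>\<^sup>+y. indicator Z y * (ennreal (1 / s ^ (CARD('n) + 7)) * F (s, y)) \<partial>lborel) \<partial>lborel)"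
proof -
  let ?w = "\<lambda>p::real \<times> (real^'n). ennreal (indicator ({\<sigma>..\<rho>} \<times> Z) p / fst p ^ (CARD('n) + 7))"
  have "(\<integral>\<^sup>+p. F p \<partial>P) = (\<integral>\<^sup>+p. ?w p * F p \<partial>lborel)"
    unfolding P_def by (rule nn_integral_density) measurable
  also have "\<dots> = (\<integral>\<^sup>+p. ?w p * F p \<partial>(lborel \<Otimes>\<^sub>M lborel))" by (simp only: lborel_prod)
  also have "\<dots> = (\<integral>\<^sup>+s. \<integral>\<^sup>+y. ?w (s, y) * F (s, y) \<partial>lborel \<partial>lborel)"
    by (intro lborel.nn_integral_fst[symmetric]) (simp add: lborel_prod)
  also have "\<dots> = (\<integral>\<^sup>+s. indicator {\<sigma>..\<rho>} s * (\<integral>\<^sup>+y. indicator Z y * (ennreal (1 / s ^ (CARD('n) + 7)) * F (s, y)) \<partial>lborel) \<partial>lborel)"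
  proof (intro nn_integral_cong)
    fix s :: real
    show "(\<integral>\<^sup>+y. ?w (s, y) * F (s, y) \<partial>lborel) = indicator {\<sigma>..\<rho>} s * (\<integral>\<^sup>+y. indicator Z y * (ennreal (1 / s ^ (CARD('n) + 7)) * F (s, y)) \<partial>lborel)"
      by (cases "s \<in> {\<sigma>..\<rho>}") (auto intro!: nn_integral_cong simp: indicator_def)
  qed
  finally show ?thesis .
qed

lemma emeasure_Z: "emeasure lborel Z < \<infinity>" using emeasure_bounded_finite[OF bZ] by simp

lemma finite_P: "finite_measure P"
proof
  have "emeasure P (space P) = (\<integral>\<^sup>+p. 1 \<partial>P)" by simp
  also have "\<dots> = (\<integral>\<^sup>+s. indicator {\<sigma>..\<rho>} s * (\<integral>\<^sup>+y. indicator Z y * (ennreal (1 / s ^ (CARD('n) + 7)) * 1) \<partial>lborel) \<partial>lborel)"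
    by (rule nn_P) simp
  also have "\<dots> \<le> (\<integral>\<^sup>+s. ennreal (1 / \<sigma> ^ (CARD('n) + 7)) * emeasure lborel Z * indicator {\<sigma>..\<rho>} s \<partial>lborel)"
  proof (intro nn_integral_mono)
    fix s :: real
    show "indicator {\<sigma>..\<rho>} s * (\<integral>\<^sup>+y. indicator Z y * (ennreal (1 / s ^ (CARD('n) + 7)) * 1) \<partial>lborel)
      \<le> ennreal (1 / \<sigma> ^ (CARD('n) + 7)) * emeasure lborel Z * indicator {\<sigma>..\<rho>} s"
    proof (cases "s \<in> {\<sigma>..\<rho>}")
      case True
      have "(\<integral>\<^sup>+y. indicator Z y * (ennreal (1 / s ^ (CARD('n) + 7)) * 1) \<partial>lborel) = ennreal (1 / s ^ (CARD('n) + 7)) * emeasure lborel Z"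
        by (simp add: nn_integral_multc mult.commute nn_integral_cmult)
      also have "\<dots> \<le> ennreal (1 / \<sigma> ^ (CARD('n) + 7)) * emeasure lborel Z"
        using True \<sigma> by (intro mult_right_mono ennreal_leI divide_left_mono power_mono) auto
      finally show ?thesis using True by simp
    qed simp
  qed
  also have "\<dots> = ennreal (1 / \<sigma> ^ (CARD('n) + 7)) * emeasure lborel Z * ennreal (\<rho> - \<sigma>)"
    using \<sigma>\<rho> by (simp add: nn_integral_cmult)
  also have "\<dots> < \<infinity>" using emeasure_Z by (simp add: ennreal_mult_less_top)
  finally show "emeasure P (space P) \<noteq> \<infinity>" by simp
qed

sublocale P: finite_measure P by (rule finite_P)

lemma K_bound: "\<bar>K2 i j p x\<bar> \<le> 56 * \<rho> ^ 6" "\<bar>K1 i p x\<bar> \<le> 8 * \<rho> ^ 7"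
proof -
  show "\<bar>K2 i j p x\<bar> \<le> 56 * \<rho> ^ 6"
  proof (cases "fst p \<in> {\<sigma>..\<rho>} \<and> snd p \<in> Z")
    case True
    then have s: "0 < fst p" "fst p ^ 6 \<le> \<rho> ^ 6" using \<sigma> by (auto intro!: power_mono)
    have "\<bar>bump2 i j (fst p) (x - snd p)\<bar> \<le> 56 * fst p ^ 6" by (rule bump2_bound[OF s(1)])
    also have "\<dots> \<le> 56 * \<rho> ^ 6" using s(2) by simp
    finally show ?thesis using True by (simp add: K2_def)
  qed (use \<sigma> \<sigma>\<rho> in \<open>auto simp: K2_def indicator_def\<close>)
  show "\<bar>K1 i p x\<bar> \<le> 8 * \<rho> ^ 7"
  proof (cases "fst p \<in> {\<sigma>..\<rho>} \<and> snd p \<in> Z")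
    case True
    then have s: "0 < fst p" "fst p ^ 7 \<le> \<rho> ^ 7" using \<sigma> by (auto intro!: power_mono)
    have "\<bar>bump1 i (fst p) (x - snd p)\<bar> \<le> 8 * fst p ^ 7" by (rule bump1_bound[OF s(1)])
    also have "\<dots> \<le> 8 * \<rho> ^ 7" using s(2) by simp
    finally show ?thesis using True by (simp add: K1_def)
  qed (use \<sigma> \<sigma>\<rho> in \<open>auto simp: K1_def indicator_def\<close>)
qed

lemma K_measurable [measurable]:
  "(\<lambda>(p, x). K2 i j p x) \<in> borel_measurable (borel \<Otimes>\<^sub>M borel)"
  "(\<lambda>(p, x). K1 i p x) \<in> borel_measurable (borel \<Otimes>\<^sub>M borel)"
  unfolding K1_def K2_def by measurable

lemma K_measurable1 [measurable]:
  "(\<lambda>p. K2 i j p x) \<in> borel_measurable borel" "(\<lambda>p. K1 i p x) \<in> borel_measurable borel"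
  unfolding K1_def K2_def by measurable

lemma K_integrable: "integrable P (\<lambda>p. K2 i j p x)" "integrable P (\<lambda>p. K1 i p x)"
  using K_bound(1)[of i j] K_bound(2)[of i]
  by (intro P.integrable_const_bound[where B="56 * \<rho> ^ 6"] P.integrable_const_bound[where B="8 * \<rho> ^ 7"]; simp)+

lemma field_measurable [measurable]: "hess i j \<in> borel_measurable borel" "grad i \<in> borel_measurable borel"
proof -
  have "(\<lambda>(x, p). K2 i j p x) \<in> borel_measurable (borel \<Otimes>\<^sub>M P)"
    "(\<lambda>(x, p). K1 i p x) \<in> borel_measurable (borel \<Otimes>\<^sub>M P)"
    unfolding K1_def K2_def by measurable
  then show "hess i j \<in> borel_measurable borel" "grad i \<in> borel_measurable borel"
    unfolding hess_def[abs_def] grad_def[abs_def] by (auto intro!: P.borel_measurable_lebesgue_integral)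
qed

lemma hess_bounded: "\<bar>hess i j x\<bar> \<le> 56 * \<rho> ^ 6 * measure P UNIV"
proof -
  have "\<bar>hess i j x\<bar> \<le> (\<integral>p. \<bar>K2 i j p x\<bar> \<partial>P)" unfolding hess_def by (rule integral_abs_bound)
  also have "\<dots> \<le> (\<integral>p. 56 * \<rho> ^ 6 \<partial>P)"
    using K_bound K_integrable by (intro integral_mono) auto
  finally show ?thesis by (simp add: mult_ac)
qed

text \<open>At scale \<open>s\<close> only the \<open>y\<close> in the ball of radius
  \<open>s\<close> about \<open>x\<close> contribute, and the volume of that ball cancels the
  dimensional part of the weight.\<close>

lemma nn_kernel_bound:
  assumes f [measurable]: "f \<in> borel_measurable borel" and [measurable]: "a \<in> borel_measurable borel"
    and bd: "\<And>s y. \<sigma> \<le> s \<Longrightarrow> s \<le> \<rho> \<Longrightarrow> y \<in> Z \<Longrightarrow> \<bar>f (s, y)\<bar> \<le> a s"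
    and supp: "\<And>s y. s \<le> norm (x - y) \<Longrightarrow> f (s, y) = 0" and a0: "\<And>s. 0 < s \<Longrightarrow> 0 \<le> a s"
  shows "(\<integral>\<^sup>+p. ennreal \<bar>f p\<bar> \<partial>P) \<le> (\<integral>\<^sup>+s. indicator {\<sigma>..\<rho>} s * ennreal (2 ^ CARD('n) * a s / s ^ 7) \<partial>lborel)"
proof -
  have "(\<integral>\<^sup>+p. ennreal \<bar>f p\<bar> \<partial>P) = (\<integral>\<^sup>+s. indicator {\<sigma>..\<rho>} s * (\<integral>\<^sup>+y. indicator Z y * (ennreal (1 / s ^ (CARD('n) + 7)) * ennreal \<bar>f (s, y)\<bar>) \<partial>lborel) \<partial>lborel)"
    by (rule nn_P) measurable
  also have "\<dots> \<le> (\<integral>\<^sup>+s. indicator {\<sigma>..\<rho>} s * ennreal (2 ^ CARD('n) * a s / s ^ 7) \<partial>lborel)"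
  proof (intro nn_integral_mono)
    fix s :: real
    show "indicator {\<sigma>..\<rho>} s * (\<integral>\<^sup>+y. indicator Z y * (ennreal (1 / s ^ (CARD('n) + 7)) * ennreal \<bar>f (s, y)\<bar>) \<partial>lborel)
      \<le> indicator {\<sigma>..\<rho>} s * ennreal (2 ^ CARD('n) * a s / s ^ 7)"
    proof (cases "s \<in> {\<sigma>..\<rho>}")
      case True
      then have s: "0 < s" "\<sigma> \<le> s" "s \<le> \<rho>" using \<sigma> by auto
      have "(\<integral>\<^sup>+y. indicator Z y * (ennreal (1 / s ^ (CARD('n) + 7)) * ennreal \<bar>f (s, y)\<bar>) \<partial>lborel)
        \<le> (\<integral>\<^sup>+y. ennreal (a s / s ^ (CARD('n) + 7)) * indicator (ball x s) y \<partial>lborel)"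
      proof (intro nn_integral_mono)
        fix y
        show "indicator Z y * (ennreal (1 / s ^ (CARD('n) + 7)) * ennreal \<bar>f (s, y)\<bar>)
          \<le> ennreal (a s / s ^ (CARD('n) + 7)) * indicator (ball x s) y"
        proof (cases "y \<in> Z \<and> norm (x - y) < s")
          case True
          then have "\<bar>f (s, y)\<bar> / s ^ (CARD('n) + 7) \<le> a s / s ^ (CARD('n) + 7)"
            using s bd by (intro divide_right_mono) auto
          then show ?thesis using True s by (simp add: ennreal_mult[symmetric] dist_norm ennreal_leI)
        next
          case False
          then show ?thesis using supp[of s y] by (auto simp: not_less)
        qed
      qed
      also have "\<dots> = ennreal (a s / s ^ (CARD('n) + 7)) * emeasure lborel (ball x s)" by (simp add: nn_integral_cmult_indicator)
      also have "\<dots> \<le> ennreal (a s / s ^ (CARD('n) + 7)) * ennreal ((2 * s) ^ CARD('n))"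
        using s by (intro mult_left_mono emeasure_ball_le) auto
      also have "\<dots> = ennreal (2 ^ CARD('n) * a s / s ^ 7)"
        using s a0[of s] by (simp add: ennreal_mult[symmetric] power_add power_mult_distrib field_simps)
      finally show ?thesis using True by simp
    qed simp
  qed
  finally show ?thesis .
qed

lemma integral_P_bound:
  assumes "integrable P f" "(\<integral>\<^sup>+p. ennreal \<bar>f p\<bar> \<partial>P) \<le> ennreal B" "0 \<le> B"
  shows "\<bar>\<integral>p. f p \<partial>P\<bar> \<le> B"
proof -
  have "ennreal (norm (\<integral>p. f p \<partial>P)) \<le> (\<integral>\<^sup>+p. ennreal (norm (f p)) \<partial>P)"
    by (rule integral_norm_bound_ennreal[OF assms(1)])
  also have "\<dots> \<le> ennreal B" using assms(2) by simp
  finally show ?thesis using assms(3) by simp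
qed

text \<open>By scaling every \<open>s\<close> contributes at most \<open>8 * 2 ^ CARD('n)\<close>,
  hence a total of order \<rho>. For \<open>hess\<close> the same count gives the integral of
  \<open>1/s\<close>, a logarithm of \<rho>/\<sigma>; this is why the Hessian is estimated through
  oscillation and L^2 norm.\<close>

lemma grad_bound: "\<bar>grad i x\<bar> \<le> 8 * 2 ^ CARD('n) * \<rho>"
  unfolding grad_def
proof (rule integral_P_bound[OF K_integrable(2)])
  have "(\<integral>\<^sup>+p. ennreal \<bar>K1 i p x\<bar> \<partial>P) \<le> (\<integral>\<^sup>+s. indicator {\<sigma>..\<rho>} s * ennreal (2 ^ CARD('n) * (8 * s ^ 7) / s ^ 7) \<partial>lborel)"
  proof (rule nn_kernel_bound)
    fix s :: real and y assume "\<sigma> \<le> s" "s \<le> \<rho>" "y \<in> Z"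
    then show "\<bar>K1 i (s, y) x\<bar> \<le> 8 * s ^ 7" using bump1_bound[of s i "x - y"] \<sigma> by (simp add: K1_def)
  next
    fix s y assume "s \<le> norm (x - y)"
    then show "K1 i (s, y) x = 0" using bump_kernels_eq_0(1)[of s "x - y" i] \<sigma> by (auto simp: K1_def indicator_def)
  qed auto
  also have "\<dots> = (\<integral>\<^sup>+s. ennreal (8 * 2 ^ CARD('n)) * indicator {\<sigma>..\<rho>} s \<partial>lborel)"
    using \<sigma> by (intro nn_integral_cong) (auto simp: indicator_def)
  also have "\<dots> = ennreal (8 * 2 ^ CARD('n)) * ennreal (\<rho> - \<sigma>)" using \<sigma>\<rho> by (simp add: nn_integral_cmult)
  also have "\<dots> \<le> ennreal (8 * 2 ^ CARD('n) * \<rho>)"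
    using \<sigma> \<sigma>\<rho> by (subst ennreal_mult[symmetric]) (auto intro!: ennreal_leI)
  finally show "(\<integral>\<^sup>+p. ennreal \<bar>K1 i p x\<bar> \<partial>P) \<le> ennreal (8 * 2 ^ CARD('n) * \<rho>)" .
qed (use \<sigma> \<sigma>\<rho> in auto)

lemma nn_inverse_square:
  assumes "0 < r" "0 \<le> c"
  shows "(\<integral>\<^sup>+s. indicator {\<sigma>..\<rho>} s * ennreal (if r \<le> s then c / s\<^sup>2 else 0) \<partial>lborel) \<le> ennreal (c / r)"
proof -
  define t where "t = max r \<rho>"
  have "(\<integral>\<^sup>+s. indicator {\<sigma>..\<rho>} s * ennreal (if r \<le> s then c / s\<^sup>2 else 0) \<partial>lborel)
    \<le> (\<integral>\<^sup>+s. ennreal (c / s\<^sup>2) * indicator {r..t} s \<partial>lborel)"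
    by (intro nn_integral_mono) (auto simp: indicator_def t_def)
  also have "\<dots> = ennreal (- c / t - (- c / r))"
  proof (rule nn_integral_FTC_Icc[where F="\<lambda>s. - c / s" and f="\<lambda>s. c / s\<^sup>2"])
    fix s :: real assume s: "s \<in> {r..t}"
    then show "((\<lambda>s. - c / s) has_real_derivative c / s\<^sup>2) (at s)"
      using assms by (auto intro!: derivative_eq_intros simp: power2_eq_square)
  qed (use assms in \<open>auto simp: t_def\<close>)
  also have "\<dots> \<le> ennreal (c / r)"
    using assms by (intro ennreal_leI) (auto simp: t_def)
  finally show ?thesis .
qed

text \<open>Scales below \<open>r\<close> contribute nothing: either their balls reach
  \<open>Z\<close> from neither point, or they lie below \<sigma>. At a larger scale the Lipschitz
  bound on \<open>bump2\<close> contributes a multiple of \<open>norm (x - x') / s^2\<close>, whose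
  integral from \<open>r\<close> on converges, so no logarithm appears.\<close>

lemma hess_osc:
  assumes r: "0 < r" and far: "(\<forall>y\<in>Z. r \<le> norm (x - y) \<and> r \<le> norm (x' - y)) \<or> r \<le> \<sigma>"
  shows "\<bar>hess i j x - hess i j x'\<bar> \<le> 672 * 2 ^ CARD('n) * norm (x - x') / r"
proof -
  define d where "d = norm (x - x')"
  define a where "a s = (if r \<le> s then 336 * s ^ 5 * d else 0)" for s
  have [measurable]: "a \<in> borel_measurable borel" unfolding a_def by measurable
  have a0: "0 < s \<Longrightarrow> 0 \<le> a s" for s unfolding a_def d_def by auto
  \<comment> \<open>The part of the difference coming from the ball about \<open>w\<close>. A
    parameter seen from \<open>x\<close> or from \<open>x'\<close> is counted once or twice, which
    doubles 336 to 672.\<close>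
  define f where "f w = (\<lambda>p. (if norm (w - snd p) < fst p then 1 else 0) * (K2 i j p x - K2 i j p x'))" for w
  have [measurable]: "f w \<in> borel_measurable borel" for w unfolding f_def by measurable
  have main: "(\<integral>\<^sup>+p. ennreal \<bar>f w p\<bar> \<partial>P) \<le> ennreal (336 * 2 ^ CARD('n) * d / r)" if w: "w = x \<or> w = x'" for w
  proof -
    have "(\<integral>\<^sup>+p. ennreal \<bar>f w p\<bar> \<partial>P) \<le> (\<integral>\<^sup>+s. indicator {\<sigma>..\<rho>} s * ennreal (2 ^ CARD('n) * a s / s ^ 7) \<partial>lborel)"
    proof (rule nn_kernel_bound)
      fix s y assume s: "\<sigma> \<le> s" "s \<le> \<rho>" and y: "y \<in> Z"
      show "\<bar>f w (s, y)\<bar> \<le> a s"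
      proof (cases "r \<le> s")
        case True
        have "\<bar>K2 i j (s, y) x - K2 i j (s, y) x'\<bar> \<le> 336 * s ^ 5 * d"
          using bump2_lipschitz[of s i j "x - y" "x' - y"] s y \<sigma> by (simp add: K2_def d_def)
        then show ?thesis using True a0[of s] s \<sigma> by (simp add: f_def a_def)
      next
        case False
        then have "r \<le> norm (w - y)" using far w y s by auto
        then show ?thesis using False by (simp add: f_def a_def)
      qed
    next
      fix s y assume "s \<le> norm (w - y)"
      then show "f w (s, y) = 0" by (simp add: f_def)
    qed (use a0 in auto)
    also have "\<dots> \<le> (\<integral>\<^sup>+s. indicator {\<sigma>..\<rho>} s * ennreal (if r \<le> s then 336 * 2 ^ CARD('n) * d / s\<^sup>2 else 0) \<partial>lborel)"
    proof (intro nn_integral_mono mult_left_mono ennreal_leI)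
      fix s :: real
      show "2 ^ CARD('n) * a s / s ^ 7 \<le> (if r \<le> s then 336 * 2 ^ CARD('n) * d / s\<^sup>2 else 0)"
        using r by (auto simp: a_def field_simps eval_nat_numeral)
    qed simp
    also have "\<dots> \<le> ennreal (336 * 2 ^ CARD('n) * d / r)"
      using r by (intro nn_inverse_square) (auto simp: d_def)
    finally show ?thesis .
  qed
  have "\<bar>\<integral>p. K2 i j p x - K2 i j p x' \<partial>P\<bar> \<le> 672 * 2 ^ CARD('n) * d / r"
  proof (rule integral_P_bound)
    have "(\<integral>\<^sup>+p. ennreal \<bar>K2 i j p x - K2 i j p x'\<bar> \<partial>P) \<le> (\<integral>\<^sup>+p. ennreal \<bar>f x p\<bar> + ennreal \<bar>f x' p\<bar> \<partial>P)"
    proof (intro nn_integral_mono)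
      fix p
      have "\<bar>K2 i j p x - K2 i j p x'\<bar> \<le> \<bar>f x p\<bar> + \<bar>f x' p\<bar>"
      proof (cases "norm (x - snd p) < fst p \<or> norm (x' - snd p) < fst p")
        case False
        then have "K2 i j p x = 0 \<and> K2 i j p x' = 0"
          using bump_kernels_eq_0(2)[of "fst p" "x - snd p"] bump_kernels_eq_0(2)[of "fst p" "x' - snd p"] \<sigma>
          by (auto simp: K2_def indicator_def)
        then show ?thesis by (simp add: f_def)
      qed (auto simp: f_def)
      then show "ennreal \<bar>K2 i j p x - K2 i j p x'\<bar> \<le> ennreal \<bar>f x p\<bar> + ennreal \<bar>f x' p\<bar>"
        by (simp add: ennreal_leI flip: ennreal_plus)
    qed
    also have "\<dots> = (\<integral>\<^sup>+p. ennreal \<bar>f x p\<bar> \<partial>P) + (\<integral>\<^sup>+p. ennreal \<bar>f x' p\<bar> \<partial>P)" by (intro nn_integral_add) auto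
    also have "\<dots> \<le> ennreal (336 * 2 ^ CARD('n) * d / r) + ennreal (336 * 2 ^ CARD('n) * d / r)"
      by (intro add_mono main) auto
    also have "\<dots> = ennreal (672 * 2 ^ CARD('n) * d / r)"
      using r by (subst ennreal_plus[symmetric]) (auto simp: d_def)
    finally show "(\<integral>\<^sup>+p. ennreal \<bar>K2 i j p x - K2 i j p x'\<bar> \<partial>P) \<le> ennreal (672 * 2 ^ CARD('n) * d / r)" .
  qed (use K_integrable r in \<open>auto simp: d_def\<close>)
  then show ?thesis unfolding hess_def d_def using K_integrable by simp
qed

lemma field_support:
  assumes "\<And>y. y \<in> Z \<Longrightarrow> \<rho> \<le> norm (x - y)"
  shows "K2 i j p x = 0" "K1 i p x = 0" "hess i j x = 0" "grad i x = 0"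
proof -
  show 1: "K2 i j p x = 0" for p
    using assms[of "snd p"] bump_kernels_eq_0(2)[of "fst p" "x - snd p" i j] \<sigma> by (auto simp: K2_def indicator_def)
  show 2: "K1 i p x = 0" for p
    using assms[of "snd p"] bump_kernels_eq_0(1)[of "fst p" "x - snd p" i] \<sigma> by (auto simp: K1_def indicator_def)
  show "hess i j x = 0" "grad i x = 0" by (simp_all add: hess_def grad_def 1 2)
qed

end

text \<open>The map \<open>g\<close> stands for \<open>x - y\<close> as a function of either
  variable, so one estimate serves both the supremum and the integral of a mollified
  indicator.\<close>

lemma nn_mollifier:
  fixes z :: "real^'n"
  assumes s: "0 < s" and z: "(\<And>y. norm (z - y) = norm (g y))"
    and [measurable]: "g \<in> borel_measurable borel"
  shows "(\<integral>\<^sup>+y. ennreal (mollifier s (g y :: real^'n)) \<partial>lborel) \<le> ennreal (8 * 2 ^ CARD('n))"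
proof -
  have "(\<integral>\<^sup>+y. ennreal (mollifier s (g y)) \<partial>lborel) \<le> (\<integral>\<^sup>+y. ennreal (8 / s ^ CARD('n)) * indicator (ball z s) y \<partial>lborel)"
  proof (intro nn_integral_mono)
    fix y
    show "ennreal (mollifier s (g y)) \<le> ennreal (8 / s ^ CARD('n)) * indicator (ball z s) y"
    proof (cases "norm (g y) < s")
      case True
      then show ?thesis using z[of y] mollifier_bound[OF s, of "g y"] by (simp add: dist_norm ennreal_leI)
    next
      case False
      then show ?thesis using bump_kernels_eq_0(4)[of s "g y"] s by simp
    qed
  qed
  also have "\<dots> = ennreal (8 / s ^ CARD('n)) * emeasure lborel (ball z s)" by (simp add: nn_integral_cmult_indicator)
  also have "\<dots> \<le> ennreal (8 / s ^ CARD('n)) * ennreal ((2 * s) ^ CARD('n))"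
    using s by (intro mult_left_mono emeasure_ball_le) auto
  also have "\<dots> = ennreal (8 * 2 ^ CARD('n))"
    using s by (simp add: ennreal_mult[symmetric] power_mult_distrib)
  finally show ?thesis .
qed

section \<open>The mollified indicator and the L^2 bound on the Hessian\<close>

context kernel_field
begin

lemma mollifier_integrable:
  assumes s: "0 < s"
  shows "integrable lborel (\<lambda>y. indicator Z y * mollifier s (x - y))"
proof (rule Bochner_Integration.integrable_bound[where f="\<lambda>y. indicator Z y * (8 / s ^ CARD('n))"])
  show "integrable lborel (\<lambda>y. indicator Z y * (8 / s ^ CARD('n)))"
    using emeasure_Z by (intro integrable_mult_left integrable_real_indicator) auto
  show "AE y in lborel. norm (indicator Z y * mollifier s (x - y)) \<le> norm (indicator Z y * (8 / s ^ CARD('n)))"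
  proof (rule AE_I2)
    fix y
    show "norm (indicator Z y * mollifier s (x - y)) \<le> norm (indicator Z y * (8 / s ^ CARD('n)))"
      using mollifier_bound[OF s, of "x - y"] mollifier_nonneg[OF s, of "x - y"] s by (auto simp: indicator_def)
  qed
qed measurable

lemma conv_nn: "0 < s \<Longrightarrow> ennreal (conv s x) = (\<integral>\<^sup>+y. ennreal (indicator Z y * mollifier s (x - y)) \<partial>lborel)"
  unfolding conv_def
  by (intro nn_integral_eq_integral[symmetric] mollifier_integrable AE_I2) (auto simp: mollifier_nonneg)

lemma conv_measurable [measurable]: "conv s \<in> borel_measurable borel"
proof -
  have "(\<lambda>(x, y). indicator Z y * mollifier s (x - y)) \<in> borel_measurable (borel \<Otimes>\<^sub>M (lborel :: (real^'n) measure))"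
    by measurable
  then show ?thesis unfolding conv_def[abs_def] by (rule lborel.borel_measurable_lebesgue_integral)
qed

lemma conv_nonneg: "0 < s \<Longrightarrow> 0 \<le> conv s x"
  unfolding conv_def by (intro Bochner_Integration.integral_nonneg) (auto simp: mollifier_nonneg)

lemma conv_le: assumes s: "0 < s" shows "conv s x \<le> 8 * 2 ^ CARD('n)"
proof -
  have "ennreal (conv s x) \<le> (\<integral>\<^sup>+y. ennreal (mollifier s (x - y)) \<partial>lborel)"
    unfolding conv_nn[OF s] using s by (intro nn_integral_mono ennreal_leI) (auto simp: indicator_def mollifier_nonneg)
  also have "\<dots> \<le> ennreal (8 * 2 ^ CARD('n))" by (rule nn_mollifier[OF s, where z=x]) auto
  finally show ?thesis by simp
qed

lemma conv_nn_integral: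
  assumes s: "0 < s"
  shows "(\<integral>\<^sup>+x. ennreal (conv s x) \<partial>lborel) \<le> ennreal (8 * 2 ^ CARD('n) * measure lborel Z)"
proof -
  have "(\<integral>\<^sup>+x. ennreal (conv s x) \<partial>lborel) = (\<integral>\<^sup>+x. \<integral>\<^sup>+y. indicator Z y * ennreal (mollifier s (x - y)) \<partial>lborel \<partial>lborel)"
    unfolding conv_nn[OF s] by (intro nn_integral_cong) (auto simp: indicator_def)
  also have "\<dots> = (\<integral>\<^sup>+y. \<integral>\<^sup>+x. indicator Z y * ennreal (mollifier s (x - y)) \<partial>lborel \<partial>lborel)"
    by (rule lborel_pair.Fubini') measurable
  also have "\<dots> = (\<integral>\<^sup>+y. indicator Z y * (\<integral>\<^sup>+x. ennreal (mollifier s (x - y)) \<partial>lborel) \<partial>lborel)"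
    by (intro nn_integral_cong nn_integral_cmult) measurable
  also have "\<dots> \<le> (\<integral>\<^sup>+y. indicator Z y * ennreal (8 * 2 ^ CARD('n)) \<partial>lborel)"
  proof (intro nn_integral_mono mult_left_mono)
    fix y :: "real^'n"
    show "(\<integral>\<^sup>+x. ennreal (mollifier s (x - y)) \<partial>lborel) \<le> ennreal (8 * 2 ^ CARD('n))"
      by (rule nn_mollifier[OF s, where z=y]) (auto simp: norm_minus_commute)
  qed simp
  also have "\<dots> = ennreal (8 * 2 ^ CARD('n)) * emeasure lborel Z" by (simp add: nn_integral_multc mult.commute)
  also have "emeasure lborel Z = ennreal (measure lborel Z)"
    using emeasure_Z by (intro emeasure_eq_ennreal_measure) auto
  finally show ?thesis by (simp add: ennreal_mult[symmetric])
qed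

lemma conv_integrable: assumes s: "0 < s" shows "integrable lborel (conv s)"
proof (rule integrableI_bounded)
  have "(\<integral>\<^sup>+x. ennreal (norm (conv s x)) \<partial>lborel) = (\<integral>\<^sup>+x. ennreal (conv s x) \<partial>lborel)"
    using conv_nonneg[OF s] by simp
  also have "\<dots> < \<infinity>" using conv_nn_integral[OF s] by (simp add: le_less_trans)
  finally show "(\<integral>\<^sup>+x. ennreal (norm (conv s x)) \<partial>lborel) < \<infinity>" .
qed simp

lemma conv_integral: assumes s: "0 < s" shows "(\<integral>x. conv s x \<partial>lborel) \<le> 8 * 2 ^ CARD('n) * measure lborel Z"
proof -
  have "ennreal (\<integral>x. conv s x \<partial>lborel) = (\<integral>\<^sup>+x. ennreal (conv s x) \<partial>lborel)"
    by (intro nn_integral_eq_integral[symmetric] conv_integrable s AE_I2 conv_nonneg)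
  then have "ennreal (\<integral>x. conv s x \<partial>lborel) \<le> ennreal (8 * 2 ^ CARD('n) * measure lborel Z)"
    using conv_nn_integral[OF s] by simp
  then show ?thesis by (simp add: ennreal_le_iff)
qed

text \<open>The \<open>s\<close>-integral telescopes.\<close>

lemma trace_hess: "(\<Sum>i\<in>UNIV. hess i i x) = conv \<rho> x - conv \<sigma> x"
proof -
  let ?m = "CARD('n) + 7"
  define w where "w p = indicator ({\<sigma>..\<rho>} \<times> Z) p / fst p ^ ?m" for p :: "real \<times> (real^'n)"
  have [measurable]: "w \<in> borel_measurable borel" unfolding w_def by measurable
  have w0: "0 \<le> w p" for p using \<sigma> by (cases p) (auto simp: w_def indicator_def)
  define f where "f p = (\<Sum>i\<in>UNIV. K2 i i p x)" for p
  have [measurable]: "f \<in> borel_measurable borel" unfolding f_def by measurable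
  have fi: "integrable P f" unfolding f_def by (intro Bochner_Integration.integrable_sum K_integrable)
  have P: "P = density lborel (\<lambda>p. ennreal (w p))" unfolding P_def w_def ..
  have wf: "integrable lborel (\<lambda>p. w p * f p)"
    using fi integrable_density[of f lborel w] w0 unfolding P by simp
  define g where "g s y = (\<Sum>i\<in>UNIV. bump2 i i s (x - y)) / s ^ ?m" for s y
  have wfg: "w (s, y) * f (s, y) = indicator Z y * (g s y * indicator {\<sigma>..\<rho>} s)" for s y
    by (auto simp: w_def f_def K2_def g_def indicator_def)
  have "(\<Sum>i\<in>UNIV. hess i i x) = (\<integral>p. f p \<partial>P)"
    unfolding hess_def f_def by (intro Bochner_Integration.integral_sum[symmetric] K_integrable)
  also have "\<dots> = (\<integral>p. w p * f p \<partial>lborel)"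
    unfolding P using w0 by (subst integral_density) auto
  also have "\<dots> = (\<integral>p. w p * f p \<partial>(lborel \<Otimes>\<^sub>M lborel))" by (simp only: lborel_prod)
  also have "\<dots> = (\<integral>y. \<integral>s. w (s, y) * f (s, y) \<partial>lborel \<partial>lborel)"
    using lborel_pair.integral_snd[of "\<lambda>s y. w (s, y) * f (s, y)"] wf by (simp add: lborel_prod case_prod_unfold)
  also have "\<dots> = (\<integral>y. indicator Z y * mollifier \<rho> (x - y) - indicator Z y * mollifier \<sigma> (x - y) \<partial>lborel)"
  proof (intro Bochner_Integration.integral_cong refl)
    fix y :: "real^'n"
    have "(\<integral>s. g s y * indicator {\<sigma>..\<rho>} s \<partial>lborel) = mollifier \<rho> (x - y) - mollifier \<sigma> (x - y)"
    proof (rule integral_FTC_Icc_real[where F="\<lambda>s. mollifier s (x - y)"])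
      fix s assume s: "\<sigma> \<le> s" "s \<le> \<rho>"
      then show "((\<lambda>s. mollifier s (x - y)) has_real_derivative g s y) (at s)"
        unfolding g_def using \<sigma> by (intro mollifier_deriv) auto
      show "isCont (\<lambda>s. g s y) s"
      proof -
        have "continuous_on {0<..} (\<lambda>s. g s y)" unfolding g_def by (intro continuous_intros) auto
        then show ?thesis using s \<sigma> by (simp add: continuous_on_eq_continuous_at)
      qed
    qed (rule \<sigma>\<rho>)
    then show "(\<integral>s. w (s, y) * f (s, y) \<partial>lborel) = indicator Z y * mollifier \<rho> (x - y) - indicator Z y * mollifier \<sigma> (x - y)"
      unfolding wfg by (simp add: right_diff_distrib)
  qed
  also have "\<dots> = conv \<rho> x - conv \<sigma> x"
    unfolding conv_def using \<sigma> \<sigma>\<rho> by (intro Bochner_Integration.integral_diff mollifier_integrable) auto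
  finally show ?thesis .
qed

text \<open>All fields vanish outside the ball \<open>W\<close>, so Lebesgue measure may be
  restricted to it and the integrals are exchanged between finite measures.\<close>

lemma hess_product:
  "(\<integral>x. hess i j x * hess k l x \<partial>lborel) = (\<integral>p. \<integral>q. (\<integral>x. K2 i j p x * K2 k l q x \<partial>lborel) \<partial>P \<partial>P)"
  "integrable lborel (\<lambda>x. hess i j x * hess k l x)"
proof -
  obtain R where R: "\<And>y. y \<in> Z \<Longrightarrow> norm y \<le> R" using bZ by (auto simp: bounded_iff)
  define W where "W = cball (0 :: real^'n) (R + \<rho>)"
  have [measurable]: "W \<in> sets borel" by (simp add: W_def)
  have Wf: "emeasure lborel W < \<infinity>" unfolding W_def using emeasure_bounded_finite[of "cball (0::real^'n) (R + \<rho>)"] by simp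
  have supp: "K2 i j p x = 0" "hess i j x = 0" if "x \<notin> W" for i j p x
  proof -
    have far: "\<rho> \<le> norm (x - y)" if y: "y \<in> Z" for y
      using \<open>x \<notin> W\<close> R[OF y] norm_triangle_sub[of x y] by (auto simp: W_def)
    show "K2 i j p x = 0" by (rule field_support(1)[OF far])
    show "hess i j x = 0" by (rule field_support(3)[OF far])
  qed
  define U where "U = density lborel (indicator W)"
  have setsU [measurable_cong, simp]: "sets U = sets borel" by (simp add: U_def)
  have finU: "finite_measure U"
  proof
    have "emeasure U (space U) = emeasure lborel W" unfolding U_def by (simp add: emeasure_density)
    then show "emeasure U (space U) \<noteq> \<infinity>" using Wf by simp
  qed
  interpret U: finite_measure U by (rule finU)
  have U: "(\<integral>x. F x \<partial>lborel) = (\<integral>x. F x \<partial>U)" if [measurable]: "F \<in> borel_measurable borel" and "\<And>x. x \<notin> W \<Longrightarrow> F x = 0" for F :: "real^'n \<Rightarrow> real"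
  proof -
    have "(\<integral>x. F x \<partial>U) = (\<integral>x. indicator W x * F x \<partial>lborel)"
      unfolding U_def ennreal_indicator[symmetric] by (subst integral_density) auto
    also have "\<dots> = (\<integral>x. F x \<partial>lborel)"
      by (intro Bochner_Integration.integral_cong refl) (use that in \<open>auto simp: indicator_def\<close>)
    finally show ?thesis by simp
  qed
  define B where "B = 56 * \<rho> ^ 6"
  define C where "C = B * measure P UNIV"
  have KB: "\<bar>K2 i j p x\<bar> \<le> B" for i j p x unfolding B_def by (rule K_bound)
  have HC: "\<bar>hess i j x\<bar> \<le> C" for i j x unfolding C_def B_def by (rule hess_bounded)
  have B0: "0 \<le> B" using KB[of undefined undefined undefined undefined] by linarith
  have C0: "0 \<le> C" using HC[of undefined undefined undefined] by linarith
  have "(\<integral>x. hess i j x * hess k l x \<partial>lborel) = (\<integral>x. hess i j x * hess k l x \<partial>U)"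
    by (rule U) (auto simp: supp)
  also have "\<dots> = (\<integral>x. \<integral>p. K2 i j p x * hess k l x \<partial>P \<partial>U)"
    unfolding hess_def[of i j] using K_integrable by simp
  also have "\<dots> = (\<integral>p. \<integral>x. K2 i j p x * hess k l x \<partial>U \<partial>P)"
  proof (rule finite_Fubini[OF finU finite_P, where C="B * C"])
    show "(\<lambda>(x, p). K2 i j p x * hess k l x) \<in> borel_measurable (U \<Otimes>\<^sub>M P)" unfolding K2_def by measurable
    show "\<bar>K2 i j p x * hess k l x\<bar> \<le> B * C" for x p
      unfolding abs_mult using KB HC B0 by (intro mult_mono) auto
  qed
  also have "\<dots> = (\<integral>p. \<integral>x. \<integral>q. K2 i j p x * K2 k l q x \<partial>P \<partial>U \<partial>P)"
    unfolding hess_def[of k l] using K_integrable by simp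
  also have "\<dots> = (\<integral>p. \<integral>q. \<integral>x. K2 i j p x * K2 k l q x \<partial>U \<partial>P \<partial>P)"
  proof (intro Bochner_Integration.integral_cong refl)
    fix p
    show "(\<integral>x. \<integral>q. K2 i j p x * K2 k l q x \<partial>P \<partial>U) = (\<integral>q. \<integral>x. K2 i j p x * K2 k l q x \<partial>U \<partial>P)"
    proof (rule finite_Fubini[OF finU finite_P, where C="B * B"])
      show "(\<lambda>(x, q). K2 i j p x * K2 k l q x) \<in> borel_measurable (U \<Otimes>\<^sub>M P)" unfolding K2_def by measurable
      show "\<bar>K2 i j p x * K2 k l q x\<bar> \<le> B * B" for x q
        unfolding abs_mult using KB B0 by (intro mult_mono) auto
    qed
  qed
  also have "\<dots> = (\<integral>p. \<integral>q. (\<integral>x. K2 i j p x * K2 k l q x \<partial>lborel) \<partial>P \<partial>P)"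
    by (intro Bochner_Integration.integral_cong refl U[symmetric]) (auto simp: supp)
  finally show "(\<integral>x. hess i j x * hess k l x \<partial>lborel) = (\<integral>p. \<integral>q. (\<integral>x. K2 i j p x * K2 k l q x \<partial>lborel) \<partial>P \<partial>P)" .
  show "integrable lborel (\<lambda>x. hess i j x * hess k l x)"
  proof (rule Bochner_Integration.integrable_bound[where f="\<lambda>x. indicator W x * (C * C)"])
    show "integrable lborel (\<lambda>x. indicator W x * (C * C))"
      using Wf by (intro integrable_mult_left integrable_real_indicator) auto
    show "AE x in lborel. norm (hess i j x * hess k l x) \<le> norm (indicator W x * (C * C))"
    proof (rule AE_I2)
      fix x
      have "\<bar>hess i j x\<bar> * \<bar>hess k l x\<bar> \<le> C * C" using HC C0 by (intro mult_mono) auto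
      then show "norm (hess i j x * hess k l x) \<le> norm (indicator W x * (C * C))"
        using C0 by (cases "x \<in> W") (auto simp: abs_mult supp)
    qed
  qed simp
qed

text \<open>The integration by parts takes place for each pair of kernels; the superpositions
  themselves are never differentiated.\<close>

lemma hess_swap: "(\<integral>x. hess i j x * hess i j x \<partial>lborel) = (\<integral>x. hess i i x * hess j j x \<partial>lborel)"
  unfolding hess_product(1)
proof (rule Bochner_Integration.integral_cong[OF refl], rule Bochner_Integration.integral_cong[OF refl])
  fix p q
  let ?c = "indicator {\<sigma>..\<rho>} (fst p) * indicator Z (snd p) * (indicator {\<sigma>..\<rho>} (fst q) * indicator Z (snd q)) :: real"
  have eq: "K2 i j p x * K2 k l q x = ?c * (bump2 i j (fst p) (x - snd p) * bump2 k l (fst q) (x - snd q))" for i j k l x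
    by (simp add: K2_def)
  have "?c = 0 \<or> 0 < fst p \<and> 0 < fst q" using \<sigma> by (auto simp: indicator_def)
  then show "(\<integral>x. K2 i j p x * K2 i j q x \<partial>lborel) = (\<integral>x. K2 i i p x * K2 j j q x \<partial>lborel)"
  proof
    assume "?c = 0" then show ?thesis unfolding eq by (simp only: mult_zero_left)
  next
    assume "0 < fst p \<and> 0 < fst q"
    then show ?thesis unfolding eq using bump2_integral_swap[of "fst p" "fst q" i j "snd p" "snd q"] by simp
  qed
qed

text \<open>The squared Hessian integrates to the squared Laplacian, and the Laplacian is
  \<open>conv \<rho> - conv \<sigma>\<close>, which is bounded and has L^1 norm of order the volume
  of \<open>Z\<close>. Bounding one factor uniformly leaves an integral linear in that
  volume.\<close>

lemma hess_L2: "(\<Sum>i\<in>UNIV. \<Sum>j\<in>UNIV. \<integral>x. (hess i j x)\<^sup>2 \<partial>lborel) \<le> 2 * (8 * 2 ^ CARD('n))\<^sup>2 * measure lborel Z"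
proof -
  let ?c = "8 * 2 ^ CARD('n) :: real"
  have \<rho>: "0 < \<rho>" using \<sigma> \<sigma>\<rho> by simp
  have "(\<Sum>i\<in>UNIV. \<Sum>j\<in>UNIV. \<integral>x. (hess i j x)\<^sup>2 \<partial>lborel) = (\<Sum>i\<in>UNIV. \<Sum>j\<in>UNIV. \<integral>x. hess i i x * hess j j x \<partial>lborel)"
    unfolding power2_eq_square hess_swap ..
  also have "\<dots> = (\<integral>x. (\<Sum>i\<in>UNIV. \<Sum>j\<in>UNIV. hess i i x * hess j j x) \<partial>lborel)"
    using hess_product(2) by simp
  also have "\<dots> = (\<integral>x. (conv \<rho> x - conv \<sigma> x)\<^sup>2 \<partial>lborel)"
    by (simp add: sum_product[symmetric] trace_hess power2_eq_square)
  also have "\<dots> \<le> (\<integral>x. ?c * (conv \<rho> x + conv \<sigma> x) \<partial>lborel)"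
  proof (rule integral_mono_AE')
    show "integrable lborel (\<lambda>x. ?c * (conv \<rho> x + conv \<sigma> x))"
      using conv_integrable[OF \<rho>] conv_integrable[OF \<sigma>] by auto
    show "AE x in lborel. (conv \<rho> x - conv \<sigma> x)\<^sup>2 \<le> ?c * (conv \<rho> x + conv \<sigma> x)"
    proof (rule AE_I2)
      fix x
      have "0 \<le> conv \<rho> x" "0 \<le> conv \<sigma> x" "conv \<rho> x \<le> ?c" "conv \<sigma> x \<le> ?c"
        using conv_nonneg conv_le \<rho> \<sigma> by auto
      then have "\<bar>conv \<rho> x - conv \<sigma> x\<bar> * \<bar>conv \<rho> x - conv \<sigma> x\<bar> \<le> ?c * (conv \<rho> x + conv \<sigma> x)"
        by (intro mult_mono) auto
      then show "(conv \<rho> x - conv \<sigma> x)\<^sup>2 \<le> ?c * (conv \<rho> x + conv \<sigma> x)"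
        by (simp add: power2_eq_square)
    qed
    show "AE x in lborel. 0 \<le> ?c * (conv \<rho> x + conv \<sigma> x)"
      using conv_nonneg[OF \<rho>] conv_nonneg[OF \<sigma>] by (intro AE_I2 mult_nonneg_nonneg add_nonneg_nonneg) auto
  qed
  also have "\<dots> = ?c * ((\<integral>x. conv \<rho> x \<partial>lborel) + (\<integral>x. conv \<sigma> x \<partial>lborel))"
    using conv_integrable[OF \<rho>] conv_integrable[OF \<sigma>] by simp
  also have "\<dots> \<le> ?c * (?c * measure lborel Z + ?c * measure lborel Z)"
    using conv_integral[OF \<rho>] conv_integral[OF \<sigma>] by (intro mult_left_mono add_mono) auto
  finally show ?thesis by (simp add: power2_eq_square algebra_simps)
qed

lemma conv_eq_0: "0 < s \<Longrightarrow> (\<And>y. y \<in> Z \<Longrightarrow> s \<le> norm (x - y)) \<Longrightarrow> conv s x = 0"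
  unfolding conv_def by (intro integral_eq_zero_AE AE_I2) (auto simp: indicator_def intro!: bump_kernels_eq_0(4))

text \<open>Within distance \<open>s / 2\<close> the bump is at least three quarters of
  \<open>s^2\<close>, and \<open>8 * (3/4)^3 = 27/8\<close>.\<close>

lemma conv_lower:
  assumes s: "0 < s" and near: "\<And>y. y \<in> Z \<Longrightarrow> norm (x - y) \<le> s / 2"
  shows "(27/8) / s ^ CARD('n) * measure lborel Z \<le> conv s x"
proof -
  have low: "(27/8) / s ^ CARD('n) \<le> mollifier s (x - y)" if y: "y \<in> Z" for y
  proof -
    have "(norm (x - y))\<^sup>2 \<le> (s / 2)\<^sup>2" using near[OF y] by (intro power_mono) auto
    then have "(3/4) * s\<^sup>2 \<le> s\<^sup>2 - (norm (x - y))\<^sup>2" by (simp add: power_divide)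
    also have "\<dots> \<le> bump s (x - y)" unfolding bump_def by (rule max.cobounded2)
    finally have "(3/4) * s\<^sup>2 \<le> bump s (x - y)" .
    then have "((3/4) * s\<^sup>2) ^ 3 \<le> bump s (x - y) ^ 3" by (intro power_mono) auto
    then have "8 * ((3/4) * s\<^sup>2) ^ 3 / s ^ (CARD('n) + 6) \<le> mollifier s (x - y)"
      unfolding mollifier_def using s by (intro divide_right_mono) auto
    also have "8 * ((3/4) * s\<^sup>2) ^ 3 / s ^ (CARD('n) + 6) = (27/8) / s ^ CARD('n)"
      using s by (simp add: power_add power_mult_distrib power_mult[symmetric] field_simps eval_nat_numeral)
    finally show ?thesis .
  qed
  have "(27/8) / s ^ CARD('n) * measure lborel Z = (\<integral>y. indicator Z y * ((27/8) / s ^ CARD('n)) \<partial>lborel)"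
    using emeasure_Z by (simp add: mult.commute)
  also have "\<dots> \<le> conv s x"
    unfolding conv_def
    using emeasure_Z low s by (intro integral_mono mollifier_integrable integrable_mult_left integrable_real_indicator)
      (auto simp: indicator_def)
  finally show ?thesis .
qed

text \<open>Transfers identities valid for every single kernel to \<open>hess\<close> and
  \<open>grad\<close>: the kernels are uniformly bounded, \<open>P\<close> is finite, and
  \<open>q\<close> is integrable.\<close>

lemma field_Fubini:
  assumes M: "finite_measure M" and \<phi> [measurable]: "\<phi> \<in> borel_measurable M" and q: "integrable M q"
  shows "(\<integral>x. hess i j (\<phi> x) * q x \<partial>M) = (\<integral>p. (\<integral>x. K2 i j p (\<phi> x) * q x \<partial>M) \<partial>P)"
    "(\<integral>x. grad i (\<phi> x) * q x \<partial>M) = (\<integral>p. (\<integral>x. K1 i p (\<phi> x) * q x \<partial>M) \<partial>P)"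
    "integrable P (\<lambda>p. (\<integral>x. K2 i j p (\<phi> x) * q x \<partial>M))"
    "integrable P (\<lambda>p. (\<integral>x. K1 i p (\<phi> x) * q x \<partial>M))"
    "integrable M (\<lambda>x. hess i j (\<phi> x) * q x)" "integrable M (\<lambda>x. grad i (\<phi> x) * q x)"
proof -
  interpret M: finite_measure M by (rule M)
  interpret PM: pair_sigma_finite P M ..
  have [measurable]: "q \<in> borel_measurable M" using q by auto
  have gen: "(\<integral>x. (\<integral>p. K p (\<phi> x) \<partial>P) * q x \<partial>M) = (\<integral>p. (\<integral>x. K p (\<phi> x) * q x \<partial>M) \<partial>P)
      \<and> integrable P (\<lambda>p. (\<integral>x. K p (\<phi> x) * q x \<partial>M)) \<and> integrable M (\<lambda>x. (\<integral>p. K p (\<phi> x) \<partial>P) * q x)"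
    if Km: "(\<lambda>(p, x). K p x) \<in> borel_measurable (borel \<Otimes>\<^sub>M borel)" and B: "\<And>p x. \<bar>K p x\<bar> \<le> B"
      and Kp: "\<And>x. integrable P (\<lambda>p. K p x)" for K :: "real \<times> (real^'n) \<Rightarrow> real^'n \<Rightarrow> real" and B
  proof -
    have B0: "0 \<le> B" using B[of undefined undefined] by linarith
    have m1: "(\<lambda>(p, x). K p (\<phi> x) * q x) \<in> borel_measurable (P \<Otimes>\<^sub>M M)"
      using measurable_compose[of "\<lambda>z. (fst z, \<phi> (snd z))" "P \<Otimes>\<^sub>M M" "borel \<Otimes>\<^sub>M borel", OF _ Km]
      by (auto simp: case_prod_unfold)
    have m2: "(\<lambda>x. K p x) \<in> borel_measurable borel" for p
      using measurable_compose[of "\<lambda>x. (p, x)" borel "borel \<Otimes>\<^sub>M borel", OF _ Km] by simp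
    have m3: "(\<lambda>x. K p (\<phi> x)) \<in> borel_measurable M" for p using measurable_compose[OF \<phi> m2] .
    have int1: "integrable M (\<lambda>x. K p (\<phi> x) * q x)" for p
      by (rule Bochner_Integration.integrable_bound[where f="\<lambda>x. B * q x"])
         (use q m3 B B0 in \<open>auto intro!: AE_I2 simp: abs_mult mult_right_mono\<close>)
    have int: "integrable (P \<Otimes>\<^sub>M M) (\<lambda>(p, x). K p (\<phi> x) * q x)"
    proof (rule PM.Fubini_integrable[OF m1])
      show "AE p in P. integrable M (\<lambda>x. case (p, x) of (p, x) \<Rightarrow> K p (\<phi> x) * q x)" using int1 by simp
      show "integrable P (\<lambda>p. \<integral>x. norm (case (p, x) of (p, x) \<Rightarrow> K p (\<phi> x) * q x) \<partial>M)"
      proof (rule P.integrable_const_bound[where B="B * (\<integral>x. \<bar>q x\<bar> \<partial>M)"])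
        show "AE p in P. norm (\<integral>x. norm (case (p, x) of (p, x) \<Rightarrow> K p (\<phi> x) * q x) \<partial>M) \<le> B * (\<integral>x. \<bar>q x\<bar> \<partial>M)"
        proof (rule AE_I2)
          fix p
          have "(\<integral>x. \<bar>K p (\<phi> x) * q x\<bar> \<partial>M) \<le> (\<integral>x. B * \<bar>q x\<bar> \<partial>M)"
          proof (rule integral_mono)
            show "integrable M (\<lambda>x. \<bar>K p (\<phi> x) * q x\<bar>)" using int1 by (rule integrable_abs)
          qed (use q B in \<open>auto simp: abs_mult mult_right_mono\<close>)
          then show "norm (\<integral>x. norm (case (p, x) of (p, x) \<Rightarrow> K p (\<phi> x) * q x) \<partial>M) \<le> B * (\<integral>x. \<bar>q x\<bar> \<partial>M)" by simp
        qed
        show "(\<lambda>p. \<integral>x. norm (case (p, x) of (p, x) \<Rightarrow> K p (\<phi> x) * q x) \<partial>M) \<in> borel_measurable P"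
          using m1 by (intro M.borel_measurable_lebesgue_integral) (auto simp: case_prod_unfold)
      qed
    qed
    have "(\<integral>x. (\<integral>p. K p (\<phi> x) \<partial>P) * q x \<partial>M) = (\<integral>x. \<integral>p. K p (\<phi> x) * q x \<partial>P \<partial>M)"
      using Kp by simp
    also have "\<dots> = (\<integral>p. (\<integral>x. K p (\<phi> x) * q x \<partial>M) \<partial>P)"
      by (rule PM.Fubini_integral[OF int])
    moreover have "integrable P (\<lambda>p. (\<integral>x. K p (\<phi> x) * q x \<partial>M))" using PM.integrable_fst[OF int] .
    moreover have "integrable M (\<lambda>x. \<integral>p. K p (\<phi> x) * q x \<partial>P)" using PM.integrable_snd[OF int] .
    ultimately show ?thesis using Kp by simp
  qed
  note 1 = gen[of "K2 i j", OF K_measurable(1) K_bound(1) K_integrable(1)]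
  note 2 = gen[of "K1 i", OF K_measurable(2) K_bound(2) K_integrable(2)]
  show "(\<integral>x. hess i j (\<phi> x) * q x \<partial>M) = (\<integral>p. (\<integral>x. K2 i j p (\<phi> x) * q x \<partial>M) \<partial>P)"
    "(\<integral>x. grad i (\<phi> x) * q x \<partial>M) = (\<integral>p. (\<integral>x. K1 i p (\<phi> x) * q x \<partial>M) \<partial>P)"
    "integrable P (\<lambda>p. (\<integral>x. K2 i j p (\<phi> x) * q x \<partial>M))"
    "integrable P (\<lambda>p. (\<integral>x. K1 i p (\<phi> x) * q x \<partial>M))"
    "integrable M (\<lambda>x. hess i j (\<phi> x) * q x)" "integrable M (\<lambda>x. grad i (\<phi> x) * q x)"
    using 1 2 by (auto simp: hess_def grad_def)
qed

end

section \<open>Calderon-Zygmund cubes\<close>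

text \<open>Half-open, so that halving all sides produces a partition.\<close>

definition cube :: "real^'n \<Rightarrow> real \<Rightarrow> (real^'n) set" where
  "cube c a = {x. \<forall>i. c $ i \<le> x $ i \<and> x $ i < c $ i + a}"

lemma vec_nth_measurable [measurable (raw)]:
  fixes f :: "'a \<Rightarrow> real^'n"
  assumes "f \<in> borel_measurable M"
  shows "(\<lambda>x. f x $ i) \<in> borel_measurable M"
proof -
  have "(\<lambda>x. f x \<bullet> axis i 1) \<in> borel_measurable M" using assms by measurable
  then show ?thesis by (simp add: inner_axis)
qed

lemma cube_pair_measurable: "{z. snd z \<in> cube (fst z - (\<chi> i. b)) L} \<in> sets (borel \<Otimes>\<^sub>M (borel :: (real^'n) measure))"
proof -
  have "{z :: (real^'n) \<times> (real^'n). snd z \<in> cube (fst z - (\<chi> i. b)) L}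
    = (\<Inter>i. {z \<in> space (borel \<Otimes>\<^sub>M borel). fst z $ i - b \<le> snd z $ i} \<inter> {z \<in> space (borel \<Otimes>\<^sub>M borel). snd z $ i < fst z $ i - b + L})"
    by (intro set_eqI) (simp add: cube_def space_pair_measure)
  also have "\<dots> \<in> sets (borel \<Otimes>\<^sub>M borel)"
  proof (intro sets.finite_INT sets.Int)
    fix i
    show "{z \<in> space (borel \<Otimes>\<^sub>M borel). fst z $ i - b \<le> snd z $ i} \<in> sets (borel \<Otimes>\<^sub>M (borel :: (real^'n) measure))"
      "{z \<in> space (borel \<Otimes>\<^sub>M borel). snd z $ i < fst z $ i - b + L} \<in> sets (borel \<Otimes>\<^sub>M (borel :: (real^'n) measure))"
      by measurable
  qed auto
  finally show ?thesis .
qed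

lemma cube_measurable [measurable]: "cube c a \<in> sets borel"
proof -
  have "cube c a = (\<Inter>i. {x \<in> space borel. c $ i \<le> x $ i} \<inter> {x \<in> space borel. x $ i < c $ i + a})"
    by (intro set_eqI) (simp add: cube_def)
  also have "\<dots> \<in> sets borel"
  proof (intro sets.finite_INT sets.Int)
    fix i
    show "{x \<in> space borel. c $ i \<le> x $ i} \<in> sets borel" "{x \<in> space borel. x $ i < c $ i + a} \<in> sets borel"
      by measurable
  qed auto
  finally show ?thesis .
qed

lemma emeasure_between:
  fixes l :: "real^'n"
  assumes a: "0 \<le> a" and S: "box l (l + (\<chi> i. a)) \<subseteq> S" "S \<subseteq> cbox l (l + (\<chi> i. a))" and Sm: "S \<in> sets borel"
  shows "emeasure lborel S = ennreal (a ^ CARD('n))"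
proof -
  have b: "(l + (\<chi> i. a) - l) \<bullet> b = a" "l \<bullet> b \<le> (l + (\<chi> i. a)) \<bullet> b" if "b \<in> Basis" for b
    using that a by (auto simp: Basis_vec_def inner_axis inner_add_left)
  have 1: "emeasure lborel (cbox l (l + (\<chi> i. a))) = ennreal (a ^ CARD('n))"
    using b by (subst emeasure_lborel_cbox) (auto cong: prod.cong)
  have 2: "emeasure lborel (box l (l + (\<chi> i. a))) = ennreal (a ^ CARD('n))"
    using b by (subst emeasure_lborel_box) (auto cong: prod.cong)
  show ?thesis
  proof (rule antisym)
    show "emeasure lborel S \<le> ennreal (a ^ CARD('n))" unfolding 1[symmetric] using S by (intro emeasure_mono) auto
    show "ennreal (a ^ CARD('n)) \<le> emeasure lborel S" unfolding 2[symmetric] using S Sm by (intro emeasure_mono) auto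
  qed
qed

lemma emeasure_cube:
  fixes c :: "real^'n" assumes "0 \<le> a" shows "emeasure lborel (cube c a) = ennreal (a ^ CARD('n))"
  using assms by (intro emeasure_between[where l=c]) (auto simp: cube_def mem_box_cart less_imp_le)

lemma measure_cube:
  fixes c :: "real^'n" assumes "0 \<le> a" shows "measure lborel (cube c a) = a ^ CARD('n)"
  using assms by (simp add: measure_def emeasure_cube)

lemma cube_corners_measurable: "{c. z \<in> cube (c - (\<chi> i. b)) L} \<in> sets borel"
proof -
  have "{c. z \<in> cube (c - (\<chi> i. b)) L} = (\<Inter>i. {c \<in> space borel. c $ i - b \<le> z $ i} \<inter> {c \<in> space borel. z $ i < c $ i - b + L})"
    by (intro set_eqI) (simp add: cube_def)
  also have "\<dots> \<in> sets borel"
  proof (intro sets.finite_INT sets.Int)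
    fix i
    show "{c \<in> space borel. c $ i - b \<le> z $ i} \<in> sets borel" "{c \<in> space borel. z $ i < c $ i - b + L} \<in> sets borel"
      by measurable
  qed auto
  finally show ?thesis .
qed

text \<open>Seen from \<open>z\<close>, the admissible corners again fill a cube of side
  \<open>L\<close>, with open and closed faces exchanged; \<open>emeasure_between\<close> ignores
  the faces.\<close>

lemma emeasure_cube_corners:
  fixes z :: "real^'n" assumes "0 \<le> L"
  shows "emeasure lborel {c. z \<in> cube (c - (\<chi> i. b)) L} = ennreal (L ^ CARD('n))"
proof (rule emeasure_between[OF assms, where l="z + (\<chi> i. b - L)"])
  show "{c. z \<in> cube (c - (\<chi> i. b)) L} \<in> sets borel" by (rule cube_corners_measurable)
  show "box (z + (\<chi> i. b - L)) (z + (\<chi> i. b - L) + (\<chi> i. L)) \<subseteq> {c. z \<in> cube (c - (\<chi> i. b)) L}"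
  proof
    fix c assume "c \<in> box (z + (\<chi> i. b - L)) (z + (\<chi> i. b - L) + (\<chi> i. L))"
    then have h: "z $ i + (b - L) < c $ i \<and> c $ i < z $ i + (b - L) + L" for i by (simp add: mem_box_cart)
    have "c $ i - b \<le> z $ i \<and> z $ i < c $ i - b + L" for i using h[of i] by linarith
    then show "c \<in> {c. z \<in> cube (c - (\<chi> i. b)) L}" by (simp add: cube_def)
  qed
  show "{c. z \<in> cube (c - (\<chi> i. b)) L} \<subseteq> cbox (z + (\<chi> i. b - L)) (z + (\<chi> i. b - L) + (\<chi> i. L))"
  proof
    fix c assume "c \<in> {c. z \<in> cube (c - (\<chi> i. b)) L}"
    then have h: "c $ i - b \<le> z $ i \<and> z $ i < c $ i - b + L" for i by (simp add: cube_def)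
    have "z $ i + (b - L) \<le> c $ i \<and> c $ i \<le> z $ i + (b - L) + L" for i using h[of i] by linarith
    then show "c \<in> cbox (z + (\<chi> i. b - L)) (z + (\<chi> i. b - L) + (\<chi> i. L))" by (simp add: mem_box_cart)
  qed
qed

lemma cube_norm_le:
  fixes x y c :: "real^'n"
  assumes "x \<in> cube c a" "y \<in> cube c a"
  shows "norm (x - y) \<le> real CARD('n) * a"
proof -
  have "norm (x - y) \<le> (\<Sum>i\<in>UNIV. \<bar>(x - y) $ i\<bar>)" by (rule norm_le_l1_cart)
  also have "\<dots> \<le> (\<Sum>i\<in>(UNIV::'n set). a)"
  proof (rule sum_mono)
    fix i
    have "c $ i \<le> x $ i" "x $ i < c $ i + a" "c $ i \<le> y $ i" "y $ i < c $ i + a"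
      using assms by (auto simp: cube_def)
    then show "\<bar>(x - y) $ i\<bar> \<le> a" by (simp add: abs_le_iff)
  qed
  finally show ?thesis by simp
qed

text \<open>A Calderon-Zygmund stopping time argument with finitely many generations.\<close>

lemma cube_partition:
  fixes c :: "real^'n" and m :: "(real^'n) set \<Rightarrow> real"
  assumes m: "\<And>c a c' a'. cube c a \<subseteq> cube c' a' \<Longrightarrow> m (cube c a) \<le> m (cube c' a')" and a: "0 < a"
    and "m (cube c a) \<le> \<theta> * a ^ CARD('n)" "0 \<le> \<theta>"
  shows "\<exists>T. finite T \<and> (\<Union>t\<in>T. cube (fst t) (snd t)) = cube c a \<and>
    (\<forall>t\<in>T. \<forall>t'\<in>T. t \<noteq> t' \<longrightarrow> cube (fst t) (snd t) \<inter> cube (fst t') (snd t') = {}) \<and>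
    (\<forall>t\<in>T. 0 < snd t \<and> m (cube (fst t) (snd t)) \<le> 2 ^ CARD('n) * \<theta> * snd t ^ CARD('n) \<and>
       (snd t = a / 2 ^ N \<or> \<theta> * snd t ^ CARD('n) < m (cube (fst t) (snd t))))"
  using a assms(3)
proof (induction N arbitrary: c a)
  case 0
  have "m (cube c a) \<le> 2 ^ CARD('n) * \<theta> * a ^ CARD('n)"
  proof -
    have "1 * (\<theta> * a ^ CARD('n)) \<le> 2 ^ CARD('n) * (\<theta> * a ^ CARD('n))"
      using 0 assms(4) by (intro mult_right_mono) auto
    then show ?thesis using 0 by simp
  qed
  then show ?case using 0 by (intro exI[of _ "{(c, a)}"]) auto
next
  case (Suc N)
  \<comment> \<open>The halves are indexed by the set of coordinates in which the upper half is
    taken.\<close>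
  define ch where "ch S = (\<chi> i. c $ i + (if i \<in> S then a / 2 else 0))" for S :: "'n set"
  have chU: "(\<Union>S. cube (ch S) (a/2)) = cube c a"
  proof
    show "(\<Union>S. cube (ch S) (a/2)) \<subseteq> cube c a"
    proof
      fix x assume "x \<in> (\<Union>S. cube (ch S) (a/2))"
      then obtain S where S: "\<And>i. c $ i + (if i \<in> S then a / 2 else 0) \<le> x $ i \<and> x $ i < c $ i + (if i \<in> S then a / 2 else 0) + a/2"
        by (auto simp: cube_def ch_def)
      have "c $ i \<le> x $ i \<and> x $ i < c $ i + a" for i
        using S[of i] Suc.prems(1) by (cases "i \<in> S") simp_all
      then show "x \<in> cube c a" by (simp add: cube_def)
    qed
    show "cube c a \<subseteq> (\<Union>S. cube (ch S) (a/2))"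
    proof
      fix x assume x: "x \<in> cube c a"
      have "x \<in> cube (ch {i. c $ i + a/2 \<le> x $ i}) (a/2)"
        unfolding cube_def mem_Collect_eq
      proof
        fix i
        have "c $ i \<le> x $ i" "x $ i < c $ i + a" using x by (auto simp: cube_def)
        then show "ch {i. c $ i + a/2 \<le> x $ i} $ i \<le> x $ i \<and> x $ i < ch {i. c $ i + a/2 \<le> x $ i} $ i + a/2"
          by (simp add: ch_def)
      qed
      then show "x \<in> (\<Union>S. cube (ch S) (a/2))" by blast
    qed
  qed
  have chD: "cube (ch S) (a/2) \<inter> cube (ch S') (a/2) = {}" if ne: "S \<noteq> S'" for S S' :: "'n set"
  proof -
    obtain i where i: "(i \<in> S) \<noteq> (i \<in> S')" using ne unfolding set_eq_iff by blast
    show ?thesis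
    proof (rule ccontr)
      assume "cube (ch S) (a/2) \<inter> cube (ch S') (a/2) \<noteq> {}"
      then obtain x where "x \<in> cube (ch S) (a/2)" "x \<in> cube (ch S') (a/2)" by blast
      then have "ch S $ i \<le> x $ i" "x $ i < ch S $ i + a/2" "ch S' $ i \<le> x $ i" "x $ i < ch S' $ i + a/2"
        by (auto simp: cube_def)
      then show False using i Suc.prems(1) by (cases "i \<in> S") (auto simp: ch_def)
    qed
  qed
  define Q where "Q S T \<longleftrightarrow> finite T \<and> (\<Union>t\<in>T. cube (fst t) (snd t)) = cube (ch S) (a/2) \<and>
    (\<forall>t\<in>T. \<forall>t'\<in>T. t \<noteq> t' \<longrightarrow> cube (fst t) (snd t) \<inter> cube (fst t') (snd t') = {}) \<and>
    (\<forall>t\<in>T. 0 < snd t \<and> m (cube (fst t) (snd t)) \<le> 2 ^ CARD('n) * \<theta> * snd t ^ CARD('n) \<and>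
       (snd t = a / 2 ^ Suc N \<or> \<theta> * snd t ^ CARD('n) < m (cube (fst t) (snd t))))" for S T
  have "\<exists>T. Q S T" for S
  proof (cases "m (cube (ch S) (a/2)) \<le> \<theta> * (a/2) ^ CARD('n)")
    case True
    then show ?thesis using Suc.IH[of "a/2" "ch S"] Suc.prems(1) unfolding Q_def by simp
  next
    case False
    \<comment> \<open>A child above the threshold is kept undivided. Its parent was not above it, so
      the density exceeds the threshold by at most the ratio of volumes,
      \<open>2 ^ CARD('n)\<close>.\<close>
    have "m (cube (ch S) (a/2)) \<le> m (cube c a)" using chU by (intro m) blast
    also have "\<dots> \<le> \<theta> * a ^ CARD('n)" by (rule Suc.prems)
    also have "\<dots> = 2 ^ CARD('n) * \<theta> * (a/2) ^ CARD('n)" by (simp add: power_divide)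
    finally have "Q S {(ch S, a/2)}" using False Suc.prems(1) unfolding Q_def by simp
    then show ?thesis by blast
  qed
  then obtain TT where TT: "\<And>S. Q S (TT S)" by metis
  have fin: "finite (\<Union>S. TT S)" using TT by (intro finite_UN_I) (auto simp: Q_def)
  have un: "(\<Union>t\<in>(\<Union>S. TT S). cube (fst t) (snd t)) = cube c a"
  proof -
    have "(\<Union>t\<in>(\<Union>S. TT S). cube (fst t) (snd t)) = (\<Union>S. \<Union>t\<in>TT S. cube (fst t) (snd t))" by blast
    also have "\<dots> = (\<Union>S. cube (ch S) (a/2))" using TT by (simp add: Q_def)
    finally show ?thesis using chU by simp
  qed
  have dis: "cube (fst t) (snd t) \<inter> cube (fst t') (snd t') = {}" if t: "t \<in> (\<Union>S. TT S)" "t' \<in> (\<Union>S. TT S)" "t \<noteq> t'" for t t'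
  proof -
    obtain S S' where S: "t \<in> TT S" "t' \<in> TT S'" using t by blast
    show ?thesis
    proof (cases "S = S'")
      case True then show ?thesis using S t TT[of S] unfolding Q_def by blast
    next
      case False
      have "cube (fst t) (snd t) \<subseteq> cube (ch S) (a/2)" "cube (fst t') (snd t') \<subseteq> cube (ch S') (a/2)"
        using TT[of S] TT[of S'] S unfolding Q_def by blast+
      then show ?thesis using chD[OF False] by blast
    qed
  qed
  have prp: "0 < snd t \<and> m (cube (fst t) (snd t)) \<le> 2 ^ CARD('n) * \<theta> * snd t ^ CARD('n) \<and>
       (snd t = a / 2 ^ Suc N \<or> \<theta> * snd t ^ CARD('n) < m (cube (fst t) (snd t)))" if t: "t \<in> (\<Union>S. TT S)" for t
  proof -
    obtain S where S: "t \<in> TT S" using t by (rule UN_E)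
    have "\<forall>t\<in>TT S. 0 < snd t \<and> m (cube (fst t) (snd t)) \<le> 2 ^ CARD('n) * \<theta> * snd t ^ CARD('n) \<and>
       (snd t = a / 2 ^ Suc N \<or> \<theta> * snd t ^ CARD('n) < m (cube (fst t) (snd t)))"
      using TT[of S] unfolding Q_def by (elim conjE)
    then show ?thesis using S by (rule bspec)
  qed
  show ?case
    by (rule exI[of _ "\<Union>S. TT S"], intro conjI fin un) (intro ballI impI dis prp; assumption)+
qed

text \<open>Outer regularity gives a small open superset, and compactness leaves room for a
  neighbourhood of uniform width inside it.\<close>

lemma compact_null_neighbourhood:
  fixes K :: "(real^'n) set"
  assumes K: "compact K" "emeasure lborel K = 0" and e: "0 < e"
  obtains d where "0 < d" "open {x. \<exists>k\<in>K. dist x k < d}" "emeasure lborel {x. \<exists>k\<in>K. dist x k < d} \<le> ennreal e"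
proof -
  have Kb: "K \<in> sets borel" using K(1) by (simp add: borel_compact)
  then obtain U where U: "open U" "K \<subseteq> U" "emeasure lborel (U - K) < ennreal e"
    using outer_regular_lborel[of K e] e by auto
  obtain d where d: "0 < d" "(\<Union>k\<in>K. ball k d) \<subseteq> U"
    using compact_subset_open_imp_ball_epsilon_subset[OF K(1) U(1,2)] by metis
  have eq: "{x. \<exists>k\<in>K. dist x k < d} = (\<Union>k\<in>K. ball k d)" by (auto simp: dist_commute)
  have "emeasure lborel (\<Union>k\<in>K. ball k d) \<le> emeasure lborel U" using d U by (intro emeasure_mono) auto
  also have "\<dots> \<le> emeasure lborel (U - K) + emeasure lborel K"
  proof -
    have "emeasure lborel U \<le> emeasure lborel ((U - K) \<union> K)" using U Kb by (intro emeasure_mono) auto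
    also have "\<dots> \<le> emeasure lborel (U - K) + emeasure lborel K" using U Kb by (intro emeasure_subadditive) auto
    finally show ?thesis .
  qed
  also have "\<dots> \<le> ennreal e" using U(3) K(2) by simp
  finally show ?thesis using that[OF d(1)] unfolding eq by auto
qed

section \<open>The divergence identity for the test field; Hessian against its averages\<close>

context kernel_field
begin

lemma K_field_integrable:
  assumes \<phi> [measurable]: "\<phi> \<in> borel_measurable M" and q: "integrable M q"
  shows "integrable M (\<lambda>x. K2 i j p (\<phi> x) * q x)" "integrable M (\<lambda>x. K1 i p (\<phi> x) * q x)"
proof -
  have [measurable]: "q \<in> borel_measurable M" using q by auto
  show "integrable M (\<lambda>x. K2 i j p (\<phi> x) * q x)"
  proof (rule Bochner_Integration.integrable_bound[where f="\<lambda>x. 56 * \<rho> ^ 6 * q x"])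
    show "AE x in M. norm (K2 i j p (\<phi> x) * q x) \<le> norm (56 * \<rho> ^ 6 * q x)"
    proof (rule AE_I2)
      fix x
      have "\<bar>K2 i j p (\<phi> x)\<bar> \<le> \<bar>56 * \<rho> ^ 6\<bar>" using K_bound(1)[of i j p "\<phi> x"] by linarith
      then show "norm (K2 i j p (\<phi> x) * q x) \<le> norm (56 * \<rho> ^ 6 * q x)"
        unfolding real_norm_def abs_mult[of _ "q x"] by (rule mult_right_mono) simp
    qed
  qed (use q in auto)
  show "integrable M (\<lambda>x. K1 i p (\<phi> x) * q x)"
  proof (rule Bochner_Integration.integrable_bound[where f="\<lambda>x. 8 * \<rho> ^ 7 * q x"])
    show "AE x in M. norm (K1 i p (\<phi> x) * q x) \<le> norm (8 * \<rho> ^ 7 * q x)"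
    proof (rule AE_I2)
      fix x
      have "\<bar>K1 i p (\<phi> x)\<bar> \<le> \<bar>8 * \<rho> ^ 7\<bar>" using K_bound(2)[of i p "\<phi> x"] by linarith
      then show "norm (K1 i p (\<phi> x) * q x) \<le> norm (8 * \<rho> ^ 7 * q x)"
        unfolding real_norm_def abs_mult[of _ "q x"] by (rule mult_right_mono) simp
    qed
  qed (use q in auto)
qed

text \<open>The hypothesis is available for every scale and centre, hence can be integrated over
  \<open>P\<close>; \<open>trace_hess\<close> evaluates the left-hand side.\<close>

lemma field_identity:
  fixes \<phi> :: "'a \<Rightarrow> real^'n"
  assumes M: "finite_measure M" and \<phi> [measurable]: "\<phi> \<in> borel_measurable M" and A [measurable]: "A \<in> sets M"
    and E: "\<And>i j. integrable M (E i j)" and D: "\<And>i. integrable M (D i)"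
    and id: "\<And>s y. 0 < s \<Longrightarrow> (\<integral>x. indicator A x * (\<Sum>i\<in>UNIV. bump2 i i s (\<phi> x - y)) \<partial>M)
       = (\<Sum>i\<in>UNIV. \<Sum>j\<in>UNIV. \<integral>x. bump2 i j s (\<phi> x - y) * E i j x \<partial>M)
         + (\<Sum>i\<in>UNIV. \<integral>x. bump1 i s (\<phi> x - y) * D i x \<partial>M)"
  shows "(\<integral>x. indicator A x * (conv \<rho> (\<phi> x) - conv \<sigma> (\<phi> x)) \<partial>M)
       = (\<Sum>i\<in>UNIV. \<Sum>j\<in>UNIV. \<integral>x. hess i j (\<phi> x) * E i j x \<partial>M)
         + (\<Sum>i\<in>UNIV. \<integral>x. grad i (\<phi> x) * D i x \<partial>M)"
proof -
  interpret M: finite_measure M by (rule M)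
  have iA: "integrable M (indicator A :: 'a \<Rightarrow> real)"
    by (intro integrable_real_indicator) (auto simp: M.emeasure_finite less_top[symmetric])
  note F = field_Fubini[OF M \<phi>]
  have key: "(\<Sum>i\<in>UNIV. \<integral>x. K2 i i p (\<phi> x) * indicator A x \<partial>M)
     = (\<Sum>i\<in>UNIV. \<Sum>j\<in>UNIV. \<integral>x. K2 i j p (\<phi> x) * E i j x \<partial>M) + (\<Sum>i\<in>UNIV. \<integral>x. K1 i p (\<phi> x) * D i x \<partial>M)" for p
  proof (cases "fst p \<in> {\<sigma>..\<rho>} \<and> snd p \<in> Z")
    case True
    then have s: "0 < fst p" using \<sigma> by auto
    have K: "K2 i j p z = bump2 i j (fst p) (z - snd p)" "K1 i p z = bump1 i (fst p) (z - snd p)" for i j z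
      using True by (simp_all add: K2_def K1_def)
    have "(\<Sum>i\<in>UNIV. \<integral>x. K2 i i p (\<phi> x) * indicator A x \<partial>M) = (\<integral>x. (\<Sum>i\<in>UNIV. K2 i i p (\<phi> x) * indicator A x) \<partial>M)"
      by (intro Bochner_Integration.integral_sum[symmetric] K_field_integrable iA \<phi>)
    also have "\<dots> = (\<integral>x. indicator A x * (\<Sum>i\<in>UNIV. bump2 i i (fst p) (\<phi> x - snd p)) \<partial>M)"
      unfolding K by (simp add: sum_distrib_left mult.commute)
    finally show ?thesis unfolding id[OF s] K .
  next
    case False
    then have K: "K2 i j p z = 0" "K1 i p z = 0" for i j z by (auto simp: K2_def K1_def)
    show ?thesis by (simp add: K)
  qed
  have "(\<integral>x. indicator A x * (conv \<rho> (\<phi> x) - conv \<sigma> (\<phi> x)) \<partial>M) = (\<integral>x. (\<Sum>i\<in>UNIV. hess i i (\<phi> x) * indicator A x) \<partial>M)"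
    unfolding trace_hess[symmetric] by (simp add: sum_distrib_left mult.commute)
  also have "\<dots> = (\<Sum>i\<in>UNIV. \<integral>x. hess i i (\<phi> x) * indicator A x \<partial>M)"
    by (intro Bochner_Integration.integral_sum F(5) iA)
  also have "\<dots> = (\<Sum>i\<in>UNIV. \<integral>p. (\<integral>x. K2 i i p (\<phi> x) * indicator A x \<partial>M) \<partial>P)"
    by (intro sum.cong refl F(1) iA)
  also have "\<dots> = (\<integral>p. (\<Sum>i\<in>UNIV. \<integral>x. K2 i i p (\<phi> x) * indicator A x \<partial>M) \<partial>P)"
    by (intro Bochner_Integration.integral_sum[symmetric] F(3) iA)
  also have "\<dots> = (\<integral>p. (\<Sum>i\<in>UNIV. \<Sum>j\<in>UNIV. \<integral>x. K2 i j p (\<phi> x) * E i j x \<partial>M) + (\<Sum>i\<in>UNIV. \<integral>x. K1 i p (\<phi> x) * D i x \<partial>M) \<partial>P)"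
    unfolding key ..
  also have "\<dots> = (\<integral>p. (\<Sum>i\<in>UNIV. \<Sum>j\<in>UNIV. \<integral>x. K2 i j p (\<phi> x) * E i j x \<partial>M) \<partial>P) + (\<integral>p. (\<Sum>i\<in>UNIV. \<integral>x. K1 i p (\<phi> x) * D i x \<partial>M) \<partial>P)"
    by (intro Bochner_Integration.integral_add Bochner_Integration.integrable_sum F(3) F(4) E D)
  also have "(\<integral>p. (\<Sum>i\<in>UNIV. \<Sum>j\<in>UNIV. \<integral>x. K2 i j p (\<phi> x) * E i j x \<partial>M) \<partial>P) = (\<Sum>i\<in>UNIV. \<Sum>j\<in>UNIV. \<integral>x. hess i j (\<phi> x) * E i j x \<partial>M)"
    using F(1,3)[OF E] by simp
  also have "(\<integral>p. (\<Sum>i\<in>UNIV. \<integral>x. K1 i p (\<phi> x) * D i x \<partial>M) \<partial>P) = (\<Sum>i\<in>UNIV. \<integral>x. grad i (\<phi> x) * D i x \<partial>M)"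
    using F(2,4)[OF D] by simp
  finally show ?thesis .
qed

text \<open>Combines \<open>|h| \<le> 1 + h^2\<close> with
  \<open>h^2 \<le> 2 k^2 + 2 (h - k)^2\<close>. The inhomogeneous bound is deliberate: it is linear
  in the average of the squared Hessian, so that it can be summed over cubes against their
  masses.\<close>

lemma hess_le_average:
  assumes Q [measurable]: "Q \<in> sets borel" "measure lborel Q = v" "0 < v" "emeasure lborel Q < \<infinity>"
    and osc: "\<And>y. y \<in> Q \<Longrightarrow> \<bar>hess i j x - hess i j y\<bar> \<le> Om"
  shows "\<bar>hess i j x\<bar> \<le> 1 + 2 * Om\<^sup>2 + 2 * (\<integral>y. indicator Q y * (hess i j y)\<^sup>2 \<partial>lborel) / v"
proof -
  have iH: "integrable lborel (\<lambda>y. indicator Q y * (hess i j y)\<^sup>2)"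
    using integrable_mult_indicator[OF _ hess_product(2)[of i j i j], of Q] by (simp add: power2_eq_square)
  have i1: "integrable lborel (\<lambda>y. indicator Q y * (c::real))" for c
    using Q(4) by (intro integrable_mult_left integrable_real_indicator) auto
  have "\<bar>hess i j x\<bar> * v = (\<integral>y. indicator Q y * \<bar>hess i j x\<bar> \<partial>lborel)" using Q(2) by (simp add: mult.commute)
  also have "\<dots> \<le> (\<integral>y. indicator Q y * (1 + 2 * Om\<^sup>2) + 2 * (indicator Q y * (hess i j y)\<^sup>2) \<partial>lborel)"
  proof (intro integral_mono i1 Bochner_Integration.integrable_add integrable_mult_right iH)
    fix y
    show "indicator Q y * \<bar>hess i j x\<bar> \<le> indicator Q y * (1 + 2 * Om\<^sup>2) + 2 * (indicator Q y * (hess i j y)\<^sup>2)"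
    proof (cases "y \<in> Q")
      case True
      define h k where "h = hess i j x" and "k = hess i j y"
      have "(h - k)\<^sup>2 \<le> Om\<^sup>2" using osc[OF True] unfolding h_def k_def by (metis abs_ge_zero power2_abs power_mono)
      moreover have "0 \<le> (h - 2 * k)\<^sup>2" by simp
      then have "h\<^sup>2 \<le> 2 * k\<^sup>2 + 2 * (h - k)\<^sup>2" by (simp add: power2_eq_square algebra_simps)
      moreover have "0 \<le> (\<bar>h\<bar> - 1/2)\<^sup>2" by simp
      then have "\<bar>h\<bar> \<le> 1 + h\<^sup>2" unfolding power2_diff by (simp add: power_divide)
      ultimately have "\<bar>h\<bar> \<le> 1 + 2 * Om\<^sup>2 + 2 * k\<^sup>2" by linarith
      then show ?thesis using True by (simp add: h_def k_def)
    qed simp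
  qed
  also have "\<dots> = (1 + 2 * Om\<^sup>2) * v + 2 * (\<integral>y. indicator Q y * (hess i j y)\<^sup>2 \<partial>lborel)"
    using i1 iH Q(2) by simp
  finally have "\<bar>hess i j x\<bar> * v \<le> (1 + 2 * Om\<^sup>2) * v + 2 * (\<integral>y. indicator Q y * (hess i j y)\<^sup>2 \<partial>lborel)" .
  then have "\<bar>hess i j x\<bar> \<le> ((1 + 2 * Om\<^sup>2) * v + 2 * (\<integral>y. indicator Q y * (hess i j y)\<^sup>2 \<partial>lborel)) / v"
    using Q(3) by (simp add: pos_le_divide_eq)
  also have "\<dots> = 1 + 2 * Om\<^sup>2 + 2 * (\<integral>y. indicator Q y * (hess i j y)\<^sup>2 \<partial>lborel) / v"
    using Q(3) by (simp add: add_divide_distrib)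
  finally show ?thesis .
qed

end

text \<open>The set \<open>Z\<close> avoids a neighbourhood of \<open>K\<close> and the dilates of the cubes on which the error \<open>E\<close> is
  concentrated; on every cube of the partition the Hessian then has bounded oscillation, so its
  pairing with \<open>E\<close> is controlled by its norm in \<open>L\<^sup>2\<close>.\<close>

lemma cube_inequality:
  fixes \<phi> :: "'a \<Rightarrow> real^'n" and c :: "real^'n"
  assumes M: "finite_measure M" and \<phi> [measurable]: "\<phi> \<in> borel_measurable M" and A [measurable]: "A \<in> sets M"
    and E: "\<And>i j. integrable M (E i j)" and D: "\<And>i. integrable M (D i)"
    and id: "\<And>s y. 0 < s \<Longrightarrow> (\<integral>x. indicator A x * (\<Sum>i\<in>UNIV. bump2 i i s (\<phi> x - y)) \<partial>M)
       = (\<Sum>i\<in>UNIV. \<Sum>j\<in>UNIV. \<integral>x. bump2 i j s (\<phi> x - y) * E i j x \<partial>M)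
         + (\<Sum>i\<in>UNIV. \<integral>x. bump1 i s (\<phi> x - y) * D i x \<partial>M)"
    and K: "compact K" "emeasure lborel K = 0" "\<And>x. x \<in> A \<Longrightarrow> \<phi> x \<in> K" and a: "0 < a"
    and N: "N = CARD('n)" and nn: "n = real N"
    and Om: "Os = 672 * 2 ^ N * n" and L: "L = (4 * n + 1) * a" and \<Lambda>: "\<Lambda> = 4 * 3 ^ N * (4 * n + 1) ^ N"
    and EE: "EE = (\<lambda>x. \<Sum>i\<in>UNIV. \<Sum>j\<in>UNIV. \<bar>E i j x\<bar>)" and DD: "DD = (\<lambda>x. \<Sum>i\<in>UNIV. \<bar>D i x\<bar>)"
    and Q1: "Q1 = cube (c - (\<chi> i. 2 * n * a)) L"
  shows "27 / 16 / (2 * n) ^ N * (\<integral>x. indicator (cube c a) (\<phi> x) * indicator A x \<partial>M)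
    \<le> (n\<^sup>2 * (1 + 2 * Os\<^sup>2) + 2 * 2 ^ N * \<Lambda> * (2 * (8 * 2 ^ N)\<^sup>2)) * (\<integral>x. indicator Q1 (\<phi> x) * EE x \<partial>M)
      + 16 * n * 2 ^ N * a * (\<integral>x. indicator Q1 (\<phi> x) * DD x \<partial>M)"
proof -
  interpret M: finite_measure M by (rule M)
  have N1: "1 \<le> N" using N by (simp add: Suc_leI)
  have n1: "1 \<le> n" using N1 nn by simp
  \<comment> \<open>The cube has diameter at most \<open>n * a\<close>, which is half of \<rho>, as
    \<open>conv_lower\<close> demands. \<open>Q1\<close> is the cube enlarged by \<rho> on every
    side, so that both fields vanish outside it.\<close>
  define \<rho> where "\<rho> = 2 * n * a"
  have \<rho>: "0 < \<rho>" using a n1 by (simp add: \<rho>_def)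
  have L0: "0 < L" "a \<le> L" using a n1 by (auto simp: L)
  have [measurable]: "Q1 \<in> sets borel" unfolding Q1 by (rule cube_measurable)
  have EEi: "integrable M EE" unfolding EE by (intro Bochner_Integration.integrable_sum integrable_abs E)
  have EE0: "0 \<le> EE x" for x unfolding EE by (intro sum_nonneg) auto
  have [measurable]: "EE \<in> borel_measurable M" using EEi by auto
  have EEij: "\<bar>E i j x\<bar> \<le> EE x" for i j x
  proof -
    have "\<bar>E i j x\<bar> \<le> (\<Sum>j\<in>UNIV. \<bar>E i j x\<bar>)" by (intro member_le_sum) auto
    also have "\<dots> \<le> EE x" unfolding EE by (intro member_le_sum[of i UNIV "\<lambda>i. \<Sum>j\<in>UNIV. \<bar>E i j x\<bar>"]) (auto intro: sum_nonneg)
    finally show ?thesis .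
  qed
  define m where "m B = (\<integral>x. indicator B (\<phi> x) * EE x \<partial>M)" for B :: "(real^'n) set"
  have mi: "integrable M (\<lambda>x. indicator B (\<phi> x) * q x)" if "B \<in> sets borel" "integrable M q" for B and q :: "'a \<Rightarrow> real"
  proof (rule Bochner_Integration.integrable_bound[OF that(2)])
    show "(\<lambda>x. indicator B (\<phi> x) * q x) \<in> borel_measurable M" using that by measurable
  qed (auto simp: indicator_def)
  have m0: "0 \<le> m B" for B unfolding m_def using EE0 by (intro Bochner_Integration.integral_nonneg) auto
  have m_mono: "m B \<le> m B'" if "B \<subseteq> B'" "B \<in> sets borel" "B' \<in> sets borel" for B B'
    unfolding m_def using that EE0 by (intro integral_mono mi EEi) (auto simp: indicator_def)
  \<comment> \<open>The cubes above this threshold have total volume at most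
    \<open>L ^ N / \<Lambda>\<close>. Tripling their sides multiplies it by \<open>3 ^ N\<close>,
    and \<open>\<Lambda>\<close> is chosen so that the result is at most a quarter of
    \<open>a ^ N\<close>.\<close>
  define \<theta> where "\<theta> = \<Lambda> * m Q1 / L ^ N"
  have \<Lambda>1: "1 \<le> \<Lambda>"
  proof -
    have "1 * 1 * 1 \<le> 4 * 3 ^ N * (4 * n + 1) ^ N" using n1 by (intro mult_mono one_le_power) auto
    then show ?thesis by (simp add: \<Lambda>)
  qed
  have \<theta>0: "0 \<le> \<theta>" using \<Lambda>1 m0 L0 by (simp add: \<theta>_def)
  have mQ1: "m Q1 \<le> \<theta> * L ^ N" using \<Lambda>1 m0[of Q1] L0 mult_right_mono[of 1 \<Lambda> "m Q1"] by (simp add: \<theta>_def)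
  obtain \<delta> where \<delta>: "0 < \<delta>" "open {x. \<exists>k\<in>K. dist x k < \<delta>}" "emeasure lborel {x. \<exists>k\<in>K. dist x k < \<delta>} \<le> ennreal (a ^ N / 4)"
    using compact_null_neighbourhood[OF K(1,2), of "a ^ N / 4"] a by auto
  \<comment> \<open>At most \<delta>, so that a ball of radius \<sigma> about a point of
    \<open>K\<close> stays inside the neighbourhood removed from \<open>Z\<close>.\<close>
  define \<sigma> where "\<sigma> = min \<delta> \<rho>"
  have \<sigma>: "0 < \<sigma>" "\<sigma> \<le> \<rho>" "\<sigma> \<le> \<delta>" using \<delta> \<rho> by (auto simp: \<sigma>_def)
  \<comment> \<open>Cubes that survive all subdivisions have side below the smallest scale \<sigma>,
    so their oscillation is controlled wherever \<open>Z\<close> lies.\<close>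
  obtain G where G: "L / 2 ^ G < \<sigma>"
  proof -
    have "(\<lambda>k. L * (1 / 2) ^ k) \<longlonglongrightarrow> L * 0" by (intro tendsto_mult tendsto_const LIMSEQ_realpow_zero) auto
    then have "\<forall>\<^sub>F k in sequentially. L * (1 / 2) ^ k < \<sigma>" using \<sigma> by (intro order_tendstoD(2)) auto
    then show ?thesis using that by (auto simp: eventually_sequentially power_divide)
  qed
  have "\<exists>T. finite T \<and> (\<Union>t\<in>T. cube (fst t) (snd t)) = Q1 \<and>
    (\<forall>t\<in>T. \<forall>t'\<in>T. t \<noteq> t' \<longrightarrow> cube (fst t) (snd t) \<inter> cube (fst t') (snd t') = {}) \<and>
    (\<forall>t\<in>T. 0 < snd t \<and> m (cube (fst t) (snd t)) \<le> 2 ^ N * \<theta> * snd t ^ N \<and>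
       (snd t = L / 2 ^ G \<or> \<theta> * snd t ^ N < m (cube (fst t) (snd t))))"
    unfolding Q1 N
    by (rule cube_partition[OF _ L0(1) _ \<theta>0]) (use mQ1 in \<open>simp_all add: m_mono cube_measurable Q1 N\<close>)
  then obtain T where T0: "finite T \<and> (\<Union>t\<in>T. cube (fst t) (snd t)) = Q1 \<and>
    (\<forall>t\<in>T. \<forall>t'\<in>T. t \<noteq> t' \<longrightarrow> cube (fst t) (snd t) \<inter> cube (fst t') (snd t') = {}) \<and>
    (\<forall>t\<in>T. 0 < snd t \<and> m (cube (fst t) (snd t)) \<le> 2 ^ N * \<theta> * snd t ^ N \<and>
       (snd t = L / 2 ^ G \<or> \<theta> * snd t ^ N < m (cube (fst t) (snd t))))"
    by (rule exE)
  have finT: "finite T" and TU: "(\<Union>t\<in>T. cube (fst t) (snd t)) = Q1"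
    and T1: "\<forall>t\<in>T. \<forall>t'\<in>T. t \<noteq> t' \<longrightarrow> cube (fst t) (snd t) \<inter> cube (fst t') (snd t') = {}"
    and T2: "\<forall>t\<in>T. 0 < snd t \<and> m (cube (fst t) (snd t)) \<le> 2 ^ N * \<theta> * snd t ^ N \<and>
       (snd t = L / 2 ^ G \<or> \<theta> * snd t ^ N < m (cube (fst t) (snd t)))"
    by (rule conjunct1[OF T0] conjunct1[OF conjunct2[OF T0]] conjunct1[OF conjunct2[OF conjunct2[OF T0]]]
      conjunct2[OF conjunct2[OF conjunct2[OF T0]]])+
  have T: "0 < snd t" "m (cube (fst t) (snd t)) \<le> 2 ^ N * \<theta> * snd t ^ N"
      "snd t = L / 2 ^ G \<or> \<theta> * snd t ^ N < m (cube (fst t) (snd t))" if "t \<in> T" for t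
    by (rule conjunct1[OF bspec[OF T2 that]] conjunct1[OF conjunct2[OF bspec[OF T2 that]]]
      conjunct2[OF conjunct2[OF bspec[OF T2 that]]])+
  have Tdis: "cube (fst t) (snd t) \<inter> cube (fst t') (snd t') = {}" if "t \<in> T" "t' \<in> T" "t \<noteq> t'" for t t'
    by (rule mp[OF bspec[OF bspec[OF T1 that(1)] that(2)] that(3)])
  define cb where "cb t = cube (fst t) (snd t)" for t :: "(real^'n) \<times> real"
  have [measurable]: "cb t \<in> sets borel" for t unfolding cb_def by (rule cube_measurable)
  have disj: "disjoint_family_on cb T" unfolding disjoint_family_on_def cb_def using Tdis by blast
  have ind: "indicator Q1 z = (\<Sum>t\<in>T. indicator (cb t) z :: real)" for z
    using indicator_UN_disjoint[OF finT disj, of z] TU by (simp add: cb_def)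
  have msum: "(\<Sum>t\<in>T. m (cb t)) = m Q1"
    unfolding m_def ind sum_distrib_right by (intro Bochner_Integration.integral_sum[symmetric] mi EEi) measurable
  define bad where "bad = {t\<in>T. \<theta> * snd t ^ N < m (cb t)}"
  have finb: "finite bad" using finT by (simp add: bad_def)
  define tri where "tri t = cube (fst t - (\<chi> i. snd t)) (3 * snd t)" for t :: "(real^'n) \<times> real"
  have [measurable]: "tri t \<in> sets borel" for t unfolding tri_def by (rule cube_measurable)
  define KN where "KN = {x. \<exists>k\<in>K. dist x k < \<delta>}"
  have [measurable]: "KN \<in> sets borel" using \<delta>(2) by (simp add: KN_def)
  define Z where "Z = cube c a - (\<Union>t\<in>bad. tri t) - KN"
  have UB [measurable]: "(\<Union>t\<in>bad. tri t) \<in> sets borel" using finb by (intro sets.finite_UN) auto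
  have Zm [measurable]: "Z \<in> sets borel" unfolding Z_def by measurable
  have Zc: "Z \<subseteq> cube c a" by (auto simp: Z_def)
  have "bounded (cube c a)"
    unfolding bounded_any_center[where a=c]
  proof (intro exI[of _ "real CARD('n) * a"] ballI)
    fix y assume "y \<in> cube c a"
    then show "dist c y \<le> real CARD('n) * a" using cube_norm_le[of c c a y] a by (auto simp: dist_norm cube_def)
  qed
  then have Zb: "bounded Z" using Zc bounded_subset by blast
  have sumbad: "3 ^ N * (\<Sum>t\<in>bad. snd t ^ N) \<le> a ^ N / 4"
  proof (cases "m Q1 = 0")
    case True
    have "bad = {}"
    proof -
      have "m (cb t) \<le> m Q1" if "t \<in> T" for t
        using TU that by (intro m_mono) (auto simp: cb_def)
      then show ?thesis unfolding bad_def \<theta>_def using True by (auto simp: not_less)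
    qed
    then show ?thesis using a by simp
  next
    case False
    then have mp: "0 < m Q1" using m0[of Q1] by simp
    have "\<theta> * (\<Sum>t\<in>bad. snd t ^ N) = (\<Sum>t\<in>bad. \<theta> * snd t ^ N)" by (simp add: sum_distrib_left)
    also have "\<dots> \<le> (\<Sum>t\<in>bad. m (cb t))" by (intro sum_mono) (auto simp: bad_def)
    also have "\<dots> \<le> (\<Sum>t\<in>T. m (cb t))" using finT m0 by (intro sum_mono2) (auto simp: bad_def)
    finally have "\<Lambda> * m Q1 / L ^ N * (\<Sum>t\<in>bad. snd t ^ N) \<le> m Q1" unfolding msum \<theta>_def .
    then have "\<Lambda> / L ^ N * (\<Sum>t\<in>bad. snd t ^ N) * m Q1 \<le> 1 * m Q1" by (simp add: algebra_simps)
    then have "\<Lambda> / L ^ N * (\<Sum>t\<in>bad. snd t ^ N) \<le> 1" using mp by (simp only: mult_le_cancel_right_pos)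
    then have "\<Lambda> * (\<Sum>t\<in>bad. snd t ^ N) \<le> L ^ N" using L0 by (simp add: field_simps)
    then have "(4 * n + 1) ^ N * (4 * (3 ^ N * (\<Sum>t\<in>bad. snd t ^ N))) \<le> (4 * n + 1) ^ N * a ^ N"
      unfolding \<Lambda> L power_mult_distrib by (simp only: mult_ac)
    then have "4 * (3 ^ N * (\<Sum>t\<in>bad. snd t ^ N)) \<le> a ^ N"
      using n1 by (simp only: mult_le_cancel_left_pos zero_less_power)
    then show ?thesis by simp
  qed
  have finQ: "emeasure lborel (cube c a) \<noteq> \<infinity>" using a by (simp add: emeasure_cube)
  have KNf: "emeasure lborel KN \<noteq> \<infinity>" using \<delta>(3) unfolding KN_def by (auto simp: top_unique)
  have trif: "emeasure lborel (tri t) \<noteq> \<infinity>" if "t \<in> T" for t using T(1)[OF that] by (simp add: tri_def emeasure_cube)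
  \<comment> \<open>A quarter of the volume is lost to the tripled cubes and another quarter to the
    neighbourhood of \<open>K\<close>.\<close>
  have Zlow: "a ^ N / 2 \<le> measure lborel Z"
  proof -
    have "a ^ N = measure lborel (cube c a)" using a by (simp add: measure_cube N)
    also have "\<dots> \<le> measure lborel (Z \<union> ((\<Union>t\<in>bad. tri t) \<union> KN))"
    proof (rule measure_mono_fmeasurable)
      have "Z \<in> fmeasurable lborel" using Zb emeasure_bounded_finite[OF Zb] by (intro fmeasurableI) auto
      moreover have "(\<Union>t\<in>bad. tri t) \<in> fmeasurable lborel"
        using finb trif by (intro fmeasurable.finite_UN fmeasurableI) (auto simp: bad_def less_top)
      moreover have "KN \<in> fmeasurable lborel" using KNf by (intro fmeasurableI) (auto simp: less_top)
      ultimately show "Z \<union> ((\<Union>t\<in>bad. tri t) \<union> KN) \<in> fmeasurable lborel" by (intro fmeasurable.Un)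
    qed (auto simp: Z_def)
    also have "\<dots> \<le> measure lborel Z + measure lborel ((\<Union>t\<in>bad. tri t) \<union> KN)"
      by (intro measure_Un_le) auto
    also have "measure lborel ((\<Union>t\<in>bad. tri t) \<union> KN) \<le> measure lborel (\<Union>t\<in>bad. tri t) + measure lborel KN"
      by (intro measure_Un_le) auto
    also have "measure lborel (\<Union>t\<in>bad. tri t) \<le> (\<Sum>t\<in>bad. measure lborel (tri t))"
      using finb trif by (intro measure_UNION_le) auto
    also have "\<dots> = 3 ^ N * (\<Sum>t\<in>bad. snd t ^ N)"
      unfolding sum_distrib_left
    proof (intro sum.cong refl)
      fix t assume "t \<in> bad"
      then have "0 < snd t" using T(1) by (simp add: bad_def)
      then show "measure lborel (tri t) = 3 ^ N * snd t ^ N" by (simp add: tri_def measure_cube N power_mult_distrib)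
    qed
    also have "\<dots> \<le> a ^ N / 4" by (rule sumbad)
    also have "measure lborel KN \<le> a ^ N / 4"
      unfolding KN_def measure_def by (rule enn2real_leI[OF _ \<delta>(3)]) (use a in simp)
    finally show ?thesis by simp
  qed
  have Zup: "measure lborel Z \<le> a ^ N"
  proof -
    have "measure lborel Z \<le> measure lborel (cube c a)"
      using finQ Zc by (intro measure_mono_fmeasurable fmeasurableI) (auto simp: less_top)
    then show ?thesis using a by (simp add: measure_cube N)
  qed
  interpret kf: kernel_field \<sigma> \<rho> Z by unfold_locales (use \<sigma> Zb in auto)
  define h where "h = kf.hess"
  define w where "w = kf.grad"
  have farZ: "\<rho> \<le> norm (z - y)" if z: "z \<notin> Q1" and y: "y \<in> Z" for z y
  proof -
    obtain i where "\<not> (c $ i - 2 * n * a \<le> z $ i \<and> z $ i < c $ i - 2 * n * a + L)"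
      using z unfolding Q1 cube_def by auto
    moreover have "c $ i \<le> y $ i" "y $ i < c $ i + a" using y Zc by (auto simp: cube_def)
    ultimately have "\<rho> \<le> \<bar>(z - y) $ i\<bar>" unfolding L \<rho>_def by (auto simp: algebra_simps abs_if not_le not_less)
    also have "\<dots> \<le> norm (z - y)" by (rule abs_component_le)
    finally show ?thesis .
  qed
  have supp: "h i j z = 0" "w i z = 0" if "z \<notin> Q1" for i j z
    unfolding h_def w_def using kf.field_support(3,4)[OF farZ[OF that]] by auto
  \<comment> \<open>A bad cube is separated from \<open>Z\<close> by at least its own side because
    its triple has been removed; any other cube has side at most \<sigma>. In both cases
    \<open>hess_osc\<close> applies with \<open>r\<close> the side, and diameter over side is at
    most \<open>n\<close>.\<close>
  have osc: "\<bar>h i j x - h i j y\<bar> \<le> Os" if t: "t \<in> T" and xy: "x \<in> cb t" "y \<in> cb t" for i j t x y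
  proof -
    have r: "0 < snd t" by (rule T(1)[OF t])
    have far: "(\<forall>y'\<in>Z. snd t \<le> norm (x - y') \<and> snd t \<le> norm (y - y')) \<or> snd t \<le> \<sigma>"
    proof (cases "t \<in> bad")
      case True
      have "snd t \<le> norm (z - y')" if z: "z \<in> cb t" and y': "y' \<in> Z" for z y'
      proof -
        have "y' \<notin> tri t" using y' True by (auto simp: Z_def)
        then obtain i where "\<not> (fst t $ i - snd t \<le> y' $ i \<and> y' $ i < fst t $ i - snd t + 3 * snd t)"
          unfolding tri_def cube_def by auto
        moreover have "fst t $ i \<le> z $ i" "z $ i < fst t $ i + snd t" using z by (auto simp: cb_def cube_def)
        ultimately have "snd t \<le> \<bar>(z - y') $ i\<bar>" by (auto simp: abs_if not_le not_less)
        also have "\<dots> \<le> norm (z - y')" by (rule abs_component_le)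
        finally show ?thesis .
      qed
      then show ?thesis using xy by blast
    next
      case False
      then have "snd t = L / 2 ^ G" using T(3)[OF t] t by (auto simp: bad_def cb_def)
      then show ?thesis using G by simp
    qed
    have "\<bar>h i j x - h i j y\<bar> \<le> 672 * 2 ^ CARD('n) * norm (x - y) / snd t"
      unfolding h_def by (rule kf.hess_osc[OF r far])
    also have "\<dots> \<le> 672 * 2 ^ CARD('n) * (real CARD('n) * snd t) / snd t"
      using r cube_norm_le[of x "fst t" "snd t" y] xy by (intro divide_right_mono mult_left_mono) (auto simp: cb_def)
    also have "\<dots> = Os" using r by (simp add: Om N nn)
    finally show ?thesis .
  qed
  define I where "I i j t = (\<integral>y. indicator (cb t) y * (h i j y)\<^sup>2 \<partial>lborel)" for i j t
  have I0: "0 \<le> I i j t" for i j t unfolding I_def by (intro Bochner_Integration.integral_nonneg) auto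
  have vol: "measure lborel (cb t) = snd t ^ N" "0 < snd t ^ N" "emeasure lborel (cb t) < \<infinity>" if "t \<in> T" for t
    using T(1)[OF that] by (auto simp: cb_def measure_cube emeasure_cube N)
  have hb: "\<bar>h i j x\<bar> \<le> 1 + 2 * Os\<^sup>2 + 2 * I i j t / snd t ^ N" if t: "t \<in> T" and x: "x \<in> cb t" for i j t x
    unfolding I_def h_def
    by (rule kf.hess_le_average[OF _ vol[OF t]]) (use osc[OF t x] in \<open>auto simp: h_def\<close>)
  have ihh: "integrable lborel (\<lambda>y. (h i j y)\<^sup>2)" for i j
    unfolding h_def power2_eq_square by (rule kf.hess_product(2))
  have ihc: "integrable lborel (\<lambda>y. indicator (cb t) y * (h i j y)\<^sup>2)" for i j t
    using integrable_mult_indicator[OF _ ihh, of "cb t" i j] by simp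
  have Isum: "(\<Sum>t\<in>T. I i j t) \<le> (\<integral>y. (h i j y)\<^sup>2 \<partial>lborel)" for i j
  proof -
    have "(\<Sum>t\<in>T. I i j t) = (\<integral>y. indicator Q1 y * (h i j y)\<^sup>2 \<partial>lborel)"
      unfolding I_def ind sum_distrib_right by (intro Bochner_Integration.integral_sum[symmetric] ihc)
    also have "\<dots> \<le> (\<integral>y. (h i j y)\<^sup>2 \<partial>lborel)"
    proof (intro integral_mono ihh)
      show "integrable lborel (\<lambda>y. indicator Q1 y * (h i j y)\<^sup>2)"
        using integrable_mult_indicator[OF _ ihh, of Q1 i j] by simp
    qed (auto simp: indicator_def)
    finally show ?thesis .
  qed
  have ihE: "integrable M (\<lambda>x. h i j (\<phi> x) * E i j x)" for i j
    unfolding h_def by (rule kf.field_Fubini(5)[OF M \<phi> E])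
  \<comment> \<open>The mass of \<open>E\<close> on a cube is at most
    \<open>2 ^ N * \<theta>\<close> times its volume, which cancels the volume in the average of the
    squared Hessian. The sum over the cubes thus becomes one integral.\<close>
  have Eterm: "(\<integral>x. h i j (\<phi> x) * E i j x \<partial>M) \<le> (1 + 2 * Os\<^sup>2) * m Q1 + 2 * (2 ^ N * \<theta>) * (\<integral>y. (h i j y)\<^sup>2 \<partial>lborel)" for i j
  proof -
    have "(\<integral>x. h i j (\<phi> x) * E i j x \<partial>M) \<le> (\<integral>x. (\<Sum>t\<in>T. (1 + 2 * Os\<^sup>2 + 2 * I i j t / snd t ^ N) * (indicator (cb t) (\<phi> x) * EE x)) \<partial>M)"
    proof (intro integral_mono ihE Bochner_Integration.integrable_sum integrable_mult_right mi EEi)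
      fix x
      have "h i j (\<phi> x) * E i j x \<le> \<bar>h i j (\<phi> x)\<bar> * \<bar>E i j x\<bar>" by (metis abs_ge_self abs_mult)
      also have "\<dots> \<le> \<bar>h i j (\<phi> x)\<bar> * EE x" using EEij by (intro mult_left_mono) auto
      also have "\<dots> = indicator Q1 (\<phi> x) * (\<bar>h i j (\<phi> x)\<bar> * EE x)"
        by (cases "\<phi> x \<in> Q1") (simp_all add: supp)
      also have "\<dots> = (\<Sum>t\<in>T. indicator (cb t) (\<phi> x) * (\<bar>h i j (\<phi> x)\<bar> * EE x))" unfolding ind sum_distrib_right ..
      also have "\<dots> \<le> (\<Sum>t\<in>T. (1 + 2 * Os\<^sup>2 + 2 * I i j t / snd t ^ N) * (indicator (cb t) (\<phi> x) * EE x))"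
      proof (rule sum_mono)
        fix t assume t: "t \<in> T"
        show "indicator (cb t) (\<phi> x) * (\<bar>h i j (\<phi> x)\<bar> * EE x) \<le> (1 + 2 * Os\<^sup>2 + 2 * I i j t / snd t ^ N) * (indicator (cb t) (\<phi> x) * EE x)"
          using hb[OF t, of "\<phi> x" i j] EE0[of x] by (cases "\<phi> x \<in> cb t") (auto intro: mult_right_mono)
      qed
      finally show "h i j (\<phi> x) * E i j x \<le> (\<Sum>t\<in>T. (1 + 2 * Os\<^sup>2 + 2 * I i j t / snd t ^ N) * (indicator (cb t) (\<phi> x) * EE x))" .
    qed measurable
    also have "\<dots> = (\<Sum>t\<in>T. (1 + 2 * Os\<^sup>2 + 2 * I i j t / snd t ^ N) * m (cb t))"
      unfolding m_def by (subst Bochner_Integration.integral_sum) (auto intro!: integrable_mult_right mi EEi)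
    also have "\<dots> \<le> (\<Sum>t\<in>T. (1 + 2 * Os\<^sup>2) * m (cb t) + 2 * (2 ^ N * \<theta>) * I i j t)"
    proof (rule sum_mono)
      fix t assume t: "t \<in> T"
      have "m (cb t) / snd t ^ N \<le> 2 ^ N * \<theta>"
        using T(2)[OF t] vol(2)[OF t] by (simp add: cb_def pos_divide_le_eq)
      then have "2 * I i j t * (m (cb t) / snd t ^ N) \<le> 2 * I i j t * (2 ^ N * \<theta>)"
        using I0 by (intro mult_left_mono) auto
      then show "(1 + 2 * Os\<^sup>2 + 2 * I i j t / snd t ^ N) * m (cb t) \<le> (1 + 2 * Os\<^sup>2) * m (cb t) + 2 * (2 ^ N * \<theta>) * I i j t"
        by (simp add: algebra_simps)
    qed
    also have "\<dots> = (1 + 2 * Os\<^sup>2) * m Q1 + 2 * (2 ^ N * \<theta>) * (\<Sum>t\<in>T. I i j t)"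
      by (simp add: sum.distrib sum_distrib_left msum[symmetric])
    also have "\<dots> \<le> (1 + 2 * Os\<^sup>2) * m Q1 + 2 * (2 ^ N * \<theta>) * (\<integral>y. (h i j y)\<^sup>2 \<partial>lborel)"
      using Isum \<theta>0 by (intro add_left_mono mult_left_mono) auto
    finally show ?thesis .
  qed
  have "(\<Sum>i\<in>UNIV. \<Sum>j\<in>UNIV. \<integral>x. h i j (\<phi> x) * E i j x \<partial>M)
     \<le> (\<Sum>i\<in>UNIV. \<Sum>j\<in>UNIV. (1 + 2 * Os\<^sup>2) * m Q1 + 2 * (2 ^ N * \<theta>) * (\<integral>y. (h i j y)\<^sup>2 \<partial>lborel))"
    by (intro sum_mono Eterm)
  also have "\<dots> = n\<^sup>2 * ((1 + 2 * Os\<^sup>2) * m Q1) + 2 * (2 ^ N * \<theta>) * (\<Sum>i\<in>UNIV. \<Sum>j\<in>UNIV. \<integral>y. (h i j y)\<^sup>2 \<partial>lborel)"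
    by (simp add: sum.distrib sum_distrib_left nn N power2_eq_square mult.assoc)
  also have "(\<Sum>i\<in>UNIV. \<Sum>j\<in>UNIV. \<integral>y. (h i j y)\<^sup>2 \<partial>lborel) \<le> 2 * (8 * 2 ^ N)\<^sup>2 * L ^ N"
  proof -
    have "(\<Sum>i\<in>UNIV. \<Sum>j\<in>UNIV. \<integral>y. (h i j y)\<^sup>2 \<partial>lborel) \<le> 2 * (8 * 2 ^ N)\<^sup>2 * measure lborel Z"
      unfolding h_def N by (rule kf.hess_L2)
    also have "\<dots> \<le> 2 * (8 * 2 ^ N)\<^sup>2 * L ^ N"
      using Zup power_mono[OF L0(2), of N] a by (intro mult_left_mono) auto
    finally show ?thesis .
  qed
  finally have Etot: "(\<Sum>i\<in>UNIV. \<Sum>j\<in>UNIV. \<integral>x. h i j (\<phi> x) * E i j x \<partial>M)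
    \<le> n\<^sup>2 * ((1 + 2 * Os\<^sup>2) * m Q1) + 2 * (2 ^ N * \<theta>) * (2 * (8 * 2 ^ N)\<^sup>2 * L ^ N)"
    using \<theta>0 by (simp add: mult_left_mono)
  \<comment> \<open>By the choice of \<theta>, \<open>\<theta> * L ^ N = \<Lambda> * m Q1\<close>:
    the L^2 bound, of the order of a volume, turns into a multiple of the mass of
    \<open>E\<close>.\<close>
  also have "\<dots> = (n\<^sup>2 * (1 + 2 * Os\<^sup>2) + 2 * 2 ^ N * \<Lambda> * (2 * (8 * 2 ^ N)\<^sup>2)) * m Q1"
    using L0 by (simp add: \<theta>_def algebra_simps)
  finally have Etot: "(\<Sum>i\<in>UNIV. \<Sum>j\<in>UNIV. \<integral>x. h i j (\<phi> x) * E i j x \<partial>M)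
    \<le> (n\<^sup>2 * (1 + 2 * Os\<^sup>2) + 2 * 2 ^ N * \<Lambda> * (2 * (8 * 2 ^ N)\<^sup>2)) * m Q1" .
  have iwD: "integrable M (\<lambda>x. w i (\<phi> x) * D i x)" for i
    unfolding w_def by (rule kf.field_Fubini(6)[OF M \<phi> D])
  have Dtot: "(\<Sum>i\<in>UNIV. \<integral>x. w i (\<phi> x) * D i x \<partial>M) \<le> 16 * n * 2 ^ N * a * (\<integral>x. indicator Q1 (\<phi> x) * DD x \<partial>M)"
  proof -
    have iD: "integrable M (\<lambda>x. indicator Q1 (\<phi> x) * \<bar>D i x\<bar>)" for i by (intro mi integrable_abs D) measurable
    have "(\<Sum>i\<in>UNIV. \<integral>x. w i (\<phi> x) * D i x \<partial>M) \<le> (\<Sum>i\<in>UNIV. \<integral>x. (8 * 2 ^ N * \<rho>) * (indicator Q1 (\<phi> x) * \<bar>D i x\<bar>) \<partial>M)"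
    proof (intro sum_mono integral_mono iwD integrable_mult_right iD)
      fix i x
      have "w i (\<phi> x) * D i x \<le> \<bar>w i (\<phi> x)\<bar> * \<bar>D i x\<bar>" by (metis abs_ge_self abs_mult)
      also have "\<dots> = indicator Q1 (\<phi> x) * (\<bar>w i (\<phi> x)\<bar> * \<bar>D i x\<bar>)" by (cases "\<phi> x \<in> Q1") (simp_all add: supp)
      also have "\<dots> \<le> indicator Q1 (\<phi> x) * ((8 * 2 ^ N * \<rho>) * \<bar>D i x\<bar>)"
        unfolding w_def N using kf.grad_bound by (intro mult_left_mono mult_right_mono) auto
      finally show "w i (\<phi> x) * D i x \<le> (8 * 2 ^ N * \<rho>) * (indicator Q1 (\<phi> x) * \<bar>D i x\<bar>)" by (simp add: algebra_simps)
    qed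
    also have "\<dots> = (8 * 2 ^ N * \<rho>) * (\<integral>x. indicator Q1 (\<phi> x) * DD x \<partial>M)"
      unfolding DD sum_distrib_left using iD by (subst Bochner_Integration.integral_sum) (auto simp: sum_distrib_left)
    finally show ?thesis by (simp add: \<rho>_def algebra_simps)
  qed
  \<comment> \<open>Points of \<open>A\<close> are mapped into \<open>K\<close>, and
    \<open>Z\<close> keeps a distance of at least \<sigma> from \<open>K\<close>.\<close>
  have Aconv: "indicator A x * kf.conv \<sigma> (\<phi> x) = (0::real)" for x
  proof (cases "x \<in> A")
    case True
    have "kf.conv \<sigma> (\<phi> x) = 0"
    proof (rule kf.conv_eq_0[OF \<sigma>(1)])
      fix y assume y: "y \<in> Z"
      have "\<not> dist y (\<phi> x) < \<delta>" using y K(3)[OF True] by (auto simp: Z_def KN_def)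
      then show "\<sigma> \<le> norm (\<phi> x - y)" using \<sigma>(3) by (simp add: dist_norm norm_minus_commute)
    qed
    then show ?thesis by simp
  qed simp
  have icA: "integrable M (\<lambda>x. indicator A x * kf.conv \<rho> (\<phi> x))"
  proof (rule M.integrable_const_bound[where B="8 * 2 ^ N"])
    show "AE x in M. norm (indicator A x * kf.conv \<rho> (\<phi> x)) \<le> 8 * 2 ^ N"
      using kf.conv_nonneg[OF \<rho>] kf.conv_le[OF \<rho>] by (intro AE_I2) (auto simp: indicator_def N)
  qed measurable
  have "27 / 16 / (2 * n) ^ N * (\<integral>x. indicator (cube c a) (\<phi> x) * indicator A x \<partial>M)
     = (\<integral>x. 27 / 16 / (2 * n) ^ N * (indicator (cube c a) (\<phi> x) * indicator A x) \<partial>M)" by simp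
  also have "\<dots> \<le> (\<integral>x. indicator A x * kf.conv \<rho> (\<phi> x) \<partial>M)"
  proof (intro integral_mono icA integrable_mult_right mi)
    show "integrable M (indicator A :: 'a \<Rightarrow> real)"
      by (intro integrable_real_indicator) (auto simp: M.emeasure_finite less_top[symmetric])
    fix x
    show "27 / 16 / (2 * n) ^ N * (indicator (cube c a) (\<phi> x) * indicator A x) \<le> indicator A x * kf.conv \<rho> (\<phi> x)"
    proof (cases "\<phi> x \<in> cube c a \<and> x \<in> A")
      case True
      \<comment> \<open>Half of the constant 27/8, because \<open>Z\<close> keeps half of the volume
        of the cube.\<close>
      have "27 / 16 / (2 * n) ^ N = (27/8) / \<rho> ^ N * (a ^ N / 2)"
        using a n1 by (simp add: \<rho>_def power_mult_distrib)
      also have "\<dots> \<le> (27/8) / \<rho> ^ N * measure lborel Z"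
        using Zlow \<rho> by (intro mult_left_mono) auto
      also have "\<dots> \<le> kf.conv \<rho> (\<phi> x)"
        unfolding N
      proof (rule kf.conv_lower[OF \<rho>])
        fix y assume "y \<in> Z"
        then have "norm (\<phi> x - y) \<le> real CARD('n) * a" using True Zc by (intro cube_norm_le[of _ c]) auto
        then show "norm (\<phi> x - y) \<le> \<rho> / 2" by (simp add: \<rho>_def nn N)
      qed
      finally show ?thesis using True by simp
    next
      case False
      then show ?thesis using kf.conv_nonneg[OF \<rho>] by (auto simp: indicator_def)
    qed
  qed (rule cube_measurable)
  also have "\<dots> = (\<integral>x. indicator A x * (kf.conv \<rho> (\<phi> x) - kf.conv \<sigma> (\<phi> x)) \<partial>M)"
    unfolding right_diff_distrib Aconv by simp
  also have "\<dots> = (\<Sum>i\<in>UNIV. \<Sum>j\<in>UNIV. \<integral>x. h i j (\<phi> x) * E i j x \<partial>M) + (\<Sum>i\<in>UNIV. \<integral>x. w i (\<phi> x) * D i x \<partial>M)"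
    unfolding h_def w_def by (rule kf.field_identity[OF M \<phi> A E D id])
  also have "\<dots> \<le> (n\<^sup>2 * (1 + 2 * Os\<^sup>2) + 2 * 2 ^ N * \<Lambda> * (2 * (8 * 2 ^ N)\<^sup>2)) * m Q1
      + 16 * n * 2 ^ N * a * (\<integral>x. indicator Q1 (\<phi> x) * DD x \<partial>M)"
    by (intro add_mono Etot Dtot)
  finally show ?thesis unfolding m_def .
qed

section \<open>Energy image density\<close>

lemma cube_integral_measurable:
  fixes \<phi> :: "'a \<Rightarrow> real^'n"
  assumes M: "finite_measure M" and \<phi> [measurable]: "\<phi> \<in> borel_measurable M" and [measurable]: "g \<in> borel_measurable M"
  shows "(\<lambda>(c, x). indicator (cube (c - (\<chi> i. b)) L) (\<phi> x) * g x :: real) \<in> borel_measurable (borel \<Otimes>\<^sub>M M)"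
    "(\<lambda>c. \<integral>x. indicator (cube (c - (\<chi> i. b)) L) (\<phi> x) * g x \<partial>M) \<in> borel_measurable borel"
proof -
  interpret M: finite_measure M by (rule M)
  have [measurable]: "indicator {z. snd z \<in> cube (fst z - (\<chi> i. b)) L} \<in> borel_measurable (borel \<Otimes>\<^sub>M (borel :: (real^'n) measure))"
    by (intro borel_measurable_indicator cube_pair_measurable)
  have "(\<lambda>w. indicator {z. snd z \<in> cube (fst z - (\<chi> i. b)) L} (fst w, \<phi> (snd w)) * g (snd w) :: real) \<in> borel_measurable (borel \<Otimes>\<^sub>M M)"
    by measurable
  then show 1: "(\<lambda>(c, x). indicator (cube (c - (\<chi> i. b)) L) (\<phi> x) * g x :: real) \<in> borel_measurable (borel \<Otimes>\<^sub>M M)"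
    by (simp add: case_prod_unfold indicator_def)
  show "(\<lambda>c. \<integral>x. indicator (cube (c - (\<chi> i. b)) L) (\<phi> x) * g x \<partial>M) \<in> borel_measurable borel"
    using M.borel_measurable_lebesgue_integral[OF 1] .
qed

text \<open>For fixed \<open>x\<close> the corners whose cube contains \<open>\<phi> x\<close> have
  measure \<open>L ^ CARD('n)\<close>, so Tonelli turns the localised integrals into global ones,
  with no covering by disjoint cubes and no count of overlaps.\<close>

lemma nn_cube_average:
  fixes \<phi> :: "'a \<Rightarrow> real^'n"
  assumes M: "finite_measure M" and \<phi> [measurable]: "\<phi> \<in> borel_measurable M"
    and g: "integrable M g" "\<And>x. 0 \<le> g x" and L: "0 \<le> L"
  shows "(\<integral>\<^sup>+c. ennreal (\<integral>x. indicator (cube (c - (\<chi> i. b)) L) (\<phi> x) * g x \<partial>M) \<partial>lborel) = ennreal (L ^ CARD('n) * (\<integral>x. g x \<partial>M))"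
proof -
  interpret M: finite_measure M by (rule M)
  interpret LM: pair_sigma_finite lborel M ..
  have [measurable]: "g \<in> borel_measurable M" using g by auto
  note m = cube_integral_measurable(1)[OF M \<phi>, of g b L]
  have mi: "integrable M (\<lambda>x. indicator (cube c L) (\<phi> x) * g x)" for c
  proof (rule Bochner_Integration.integrable_bound[OF g(1)])
    show "(\<lambda>x. indicator (cube c L) (\<phi> x) * g x) \<in> borel_measurable M"
      using cube_measurable[of c L] by measurable
  qed (auto simp: indicator_def)
  have "(\<integral>\<^sup>+c. ennreal (\<integral>x. indicator (cube (c - (\<chi> i. b)) L) (\<phi> x) * g x \<partial>M) \<partial>lborel)
    = (\<integral>\<^sup>+c. \<integral>\<^sup>+x. ennreal (indicator (cube (c - (\<chi> i. b)) L) (\<phi> x) * g x) \<partial>M \<partial>lborel)"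
    using g(2) by (intro nn_integral_cong nn_integral_eq_integral[symmetric] mi AE_I2) auto
  also have "\<dots> = (\<integral>\<^sup>+x. \<integral>\<^sup>+c. ennreal (indicator (cube (c - (\<chi> i. b)) L) (\<phi> x) * g x) \<partial>lborel \<partial>M)"
    using m by (intro LM.Fubini'[symmetric]) (simp add: case_prod_unfold)
  also have "\<dots> = (\<integral>\<^sup>+x. ennreal (L ^ CARD('n)) * ennreal (g x) \<partial>M)"
  proof (rule nn_integral_cong)
    fix x
    have [measurable]: "{c. \<phi> x \<in> cube (c - (\<chi> i. b)) L} \<in> sets borel" by (rule cube_corners_measurable)
    have "(\<integral>\<^sup>+c. ennreal (indicator (cube (c - (\<chi> i. b)) L) (\<phi> x) * g x) \<partial>lborel)
      = (\<integral>\<^sup>+c. ennreal (g x) * indicator {c. \<phi> x \<in> cube (c - (\<chi> i. b)) L} c \<partial>lborel)"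
      by (intro nn_integral_cong) (auto simp: indicator_def)
    also have "\<dots> = ennreal (L ^ CARD('n)) * ennreal (g x)"
      using L by (simp add: nn_integral_cmult_indicator emeasure_cube_corners mult.commute)
    finally show "(\<integral>\<^sup>+c. ennreal (indicator (cube (c - (\<chi> i. b)) L) (\<phi> x) * g x) \<partial>lborel) = ennreal (L ^ CARD('n)) * ennreal (g x)" .
  qed
  also have "\<dots> = ennreal (L ^ CARD('n)) * (\<integral>\<^sup>+x. ennreal (g x) \<partial>M)" by (intro nn_integral_cmult) measurable
  also have "(\<integral>\<^sup>+x. ennreal (g x) \<partial>M) = ennreal (\<integral>x. g x \<partial>M)"
    using g by (intro nn_integral_eq_integral) auto
  finally show ?thesis using L by (simp add: ennreal_mult')
qed

text \<open>Averaging the inequality over all cubes of side \<open>a\<close> and letting \<open>a\<close> tend to 0 removes the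
  divergence term.\<close>

lemma mass_bound:
  fixes n :: real
  assumes N: "N = CARD('n::finite)" and n: "n = real N"
  obtains C :: real where "\<And>(M :: 'a measure) (\<phi> :: 'a \<Rightarrow> real^'n) A E D K.
    finite_measure M \<Longrightarrow> \<phi> \<in> borel_measurable M \<Longrightarrow> A \<in> sets M \<Longrightarrow>
    (\<And>i j. integrable M (E i j)) \<Longrightarrow> (\<And>i. integrable M (D i)) \<Longrightarrow>
    (\<And>s y. 0 < s \<Longrightarrow> (\<integral>x. indicator A x * (\<Sum>i\<in>UNIV. bump2 i i s (\<phi> x - y)) \<partial>M)
       = (\<Sum>i\<in>UNIV. \<Sum>j\<in>UNIV. \<integral>x. bump2 i j s (\<phi> x - y) * E i j x \<partial>M)
         + (\<Sum>i\<in>UNIV. \<integral>x. bump1 i s (\<phi> x - y) * D i x \<partial>M)) \<Longrightarrow>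
    compact K \<Longrightarrow> emeasure lborel K = 0 \<Longrightarrow> (\<And>x. x \<in> A \<Longrightarrow> \<phi> x \<in> K) \<Longrightarrow>
    measure M A \<le> C * (\<Sum>i\<in>UNIV. \<Sum>j\<in>UNIV. \<integral>x. \<bar>E i j x\<bar> \<partial>M)"
proof -
  define Os where "Os = 672 * 2 ^ N * n"
  define \<Lambda> where "\<Lambda> = 4 * 3 ^ N * (4 * n + 1) ^ N"
  define c1 where "c1 = 27 / 16 / (2 * n) ^ N"
  define C2 where "C2 = n\<^sup>2 * (1 + 2 * Os\<^sup>2) + 2 * 2 ^ N * \<Lambda> * (2 * (8 * 2 ^ N)\<^sup>2)"
  define C3 where "C3 = 16 * n * 2 ^ N"
  define q where "q = (4 * n + 1) ^ N"
  have n1: "1 \<le> n" using N n by (simp add: Suc_leI)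
  have pos: "0 < c1" "0 \<le> C2" "0 \<le> C3" "0 < q" using n1 by (auto simp: c1_def C2_def C3_def q_def \<Lambda>_def)
  show ?thesis
  proof (rule that[of "q * C2 / c1"])
    fix M :: "'a measure" and \<phi> :: "'a \<Rightarrow> real^'n" and A E D K
    assume M: "finite_measure M" and \<phi> [measurable]: "\<phi> \<in> borel_measurable M" and A [measurable]: "A \<in> sets M"
      and E: "\<And>i j. integrable M (E i j)" and D: "\<And>i. integrable M (D i)"
      and id: "\<And>s y. 0 < s \<Longrightarrow> (\<integral>x. indicator A x * (\<Sum>i\<in>UNIV. bump2 i i s (\<phi> x - y)) \<partial>M)
       = (\<Sum>i\<in>UNIV. \<Sum>j\<in>UNIV. \<integral>x. bump2 i j s (\<phi> x - y) * E i j x \<partial>M)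
         + (\<Sum>i\<in>UNIV. \<integral>x. bump1 i s (\<phi> x - y) * D i x \<partial>M)"
      and K: "compact K" "emeasure lborel K = 0" "\<And>x. x \<in> A \<Longrightarrow> \<phi> x \<in> K"
    interpret M: finite_measure M by (rule M)
    define EE where "EE = (\<lambda>x. \<Sum>i\<in>UNIV. \<Sum>j\<in>UNIV. \<bar>E i j x\<bar>)"
    define DD where "DD = (\<lambda>x. \<Sum>i\<in>UNIV. \<bar>D i x\<bar>)"
    have EEi: "integrable M EE" unfolding EE_def by (intro Bochner_Integration.integrable_sum integrable_abs E)
    have DDi: "integrable M DD" unfolding DD_def by (intro Bochner_Integration.integrable_sum integrable_abs D)
    have EE0: "0 \<le> EE x" for x unfolding EE_def by (intro sum_nonneg) auto
    have DD0: "0 \<le> DD x" for x unfolding DD_def by (intro sum_nonneg) auto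
    have iA: "integrable M (indicator A :: 'a \<Rightarrow> real)"
      by (intro integrable_real_indicator) (auto simp: M.emeasure_finite less_top[symmetric])
    have [measurable]: "EE \<in> borel_measurable M" "DD \<in> borel_measurable M" using EEi DDi by auto
    have mu: "(\<integral>x. indicator A x \<partial>M) = measure M A" by simp
    have bound: "c1 * measure M A \<le> q * (C2 * (\<integral>x. EE x \<partial>M) + C3 * a * (\<integral>x. DD x \<partial>M))" if a: "0 < a" for a
    proof -
      define L where "L = (4 * n + 1) * a"
      have L: "0 \<le> L" using a n1 by (simp add: L_def)
      define Q0 where "Q0 c = (\<integral>x. indicator (cube (c - (\<chi> i. 0)) a) (\<phi> x) * (indicator A x :: real) \<partial>M)" for c :: "real^'n"
      define QE where "QE c = (\<integral>x. indicator (cube (c - (\<chi> i. 2 * n * a)) L) (\<phi> x) * EE x \<partial>M)" for c :: "real^'n"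
      define QD where "QD c = (\<integral>x. indicator (cube (c - (\<chi> i. 2 * n * a)) L) (\<phi> x) * DD x \<partial>M)" for c :: "real^'n"
      have [measurable]: "Q0 \<in> borel_measurable borel"
        unfolding Q0_def[abs_def] by (rule cube_integral_measurable(2)[OF M \<phi>]) measurable
      have [measurable]: "QE \<in> borel_measurable borel"
        unfolding QE_def[abs_def] by (rule cube_integral_measurable(2)[OF M \<phi>]) measurable
      have [measurable]: "QD \<in> borel_measurable borel"
        unfolding QD_def[abs_def] by (rule cube_integral_measurable(2)[OF M \<phi>]) measurable
      have nonneg: "0 \<le> Q0 c" "0 \<le> QE c" "0 \<le> QD c" for c
        unfolding Q0_def QE_def QD_def using EE0 DD0 by (auto intro!: Bochner_Integration.integral_nonneg)
      have c0: "c - (\<chi> i. 0) = c" for c :: "real^'n" by (simp add: vec_eq_iff)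
      have ineq: "c1 * Q0 c \<le> C2 * QE c + C3 * a * QD c" for c
        unfolding c1_def C2_def C3_def Q0_def QE_def QD_def c0
        by (rule cube_inequality[OF M \<phi> A E D id K a N n Os_def L_def \<Lambda>_def EE_def DD_def refl])
      have "ennreal c1 * ennreal (a ^ N * (\<integral>x. indicator A x \<partial>M)) = ennreal c1 * (\<integral>\<^sup>+c. ennreal (Q0 c) \<partial>lborel)"
        unfolding Q0_def N using a by (subst nn_cube_average[OF M \<phi> iA]) auto
      also have "\<dots> = (\<integral>\<^sup>+c. ennreal (c1 * Q0 c) \<partial>lborel)"
        using pos nonneg by (simp add: ennreal_mult' nn_integral_cmult)
      also have "\<dots> \<le> (\<integral>\<^sup>+c. ennreal (C2 * QE c + C3 * a * QD c) \<partial>lborel)"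
        using ineq by (intro nn_integral_mono ennreal_leI)
      also have "\<dots> = (\<integral>\<^sup>+c. ennreal C2 * ennreal (QE c) + ennreal (C3 * a) * ennreal (QD c) \<partial>lborel)"
        using pos nonneg a by (intro nn_integral_cong) (simp add: ennreal_mult)
      also have "\<dots> = ennreal C2 * (\<integral>\<^sup>+c. ennreal (QE c) \<partial>lborel) + ennreal (C3 * a) * (\<integral>\<^sup>+c. ennreal (QD c) \<partial>lborel)"
        by (subst nn_integral_add) (auto simp: nn_integral_cmult)
      also have "(\<integral>\<^sup>+c. ennreal (QE c) \<partial>lborel) = ennreal (L ^ N * (\<integral>x. EE x \<partial>M))"
        unfolding QE_def N by (rule nn_cube_average[OF M \<phi> EEi EE0 L])
      also have "(\<integral>\<^sup>+c. ennreal (QD c) \<partial>lborel) = ennreal (L ^ N * (\<integral>x. DD x \<partial>M))"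
        unfolding QD_def N by (rule nn_cube_average[OF M \<phi> DDi DD0 L])
      also have "ennreal C2 * ennreal (L ^ N * (\<integral>x. EE x \<partial>M)) + ennreal (C3 * a) * ennreal (L ^ N * (\<integral>x. DD x \<partial>M))
        = ennreal (C2 * (L ^ N * (\<integral>x. EE x \<partial>M)) + C3 * a * (L ^ N * (\<integral>x. DD x \<partial>M)))"
        using pos a L EE0 DD0 by (simp add: ennreal_mult Bochner_Integration.integral_nonneg)
      also have "ennreal c1 * ennreal (a ^ N * (\<integral>x. indicator A x \<partial>M)) = ennreal (c1 * (a ^ N * measure M A))"
        using pos a by (simp add: mu ennreal_mult)
      finally have "c1 * (a ^ N * measure M A) \<le> C2 * (L ^ N * (\<integral>x. EE x \<partial>M)) + C3 * a * (L ^ N * (\<integral>x. DD x \<partial>M))"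
        using pos a L EE0 DD0 by (subst (asm) ennreal_le_iff) (auto intro!: add_nonneg_nonneg mult_nonneg_nonneg Bochner_Integration.integral_nonneg)
      \<comment> \<open>\<open>L\<close> is proportional to \<open>a\<close>, so the volumes cancel
        on both sides and only the term with \<open>DD\<close> keeps a factor
        \<open>a\<close>.\<close>
      also have "L ^ N = q * a ^ N" by (simp add: L_def q_def power_mult_distrib)
      finally have "a ^ N * (c1 * measure M A) \<le> a ^ N * (q * (C2 * (\<integral>x. EE x \<partial>M) + C3 * a * (\<integral>x. DD x \<partial>M)))"
        by (simp add: algebra_simps)
      then show ?thesis using a by (simp only: mult_le_cancel_left_pos zero_less_power)
    qed
    have "(\<lambda>k. q * (C2 * (\<integral>x. EE x \<partial>M) + C3 * (1 / real (Suc k)) * (\<integral>x. DD x \<partial>M)))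
       \<longlonglongrightarrow> q * (C2 * (\<integral>x. EE x \<partial>M) + C3 * 0 * (\<integral>x. DD x \<partial>M))"
      using LIMSEQ_inverse_real_of_nat by (intro tendsto_intros) (simp add: inverse_eq_divide)
    then have "c1 * measure M A \<le> q * (C2 * (\<integral>x. EE x \<partial>M) + C3 * 0 * (\<integral>x. DD x \<partial>M))"
      by (rule LIMSEQ_le_const) (intro exI[of _ 0] allI impI bound, simp)
    then have "measure M A \<le> q * C2 / c1 * (\<integral>x. EE x \<partial>M)" using pos by (simp add: field_simps)
    also have "(\<integral>x. EE x \<partial>M) = (\<Sum>i\<in>UNIV. \<Sum>j\<in>UNIV. \<integral>x. \<bar>E i j x\<bar> \<partial>M)"
      unfolding EE_def using E by simp
    finally show "measure M A \<le> q * C2 / c1 * (\<Sum>i\<in>UNIV. \<Sum>j\<in>UNIV. \<integral>x. \<bar>E i j x\<bar> \<partial>M)" .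
  qed
qed

context carre_structure
begin

text \<open>The constant of \<open>mass_bound\<close> is fixed before the approximation is chosen.
  \<open>small_divergence\<close> then makes the mass of \<open>E\<close> arbitrarily small, and the
  accompanying \<open>D\<close>, however large, does not enter the bound.\<close>

lemma null_if_bounded_inverse:
  fixes \<phi> :: "'n::finite \<Rightarrow> 'a \<Rightarrow> real" and \<beta> :: "'n \<Rightarrow> 'n \<Rightarrow> 'a \<Rightarrow> real"
  assumes \<phi>: "\<And>i. \<phi> i \<in> \<F>b" and A [measurable]: "A \<in> sets M"
    and \<beta> [measurable]: "\<And>i l. \<beta> i l \<in> borel_measurable M" and \<beta>C: "\<And>i l x. \<bar>\<beta> i l x\<bar> \<le> C"
    and inv: "\<And>x i j. x \<in> A \<Longrightarrow> (\<Sum>l\<in>UNIV. \<beta> i l x * \<gamma> (\<phi> l) (\<phi> j) x) = (if i = j then 1 else 0)"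
    and K: "compact K" "emeasure lborel K = 0" "\<And>x. x \<in> A \<Longrightarrow> (\<chi> i. \<phi> i x) \<in> K"
  shows "measure M A = 0"
proof -
  have m: "(\<lambda>x. (\<chi> i. \<phi> i x)) \<in> borel_measurable M" by (intro vec_measurable dom_meas) (use \<phi> in auto)
  show ?thesis
  proof (rule mass_bound[OF refl refl, where 'n='n and 'a='a])
    fix C0
    assume C0: "\<And>(M :: 'a measure) (\<phi> :: 'a \<Rightarrow> real^'n) A E D K.
    finite_measure M \<Longrightarrow> \<phi> \<in> borel_measurable M \<Longrightarrow> A \<in> sets M \<Longrightarrow>
    (\<And>i j. integrable M (E i j)) \<Longrightarrow> (\<And>i. integrable M (D i)) \<Longrightarrow>
    (\<And>s y. 0 < s \<Longrightarrow> (\<integral>x. indicator A x * (\<Sum>i\<in>UNIV. bump2 i i s (\<phi> x - y)) \<partial>M)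
       = (\<Sum>i\<in>UNIV. \<Sum>j\<in>UNIV. \<integral>x. bump2 i j s (\<phi> x - y) * E i j x \<partial>M)
         + (\<Sum>i\<in>UNIV. \<integral>x. bump1 i s (\<phi> x - y) * D i x \<partial>M)) \<Longrightarrow>
    compact K \<Longrightarrow> emeasure lborel K = 0 \<Longrightarrow> (\<And>x. x \<in> A \<Longrightarrow> \<phi> x \<in> K) \<Longrightarrow>
    measure M A \<le> C0 * (\<Sum>i\<in>UNIV. \<Sum>j\<in>UNIV. \<integral>x. \<bar>E i j x\<bar> \<partial>M)"
    have le: "measure M A \<le> \<bar>C0\<bar> * e" if e: "0 < e" for e
    proof (rule small_divergence[OF \<phi> A \<beta> \<beta>C inv e])
      fix E :: "'n \<Rightarrow> 'n \<Rightarrow> 'a \<Rightarrow> real" and D :: "'n \<Rightarrow> 'a \<Rightarrow> real"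
      assume E: "\<And>i j. integrable M (E i j)" and D: "\<And>i. integrable M (D i)"
        and s: "(\<Sum>i\<in>UNIV. \<Sum>j\<in>UNIV. \<integral>x. \<bar>E i j x\<bar> \<partial>M) \<le> e"
        and id: "\<And>s y. 0 < s \<Longrightarrow> (\<integral>x. indicator A x * (\<Sum>i\<in>UNIV. bump2 i i s ((\<chi> k. \<phi> k x) - y)) \<partial>M)
       = (\<Sum>i\<in>UNIV. \<Sum>j\<in>UNIV. \<integral>x. bump2 i j s ((\<chi> k. \<phi> k x) - y) * E i j x \<partial>M)
         + (\<Sum>i\<in>UNIV. \<integral>x. bump1 i s ((\<chi> k. \<phi> k x) - y) * D i x \<partial>M)"
      have "measure M A \<le> C0 * (\<Sum>i\<in>UNIV. \<Sum>j\<in>UNIV. \<integral>x. \<bar>E i j x\<bar> \<partial>M)"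
        by (rule C0[OF finite_measure_axioms m A E D id K])
      also have "\<dots> \<le> \<bar>C0\<bar> * e"
        using s by (intro mult_mono) (auto intro!: sum_nonneg)
      finally show "measure M A \<le> \<bar>C0\<bar> * e" .
    qed
    have "measure M A \<le> 0"
    proof (rule field_le_epsilon)
      fix e :: real assume e: "0 < e"
      have "measure M A \<le> \<bar>C0\<bar> * (e / (\<bar>C0\<bar> + 1))" using e by (intro le) simp
      also have "\<dots> \<le> e" using e by (simp add: field_simps)
      finally show "measure M A \<le> 0 + e" by simp
    qed
    then show "measure M A = 0" by (intro antisym) auto
  qed
qed

end

section \<open>Reduction to a compact null set and bounded data\<close>

lemma det_measurable:
  fixes F :: "'n::finite \<Rightarrow> 'n \<Rightarrow> 'a \<Rightarrow> real"
  assumes "\<And>i j. F i j \<in> borel_measurable M"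
  shows "(\<lambda>x. det (\<chi> i j. F i j x)) \<in> borel_measurable M"
  unfolding det_def using assms by simp

theorem theorem1p7:
  fixes M :: "'a measure"
    and \<E> :: "('a \<Rightarrow> real) \<Rightarrow> ('a \<Rightarrow> real) \<Rightarrow> real"
    and \<F> :: "('a \<Rightarrow> real) set"
    and \<gamma> :: "('a \<Rightarrow> real) \<Rightarrow> ('a \<Rightarrow> real) \<Rightarrow> 'a \<Rightarrow> real"
    and \<phi> :: "'n::finite \<Rightarrow> 'a \<Rightarrow> real"
  assumes "dirichlet_structure M \<E> \<F>"
    and "carre_du_champ M \<E> \<F> \<gamma>"
    and "\<And>i. \<phi> i \<in> \<F>"
  shows "absolutely_continuous (lborel :: (real ^ 'n) measure)
           (distr (density M (indicator {x \<in> space M. det (carre_matrix \<gamma> \<phi> x) > 0}))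
              lborel (\<lambda>x. \<chi> i. \<phi> i x))"
proof -
  interpret carre_structure M \<E> \<F> \<gamma>
    using assms(1,2) by (intro carre_structure.intro carre_structure_axioms.intro)
  note \<phi> = assms(3)
  have \<phi>m [measurable]: "\<phi> i \<in> borel_measurable M" for i using \<phi> dom_meas by auto
  define \<Phi> where "\<Phi> x = (\<chi> i. \<phi> i x)" for x
  have \<Phi> [measurable]: "\<Phi> \<in> borel_measurable M" unfolding \<Phi>_def[abs_def] by (rule vec_measurable) measurable
  define \<Gamma> where "\<Gamma> i j = \<gamma> (\<phi> i) (\<phi> j)" for i j
  have \<Gamma>m [measurable]: "\<Gamma> i j \<in> borel_measurable M" for i j unfolding \<Gamma>_def by (intro carre_meas \<phi>)
  define d where "d x = det (carre_matrix \<gamma> \<phi> x)" for x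
  have d: "d x = det (\<chi> i j. \<Gamma> i j x)" for x by (simp add: d_def carre_matrix_def \<Gamma>_def)
  have dm [measurable]: "d \<in> borel_measurable M" unfolding d[abs_def] by (rule det_measurable) measurable
  define S where "S = {x \<in> space M. d x > 0}"
  have [measurable]: "S \<in> sets M" unfolding S_def by measurable
  \<comment> \<open>Cramer's rule, so that the inverse matrix is visibly measurable. For fixed
    \<open>i\<close> these are the solutions of the transposed system with the unit vector
    \<open>i\<close> on the right.\<close>
  define \<beta> where "\<beta> i l x = det (\<chi> a b. if b = l then axis i 1 $ a else \<Gamma> b a x) / d x" for i l x
  have \<beta>m [measurable]: "\<beta> i l \<in> borel_measurable M" for i l
  proof -
    have "(\<lambda>x. det (\<chi> a b. (\<lambda>x. if b = l then axis i 1 $ a else \<Gamma> b a x) x)) \<in> borel_measurable M"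
      by (rule det_measurable) measurable
    then show ?thesis unfolding \<beta>_def[abs_def] by measurable
  qed
  have inv: "(\<Sum>l\<in>UNIV. \<beta> i l x * \<Gamma> l j x) = (if i = j then 1 else 0)" if x: "x \<in> S" for x i j
  proof -
    define G :: "real^'n^'n" where "G = (\<chi> a b. \<Gamma> b a x)"
    have "G = transpose (\<chi> i j. \<Gamma> i j x)" by (simp add: G_def transpose_def)
    then have dG: "det G = d x" by (simp add: d det_transpose)
    then have nz: "det G \<noteq> 0" using x by (simp add: S_def)
    have "G *v (\<chi> l. \<beta> i l x) = axis i 1"
      unfolding cramer[OF nz] dG by (simp add: \<beta>_def G_def cong: if_cong)
    then have "(G *v (\<chi> l. \<beta> i l x)) $ j = axis i 1 $ j" by simp
    then show ?thesis by (simp add: matrix_vector_mult_def G_def axis_def mult.commute)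
  qed
  show ?thesis
    unfolding absolutely_continuous_def
  proof
    fix B :: "(real^'n) set" assume B: "B \<in> null_sets lborel"
    then have Bm [measurable]: "B \<in> sets borel" by auto
    \<comment> \<open>These sets exhaust \<open>S\<close> up to a null set. The equality of
      densities is imposed point by point, since \<gamma> of the truncated functions agrees with
      \<open>\<Gamma>\<close> only almost everywhere, while \<open>null_if_bounded_inverse\<close>
      asks for the inverse at every point of its set.\<close>
    define R where "R m = {x \<in> space M. x \<in> S \<and> (\<forall>i. \<bar>\<phi> i x\<bar> < real (Suc m)) \<and> (\<forall>i l. \<bar>\<beta> i l x\<bar> \<le> real m)
       \<and> (\<forall>i j. \<gamma> (\<lambda>x. trunc (real (Suc m)) (\<phi> i x)) (\<lambda>x. trunc (real (Suc m)) (\<phi> j x)) x = \<Gamma> i j x)}" for m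
    have t: "(\<lambda>x. trunc (real (Suc m)) (\<phi> i x)) \<in> \<F>b" for i m by (intro trunc_Fb \<phi>) simp
    have tm [measurable]: "\<gamma> (\<lambda>x. trunc (real (Suc m)) (\<phi> i x)) (\<lambda>x. trunc (real (Suc m)) (\<phi> j x)) \<in> borel_measurable M" for i j m
      using t[of m i] t[of m j] by (intro carre_meas) auto
    have Rm [measurable]: "R m \<in> sets M" for m
    proof -
      have "R m = S \<inter> (\<Inter>i. {x \<in> space M. \<bar>\<phi> i x\<bar> < real (Suc m)}) \<inter> (\<Inter>i. \<Inter>l. {x \<in> space M. \<bar>\<beta> i l x\<bar> \<le> real m})
        \<inter> (\<Inter>i. \<Inter>j. {x \<in> space M. \<gamma> (\<lambda>x. trunc (real (Suc m)) (\<phi> i x)) (\<lambda>x. trunc (real (Suc m)) (\<phi> j x)) x = \<Gamma> i j x})"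
        unfolding R_def S_def by blast
      moreover have "{x \<in> space M. \<bar>\<phi> i x\<bar> < real (Suc m)} \<in> sets M" "{x \<in> space M. \<bar>\<beta> i l x\<bar> \<le> real m} \<in> sets M"
        "{x \<in> space M. \<gamma> (\<lambda>x. trunc (real (Suc m)) (\<phi> i x)) (\<lambda>x. trunc (real (Suc m)) (\<phi> j x)) x = \<Gamma> i j x} \<in> sets M" for i j l
        by measurable
      ultimately show ?thesis by (simp add: sets.Int sets.finite_INT)
    qed
    have R0: "measure M (R m \<inter> \<Phi> -` B) = 0" for m
    proof (rule ccontr)
      assume ne: "measure M (R m \<inter> \<Phi> -` B) \<noteq> 0"
      \<comment> \<open>A finite Borel measure on a Euclidean space is inner regular; this replaces
        the null set \<open>B\<close> by a compact one that still has positive mass.\<close>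
      define \<nu> where "\<nu> = distr (density M (indicator (R m))) borel \<Phi>"
      have \<nu>: "emeasure \<nu> X = emeasure M (R m \<inter> \<Phi> -` X)" if [measurable]: "X \<in> sets borel" for X
      proof -
        have "emeasure \<nu> X = emeasure (density M (indicator (R m))) (\<Phi> -` X \<inter> space M)"
          unfolding \<nu>_def by (subst emeasure_distr) auto
        also have "\<dots> = (\<integral>\<^sup>+x. indicator (R m) x * indicator (\<Phi> -` X \<inter> space M) x \<partial>M)"
          by (subst emeasure_density) auto
        also have "\<dots> = (\<integral>\<^sup>+x. indicator (R m \<inter> \<Phi> -` X) x \<partial>M)"
          by (intro nn_integral_cong) (auto simp: indicator_def)
        also have "\<dots> = emeasure M (R m \<inter> \<Phi> -` X)"
        proof (rule nn_integral_indicator)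
          have "R m \<inter> \<Phi> -` X = R m \<inter> (\<Phi> -` X \<inter> space M)" using sets.sets_into_space[OF Rm[of m]] by blast
          then show "R m \<inter> \<Phi> -` X \<in> sets M" by simp
        qed
        finally show ?thesis .
      qed
      have "emeasure \<nu> B = (SUP K \<in> {K. K \<subseteq> B \<and> compact K}. emeasure \<nu> K)"
      proof (rule inner_regular)
        show "emeasure \<nu> (space \<nu>) \<noteq> \<infinity>"
          using \<nu>[of UNIV] by (simp add: \<nu>_def)
      qed (auto simp: \<nu>_def)
      moreover have "emeasure \<nu> B \<noteq> 0" using ne \<nu>[OF Bm] by (auto simp: measure_def)
      ultimately have "\<exists>K. K \<subseteq> B \<and> compact K \<and> emeasure \<nu> K \<noteq> 0"
        by (metis (mono_tags, lifting) SUP_bot_conv(1) bot_ennreal mem_Collect_eq)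
      then obtain K where K: "K \<subseteq> B" "compact K" "emeasure \<nu> K \<noteq> 0" by blast
      have Km [measurable]: "K \<in> sets borel" using K(2) by (simp add: borel_compact)
      have K0: "emeasure lborel K = 0" using K(1) B Km by (metis emeasure_eq_0 null_setsD1 null_setsD2 sets_lborel)
      define A where "A = R m \<inter> \<Phi> -` K"
      have Am [measurable]: "A \<in> sets M"
      proof -
        have "A = R m \<inter> (\<Phi> -` K \<inter> space M)" using sets.sets_into_space[OF Rm[of m]] unfolding A_def by blast
        then show ?thesis by simp
      qed
      \<comment> \<open>The bound on \<open>\<beta>\<close> holds on \<open>R m\<close> only, so the
        weights are cut off by the indicator of \<open>A\<close>; on \<open>A\<close> the truncated
        functions equal the original ones.\<close>
      have "measure M A = 0"
      proof (rule null_if_bounded_inverse[OF t[of m] Am, where \<beta>="\<lambda>i l x. indicator A x * \<beta> i l x" and C="real m"])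
        show "(\<lambda>x. indicator A x * \<beta> i l x) \<in> borel_measurable M" for i l by measurable
        show "\<bar>indicator A x * \<beta> i l x\<bar> \<le> real m" for i l x
          by (cases "x \<in> A") (auto simp: A_def R_def)
        fix x assume x: "x \<in> A"
        then have xR: "x \<in> R m" "\<Phi> x \<in> K" by (auto simp: A_def)
        show "(\<Sum>l\<in>UNIV. indicator A x * \<beta> i l x * \<gamma> (\<lambda>x. trunc (real (Suc m)) (\<phi> l x)) (\<lambda>x. trunc (real (Suc m)) (\<phi> j x)) x)
          = (if i = j then 1 else 0)" for i j
        proof -
          have "\<gamma> (\<lambda>x. trunc (real (Suc m)) (\<phi> l x)) (\<lambda>x. trunc (real (Suc m)) (\<phi> j x)) x = \<Gamma> l j x" for l
            using xR by (simp add: R_def)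
          moreover have "x \<in> S" using xR by (simp add: R_def)
          ultimately show ?thesis using x inv[of x i j] by simp
        qed
        have "trunc (real (Suc m)) (\<phi> i x) = \<phi> i x" for i using xR by (intro trunc_id) (auto simp: R_def less_imp_le)
        then show "(\<chi> i. trunc (real (Suc m)) (\<phi> i x)) \<in> K" using xR by (simp add: \<Phi>_def)
      qed (use K K0 in auto)
      then have "emeasure M A = 0" by (simp add: emeasure_eq_measure)
      then show False using K(3) \<nu>[OF Km] by (simp add: A_def)
    qed
    \<comment> \<open>Off this null set the last condition in \<open>R m\<close> follows from the
      bounds on \<open>\<phi>\<close>, so every remaining point of \<open>S\<close> lies in some
      \<open>R m\<close>.\<close>
    have eqAE: "AE x in M. \<forall>m i j. \<bar>\<phi> i x\<bar> < real (Suc m) \<longrightarrow> \<bar>\<phi> j x\<bar> < real (Suc m) \<longrightarrow>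
      \<Gamma> i j x = \<gamma> (\<lambda>x. trunc (real (Suc m)) (\<phi> i x)) (\<lambda>x. trunc (real (Suc m)) (\<phi> j x)) x"
      unfolding \<Gamma>_def AE_all_countable by (intro allI carre_trunc \<phi>) simp
    have RB: "AE x in M. x \<notin> R m \<inter> \<Phi> -` B" for m
    proof -
      have "R m \<inter> \<Phi> -` B = R m \<inter> (\<Phi> -` B \<inter> space M)" using sets.sets_into_space[OF Rm[of m]] by blast
      then have "R m \<inter> \<Phi> -` B \<in> sets M" by simp
      then have "R m \<inter> \<Phi> -` B \<in> null_sets M" using R0 by (intro null_setsI) (simp_all add: emeasure_eq_measure)
      then show ?thesis by (rule AE_not_in)
    qed
    have "AE x in M. \<forall>m. x \<notin> R m \<inter> \<Phi> -` B" unfolding AE_all_countable using RB by blast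
    then have "AE x in M. x \<notin> S \<inter> \<Phi> -` B"
      using eqAE AE_space
    proof eventually_elim
      fix x assume 1: "\<forall>m. x \<notin> R m \<inter> \<Phi> -` B" and 2: "\<forall>m i j. \<bar>\<phi> i x\<bar> < real (Suc m) \<longrightarrow> \<bar>\<phi> j x\<bar> < real (Suc m) \<longrightarrow>
        \<Gamma> i j x = \<gamma> (\<lambda>x. trunc (real (Suc m)) (\<phi> i x)) (\<lambda>x. trunc (real (Suc m)) (\<phi> j x)) x" and 3: "x \<in> space M"
      show "x \<notin> S \<inter> \<Phi> -` B"
      proof
        assume xS: "x \<in> S \<inter> \<Phi> -` B"
        define b where "b = (\<Sum>i\<in>UNIV. \<bar>\<phi> i x\<bar>) + (\<Sum>i\<in>UNIV. \<Sum>l\<in>UNIV. \<bar>\<beta> i l x\<bar>)"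
        obtain m where m: "b \<le> real m" using real_arch_simple by blast
        have s0: "0 \<le> (\<Sum>i\<in>UNIV. \<bar>\<phi> i x\<bar>)" "0 \<le> (\<Sum>i\<in>UNIV. \<Sum>l\<in>UNIV. \<bar>\<beta> i l x\<bar>)" by (auto intro!: sum_nonneg)
        have p1: "\<bar>\<phi> i x\<bar> < real (Suc m)" for i
        proof -
          have "\<bar>\<phi> i x\<bar> \<le> (\<Sum>i\<in>UNIV. \<bar>\<phi> i x\<bar>)" by (intro member_le_sum) auto
          then have "\<bar>\<phi> i x\<bar> \<le> real m" using m s0 unfolding b_def by linarith
          then show ?thesis by simp
        qed
        have p2: "\<bar>\<beta> i l x\<bar> \<le> real m" for i l
        proof -
          have "\<bar>\<beta> i l x\<bar> \<le> (\<Sum>l\<in>UNIV. \<bar>\<beta> i l x\<bar>)" by (intro member_le_sum) auto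
          also have "\<dots> \<le> (\<Sum>i\<in>UNIV. \<Sum>l\<in>UNIV. \<bar>\<beta> i l x\<bar>)"
            by (intro member_le_sum[of i UNIV "\<lambda>i. \<Sum>l\<in>UNIV. \<bar>\<beta> i l x\<bar>"]) (auto intro: sum_nonneg)
          finally show ?thesis using m s0 unfolding b_def by linarith
        qed
        have "\<gamma> (\<lambda>x. trunc (real (Suc m)) (\<phi> i x)) (\<lambda>x. trunc (real (Suc m)) (\<phi> j x)) x = \<Gamma> i j x" for i j
          by (rule 2[rule_format, OF p1 p1, symmetric])
        then have "x \<in> R m" unfolding R_def using 3 xS by (intro CollectI conjI allI p1 p2) auto
        then show False using 1 xS by blast
      qed
    qed
    then have AEn: "AE x in density M (indicator S). \<Phi> x \<notin> B"
      by (subst AE_density) (auto elim!: eventually_mono simp: indicator_def split: if_splits)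
    have "B \<in> null_sets (distr (density M (indicator S)) lborel \<Phi>)"
    proof (subst null_sets_distr_iff)
      show "\<Phi> -` B \<inter> space (density M (indicator S)) \<in> null_sets (density M (indicator S)) \<and> B \<in> sets lborel"
      proof
        have "\<Phi> -` B \<inter> space M \<in> sets M" by measurable
        moreover have "AE x in density M (indicator S). x \<notin> \<Phi> -` B \<inter> space M" using AEn by eventually_elim auto
        ultimately show "\<Phi> -` B \<inter> space (density M (indicator S)) \<in> null_sets (density M (indicator S))"
          using AE_iff_null_sets[of "\<Phi> -` B \<inter> space M" "density M (indicator S)"] by simp
      qed simp
    qed simp
    then show "B \<in> null_sets (distr (density M (indicator {x \<in> space M. 0 < det (carre_matrix \<gamma> \<phi> x)})) lborel (\<lambda>x. \<chi> i. \<phi> i x))"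
      unfolding S_def d_def \<Phi>_def[abs_def] .
  qed
qed

end
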